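(* Let $G$ and $H$ be Lie groups (possibly infinite-dimensional) with Lie algebras $\mathfrak g$ and $\mathfrak h$, each carrying the right invariant metric determined by a positive definite bounded inner product $\langle\,,\rangle$ on its Lie algebra. Let $B:G\times H\to H$ be a smooth action of $G$ on $H$ by group homomorphisms, with induced action $\beta:G\to\operatorname{Aut}\mathfrak h$, $\beta(g)=T_eB(g)$, and $b:\mathfrak g\to\operatorname{Der}\mathfrak h$ the differential of $\beta$ at the identity. Equip $G\ltimes H$ with the right invariant metric determined by $\langle(X_1,Y_1),(X_2,Y_2)\rangle=\langle X_1,X_2\rangle+\langle Y_1,Y_2\rangle$ on $\mathfrak g\ltimes\mathfrak h$. Suppose that the transposes $\operatorname{ad}(X)^\top$, $\operatorname{ad}(Y)^\top$ and $b(X)^\top$ exist for all $X\in\mathfrak g$, $Y\in\mathfrak h$, and that there exists a bilinear map $h:\mathfrak h\times\mathfrak h\to\mathfrak g$ with $\langle b(X)Y_1,Y_2\rangle=\langle h(Y_1,Y_2),X\rangle$ for all $X\in\mathfrak g$, $Y_1,Y_2\in\mathfrak h$. Assume moreover that the action $\beta$ of $G$ on $\mathfrak h$ is by isometries of $\langle\,,\rangle$ (the isometric case). Let $\tilde{\mathcal R}$, $\mathcal R^G$, $\mathcal R^H$ be the Riemannian curvatures of $G\ltimes H$, $G$, $H$. Then for all $X_1,X_2\in\mathfrak g$ and $Y_1,Y_2\in\mathfrak h$, the sign of the sectional curvature of $G\ltimes H$ (on the plane spanned by $(X_1,Y_1)$ and $(X_2,Y_2)$, when these are linearly independent) is the sign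 of $$\langle\tilde{\mathcal R}((X_1,Y_1),(X_2,Y_2))(X_2,Y_2),(X_1,Y_1)\rangle=\langle\mathcal R^G(X_1,X_2)X_2,X_1\rangle+\langle\mathcal R^H(Y_1,Y_2)Y_2,Y_1\rangle .$$
   Context: Semidirect product: the group operation on $G\ltimes H$ is $(g_1,h_1)(g_2,h_2)=(g_1g_2,\,h_1B(g_1)h_2)$, and its Lie algebra is $\mathfrak g\ltimes\mathfrak h$ with bracket $[(X_1,Y_1),(X_2,Y_2)]=([X_1,X_2],[Y_1,Y_2]+b(X_1)Y_2-b(X_2)Y_1)$. Conventions: $\operatorname{ad}(X)Y=[X,Y]$ is the usual Lie algebra bracket (from left invariant vector fields). $T^\top$ denotes the adjoint of a linear operator $T$ with respect to the relevant inner product, i.e. $\langle T^\top a,c\rangle=\langle a,Tc\rangle$. Curvature: for a Lie group $K$ with Lie algebra $\mathfrak k$ and right invariant metric determined by an inner product on $\mathfrak k$ for which all $\operatorname{ad}(X)^\top$ exist, identify $C^\infty(K,\mathfrak k)$ with vector fields on $K$ by $X\mapsto R_X$, $R_X(x)=T\rho_x.X(x)$ ($\rho_x$ = right translation by $x$). The Levi-Civita covariant derivative is then $\nabla_XY=dY.R_X+\frac12\operatorname{ad}(X)^\top Y+\frac12\operatorname{ad}(Y)^\top X-\frac12\operatorname{ad}(X)Y$. The Riemannian curvature $\mathcal R$ (evaluated at the identity, on elements of $\mathfrak k$) has the sign convention $\mathcal R(U,V)=[\nabla_U,\nabla_V]-\nabla_{[U,V]}$ for vector fields $U,V$, so that the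 sectional curvature is $\mathcal K(X,Y)=\dfrac{\langle\mathcal R(X,Y)Y,X\rangle}{\langle X,X\rangle\langle Y,Y\rangle-\langle X,Y\rangle^2}$. *)

theory Defs
  imports "HOL-Analysis.Analysis" "HOL-Algebra.Group"
begin

section \<open>Differential calculus in locally convex spaces\<close>

class locally_convex_space = real_vector + t2_space + topological_ab_group_add +
  assumes tendsto_scaleR_Pair:
      "((\<lambda>z. fst z *\<^sub>R snd z) \<longlongrightarrow> r *\<^sub>R x) (nhds r \<times>\<^sub>F nhds x)"
    and convex_nhds_zero:
      "open U \<Longrightarrow> 0 \<in> U \<Longrightarrow> \<exists>C. open C \<and> 0 \<in> C \<and> C \<subseteq> U \<and>
         (\<forall>x\<in>C. \<forall>y\<in>C. \<forall>u\<ge>0. \<forall>v\<ge>0. u + v = 1 \<longrightarrow> u *\<^sub>R x + v *\<^sub>R y \<in> C)"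

lemma tendsto_scaleR_lcs:
  fixes x :: "'a::locally_convex_space"
  assumes "(f \<longlongrightarrow> r) F" and "(g \<longlongrightarrow> x) F"
  shows "((\<lambda>z. f z *\<^sub>R g z) \<longlongrightarrow> r *\<^sub>R x) F"
  using filterlim_compose[OF tendsto_scaleR_Pair, of "\<lambda>z. (f z, g z)" r x F] assms
  by (simp add: nhds_prod[symmetric] tendsto_Pair)

lemma convex_nhds_zero':
  fixes U :: "'a::locally_convex_space set"
  assumes "open U" "0 \<in> U"
  shows "\<exists>C. open C \<and> convex C \<and> 0 \<in> C \<and> C \<subseteq> U"
  using convex_nhds_zero[OF assms] unfolding convex_def by blast

instance real_normed_vector \<subseteq> locally_convex_space
proof
  fix r :: real and x :: 'a
  show "((\<lambda>z. fst z *\<^sub>R snd z) \<longlongrightarrow> r *\<^sub>R x) (nhds r \<times>\<^sub>F nhds x)"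
    unfolding nhds_prod[symmetric]
    using tendsto_scaleR[OF tendsto_fst[OF filterlim_ident] tendsto_snd[OF filterlim_ident],
        of "(r, x)"] by simp
next
  fix U :: "'a set"
  assume "open U" "0 \<in> U"
  then obtain e where "e > 0" "ball 0 e \<subseteq> U"
    using open_contains_ball by blast
  moreover have "convex (ball (0::'a) e)"
    by (rule convex_ball)
  ultimately show "\<exists>C. open C \<and> 0 \<in> C \<and> C \<subseteq> U \<and>
      (\<forall>x\<in>C. \<forall>y\<in>C. \<forall>u\<ge>0. \<forall>v\<ge>0. u + v = 1 \<longrightarrow> u *\<^sub>R x + v *\<^sub>R y \<in> C)"
    unfolding convex_def by (metis centre_in_ball open_ball)
qed

instance prod :: (topological_monoid_add, topological_monoid_add) topological_monoid_add
proof
  fix a b :: "'a \<times> 'b"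
  have "((\<lambda>z. (fst (fst z) + fst (snd z), snd (fst z) + snd (snd z)))
      \<longlongrightarrow> (fst a + fst b, snd a + snd b)) (nhds (a, b))"
    using tendsto_fst[OF filterlim_ident, of "(a, b)"] tendsto_snd[OF filterlim_ident, of "(a, b)"]
    by (auto intro!: tendsto_intros)
  then show "LIM x (nhds a \<times>\<^sub>F nhds b). fst x + snd x :> nhds (a + b)"
    by (simp add: nhds_prod plus_prod_def)
qed

instance prod :: (topological_comm_monoid_add, topological_comm_monoid_add)
  topological_comm_monoid_add ..

instance prod :: (topological_group_add, topological_group_add) topological_group_add
proof
  fix a :: "'a \<times> 'b"
  have "((\<lambda>z. (- fst z, - snd z)) \<longlongrightarrow> (- fst a, - snd a)) (nhds a)"
    by (intro tendsto_intros filterlim_ident)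
  then show "(uminus \<longlongrightarrow> - a) (nhds a)"
    unfolding uminus_prod_def[abs_def] .
qed

instance prod :: (topological_ab_group_add, topological_ab_group_add) topological_ab_group_add ..

instance prod :: (locally_convex_space, locally_convex_space) locally_convex_space
proof
  fix r :: real and x :: "'a \<times> 'b"
  have id: "((\<lambda>z. z) \<longlongrightarrow> (r, x)) (nhds (r, x))"
    by (rule filterlim_ident)
  have 1: "((\<lambda>z. fst z *\<^sub>R fst (snd z)) \<longlongrightarrow> r *\<^sub>R fst x) (nhds (r, x))"
    using tendsto_scaleR_lcs[OF tendsto_fst[OF id] tendsto_fst[OF tendsto_snd[OF id]]] by simp
  have 2: "((\<lambda>z. fst z *\<^sub>R snd (snd z)) \<longlongrightarrow> r *\<^sub>R snd x) (nhds (r, x))"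
    using tendsto_scaleR_lcs[OF tendsto_fst[OF id] tendsto_snd[OF tendsto_snd[OF id]]] by simp
  show "((\<lambda>z. fst z *\<^sub>R snd z) \<longlongrightarrow> r *\<^sub>R x) (nhds r \<times>\<^sub>F nhds x)"
    using tendsto_Pair[OF 1 2] by (simp add: nhds_prod scaleR_prod_def)
next
  fix U :: "('a \<times> 'b) set"
  assume "open U" "0 \<in> U"
  then obtain A B where AB: "open A" "open B" "0 \<in> A \<times> B" "A \<times> B \<subseteq> U"
    by (rule open_prod_elim)
  obtain C where C: "open C" "convex C" "0 \<in> C" "C \<subseteq> A"
    using convex_nhds_zero'[of A] AB by (auto simp: zero_prod_def)
  obtain D where D: "open D" "convex D" "0 \<in> D" "D \<subseteq> B"
    using convex_nhds_zero'[of B] AB by (auto simp: zero_prod_def)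
  have "open (C \<times> D) \<and> 0 \<in> C \<times> D \<and> C \<times> D \<subseteq> U \<and> convex (C \<times> D)"
    using AB C D by (auto simp: zero_prod_def intro: open_Times convex_Times)
  then show "\<exists>C. open C \<and> 0 \<in> C \<and> C \<subseteq> U \<and>
      (\<forall>x\<in>C. \<forall>y\<in>C. \<forall>u\<ge>0. \<forall>v\<ge>0. u + v = 1 \<longrightarrow> u *\<^sub>R x + v *\<^sub>R y \<in> C)"
    unfolding convex_def by (elim conjE) (intro exI[of _ "C \<times> D"] conjI; assumption)
qed

definition has_dir_deriv ::
    "('a::locally_convex_space \<Rightarrow> 'b::locally_convex_space) \<Rightarrow> 'a \<Rightarrow> 'a \<Rightarrow> 'b \<Rightarrow> bool"
  where "has_dir_deriv f x v l \<longleftrightarrow>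
    ((\<lambda>t. inverse t *\<^sub>R (f (x + t *\<^sub>R v) - f x)) \<longlongrightarrow> l) (at (0::real))"

definition dir_deriv ::
    "('a::locally_convex_space \<Rightarrow> 'b::locally_convex_space) \<Rightarrow> 'a \<Rightarrow> 'a \<Rightarrow> 'b"
  where "dir_deriv f x v = (THE l. has_dir_deriv f x v l)"

text \<open>\<open>iter_deriv k f x v\<close> is \<open>d\<^sup>k f (x; v 0, \<dots>, v (k - 1))\<close>.\<close>

primrec iter_deriv ::
    "nat \<Rightarrow> ('a::locally_convex_space \<Rightarrow> 'b::locally_convex_space) \<Rightarrow> 'a \<Rightarrow> (nat \<Rightarrow> 'a) \<Rightarrow> 'b"
  where
    "iter_deriv 0 f x v = f x"
  | "iter_deriv (Suc k) f x v = dir_deriv (\<lambda>z. iter_deriv k f z v) x (v k)"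

text \<open>Smoothness in the sense of Michal--Bastiani (Hamilton, Milnor): all iterated directional
  derivatives exist and are jointly continuous in the point and the directions.
  As only finitely many directions enter, the product topology on sequences gives
  continuity on \<open>U \<times> 'a\<^sup>k\<close>.\<close>

definition smooth_on :: "'a::locally_convex_space set \<Rightarrow> ('a \<Rightarrow> 'b::locally_convex_space) \<Rightarrow> bool"
  where "smooth_on U f \<longleftrightarrow> open U \<and>
    (\<forall>k. (\<forall>x\<in>U. \<forall>v w. \<exists>l. has_dir_deriv (\<lambda>z. iter_deriv k f z v) x w l) \<and>
         continuous_on (U \<times> UNIV) (\<lambda>(x, v). iter_deriv k f x v))"


section \<open>Manifolds and Lie groups\<close>

text \<open>An atlas is given as a family of charts indexed by the points: \<open>A x\<close> is the pair of the
  domain and the coordinate map of a chart around \<open>x\<close>.  The tangent space at \<open>x\<close> is the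
  model space \<open>'a\<close>, a tangent vector at \<open>x\<close> being represented by its coordinates in the
  chart \<open>A x\<close>.\<close>

type_synonym ('p, 'a) charts = "'p \<Rightarrow> 'p set \<times> ('p \<Rightarrow> 'a)"

definition chart_dom :: "('p, 'a) charts \<Rightarrow> 'p \<Rightarrow> 'p set"
  where "chart_dom A x = fst (A x)"

definition chart :: "('p, 'a) charts \<Rightarrow> 'p \<Rightarrow> 'p \<Rightarrow> 'a"
  where "chart A x = snd (A x)"

definition chart_inv :: "('p, 'a) charts \<Rightarrow> 'p \<Rightarrow> 'a \<Rightarrow> 'p"
  where "chart_inv A x = inv_into (chart_dom A x) (chart A x)"

text \<open>The topology of the manifold is the one generated by the charts.  Separation is not
  required here: for Lie groups it holds automatically, because the charts make the group
  a \<open>T\<^sub>1\<close> topological group.\<close>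

definition manifold :: "'p set \<Rightarrow> ('p, 'a::locally_convex_space) charts \<Rightarrow> bool"
  where "manifold S A \<longleftrightarrow>
    (\<forall>x\<in>S. x \<in> chart_dom A x \<and> chart_dom A x \<subseteq> S \<and> inj_on (chart A x) (chart_dom A x) \<and>
       open (chart A x ` chart_dom A x)) \<and>
    (\<forall>x\<in>S. \<forall>y\<in>S. smooth_on (chart A x ` (chart_dom A x \<inter> chart_dom A y))
       (chart A y \<circ> chart_inv A x))"

definition smooth_map ::
    "'p set \<Rightarrow> ('p, 'a::locally_convex_space) charts \<Rightarrow>
     'q set \<Rightarrow> ('q, 'b::locally_convex_space) charts \<Rightarrow> ('p \<Rightarrow> 'q) \<Rightarrow> bool"
  where "smooth_map S A T B f \<longleftrightarrow>
    (\<forall>x\<in>S. f x \<in> T \<and>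
      (\<exists>W. W \<subseteq> chart A x ` chart_dom A x \<and> chart A x x \<in> W \<and>
           (\<forall>z\<in>W. f (chart_inv A x z) \<in> chart_dom B (f x)) \<and>
           smooth_on W (chart B (f x) \<circ> f \<circ> chart_inv A x)))"

definition prod_charts :: "('p, 'a) charts \<Rightarrow> ('q, 'b) charts \<Rightarrow> ('p \<times> 'q, 'a \<times> 'b) charts"
  where "prod_charts A B = (\<lambda>(x, y).
    (chart_dom A x \<times> chart_dom B y, map_prod (chart A x) (chart B y)))"

text \<open>Derivative at \<open>x\<close> of a vector valued function along a tangent vector \<open>v\<close> at \<open>x\<close>,
  and tangent map at \<open>x\<close> of a map between manifolds.\<close>

definition diff_at ::
    "('p, 'a::locally_convex_space) charts \<Rightarrow> ('p \<Rightarrow> 'b::locally_convex_space) \<Rightarrow> 'p \<Rightarrow> 'a \<Rightarrow> 'b"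
  where "diff_at A f x v = dir_deriv (f \<circ> chart_inv A x) (chart A x x) v"

definition tangent_map ::
    "('p, 'a::locally_convex_space) charts \<Rightarrow> ('q, 'b::locally_convex_space) charts \<Rightarrow>
     ('p \<Rightarrow> 'q) \<Rightarrow> 'p \<Rightarrow> 'a \<Rightarrow> 'b"
  where "tangent_map A B f x v = diff_at A (chart B (f x) \<circ> f) x v"

text \<open>Bracket of vector fields \<open>F\<close>, \<open>G\<close> at \<open>p\<close>, computed in the chart at \<open>p\<close>: the coordinate
  representation of \<open>G\<close> in this chart at a nearby point \<open>x\<close> is
  \<open>diff_at A (chart A p) x (G x)\<close>, and \<open>[F, G] = dG(F) - dF(G)\<close>.\<close>

definition vf_bracket ::
    "('p, 'a::locally_convex_space) charts \<Rightarrow> ('p \<Rightarrow> 'a) \<Rightarrow> ('p \<Rightarrow> 'a) \<Rightarrow> 'p \<Rightarrow> 'a"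
  where "vf_bracket A F G p =
    diff_at A (\<lambda>x. diff_at A (chart A p) x (G x)) p (F p) -
    diff_at A (\<lambda>x. diff_at A (chart A p) x (F x)) p (G p)"

record ('g, 'a) lie_gp = "'g monoid" +
  charts :: "('g, 'a) charts"

definition lie_group :: "('g, 'a::locally_convex_space) lie_gp \<Rightarrow> bool"
  where "lie_group K \<longleftrightarrow> group K \<and> manifold (carrier K) (charts K) \<and>
    smooth_map (carrier K \<times> carrier K) (prod_charts (charts K) (charts K)) (carrier K) (charts K)
      (\<lambda>(x, y). x \<otimes>\<^bsub>K\<^esub> y) \<and>
    smooth_map (carrier K) (charts K) (carrier K) (charts K) (\<lambda>x. inv\<^bsub>K\<^esub> x)"

definition left_field :: "('g, 'a::locally_convex_space) lie_gp \<Rightarrow> 'a \<Rightarrow> 'g \<Rightarrow> 'a"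
  where "left_field K X x = tangent_map (charts K) (charts K) (\<lambda>y. x \<otimes>\<^bsub>K\<^esub> y) \<one>\<^bsub>K\<^esub> X"

text \<open>The Lie algebra is the tangent space at the identity; \<open>ad K X Y = [X, Y]\<close>.\<close>

definition ad :: "('g, 'a::locally_convex_space) lie_gp \<Rightarrow> 'a \<Rightarrow> 'a \<Rightarrow> 'a"
  where "ad K X Y = vf_bracket (charts K) (left_field K X) (left_field K Y) \<one>\<^bsub>K\<^esub>"


section \<open>Right invariant metrics and their curvature\<close>

definition vn_bounded :: "'a::locally_convex_space set \<Rightarrow> bool"
  where "vn_bounded S \<longleftrightarrow> (\<forall>U. open U \<and> 0 \<in> U \<longrightarrow> (\<exists>r>0. S \<subseteq> (\<lambda>u. r *\<^sub>R u) ` U))"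

definition bounded_inner_product :: "('a::locally_convex_space \<Rightarrow> 'a \<Rightarrow> real) \<Rightarrow> bool"
  where "bounded_inner_product ip \<longleftrightarrow> bilinear ip \<and> (\<forall>X Y. ip X Y = ip Y X) \<and>
    (\<forall>X. X \<noteq> 0 \<longrightarrow> ip X X > 0) \<and>
    (\<forall>S T. vn_bounded S \<and> vn_bounded T \<longrightarrow> bounded ((\<lambda>(X, Y). ip X Y) ` (S \<times> T)))"

definition is_transpose :: "('a \<Rightarrow> 'a \<Rightarrow> real) \<Rightarrow> ('a \<Rightarrow> 'a) \<Rightarrow> ('a \<Rightarrow> 'a) \<Rightarrow> bool"
  where "is_transpose ip T S \<longleftrightarrow> (\<forall>a c. ip (S a) c = ip a (T c))"

definition has_transpose :: "('a \<Rightarrow> 'a \<Rightarrow> real) \<Rightarrow> ('a \<Rightarrow> 'a) \<Rightarrow> bool"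
  where "has_transpose ip T \<longleftrightarrow> (\<exists>S. is_transpose ip T S)"

definition transp :: "('a \<Rightarrow> 'a \<Rightarrow> real) \<Rightarrow> ('a \<Rightarrow> 'a) \<Rightarrow> 'a \<Rightarrow> 'a"
  where "transp ip T = (THE S. is_transpose ip T S)"

text \<open>Functions \<open>U\<close> from the group to its Lie algebra are identified with vector fields by
  right translation: \<open>right_field K U\<close> is \<open>R\<^sub>U\<close>, and \<open>right_coeff K\<close> is the inverse
  identification.\<close>

definition right_field :: "('g, 'a::locally_convex_space) lie_gp \<Rightarrow> ('g \<Rightarrow> 'a) \<Rightarrow> 'g \<Rightarrow> 'a"
  where "right_field K U x =
    tangent_map (charts K) (charts K) (\<lambda>y. y \<otimes>\<^bsub>K\<^esub> x) \<one>\<^bsub>K\<^esub> (U x)"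

definition right_coeff :: "('g, 'a::locally_convex_space) lie_gp \<Rightarrow> ('g \<Rightarrow> 'a) \<Rightarrow> 'g \<Rightarrow> 'a"
  where "right_coeff K F x =
    tangent_map (charts K) (charts K) (\<lambda>y. y \<otimes>\<^bsub>K\<^esub> (inv\<^bsub>K\<^esub> x)) x (F x)"

definition field_bracket ::
    "('g, 'a::locally_convex_space) lie_gp \<Rightarrow> ('g \<Rightarrow> 'a) \<Rightarrow> ('g \<Rightarrow> 'a) \<Rightarrow> 'g \<Rightarrow> 'a"
  where "field_bracket K U V =
    right_coeff K (vf_bracket (charts K) (right_field K U) (right_field K V))"

text \<open>The Levi-Civita covariant derivative of the right invariant metric determined by \<open>ip\<close>,
  in the right trivialization:
  \<open>\<nabla>\<^sub>X Y = dY.R\<^sub>X + 1/2 ad(X)\<^sup>T Y + 1/2 ad(Y)\<^sup>T X - 1/2 ad(X) Y\<close>.\<close>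

definition cov_deriv ::
    "('g, 'a::locally_convex_space) lie_gp \<Rightarrow> ('a \<Rightarrow> 'a \<Rightarrow> real) \<Rightarrow>
     ('g \<Rightarrow> 'a) \<Rightarrow> ('g \<Rightarrow> 'a) \<Rightarrow> 'g \<Rightarrow> 'a"
  where "cov_deriv K ip X Y x =
    diff_at (charts K) Y x (right_field K X x)
    + (1/2) *\<^sub>R transp ip (ad K (X x)) (Y x)
    + (1/2) *\<^sub>R transp ip (ad K (Y x)) (X x)
    - (1/2) *\<^sub>R ad K (X x) (Y x)"

definition curvature_field ::
    "('g, 'a::locally_convex_space) lie_gp \<Rightarrow> ('a \<Rightarrow> 'a \<Rightarrow> real) \<Rightarrow>
     ('g \<Rightarrow> 'a) \<Rightarrow> ('g \<Rightarrow> 'a) \<Rightarrow> ('g \<Rightarrow> 'a) \<Rightarrow> 'g \<Rightarrow> 'a"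
  where "curvature_field K ip U V W x =
    cov_deriv K ip U (cov_deriv K ip V W) x
    - cov_deriv K ip V (cov_deriv K ip U W) x
    - cov_deriv K ip (field_bracket K U V) W x"

text \<open>The curvature tensor at the identity; tangent vectors at the identity are extended to
  right invariant vector fields, i.e. to constant functions.\<close>

definition curvature ::
    "('g, 'a::locally_convex_space) lie_gp \<Rightarrow> ('a \<Rightarrow> 'a \<Rightarrow> real) \<Rightarrow> 'a \<Rightarrow> 'a \<Rightarrow> 'a \<Rightarrow> 'a"
  where "curvature K ip X Y Z = curvature_field K ip (\<lambda>_. X) (\<lambda>_. Y) (\<lambda>_. Z) \<one>\<^bsub>K\<^esub>"

definition sectional_curvature ::
    "('g, 'a::locally_convex_space) lie_gp \<Rightarrow> ('a \<Rightarrow> 'a \<Rightarrow> real) \<Rightarrow> 'a \<Rightarrow> 'a \<Rightarrow> real"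
  where "sectional_curvature K ip X Y =
    ip (curvature K ip X Y Y) X / (ip X X * ip Y Y - (ip X Y)\<^sup>2)"


section \<open>Semidirect products\<close>

definition smooth_action ::
    "('g, 'a::locally_convex_space) lie_gp \<Rightarrow> ('h, 'b::locally_convex_space) lie_gp \<Rightarrow>
     ('g \<Rightarrow> 'h \<Rightarrow> 'h) \<Rightarrow> bool"
  where "smooth_action G H B \<longleftrightarrow>
    (\<forall>g\<in>carrier G. B g \<in> hom H H) \<and>
    (\<forall>y\<in>carrier H. B \<one>\<^bsub>G\<^esub> y = y) \<and>
    (\<forall>g\<in>carrier G. \<forall>g'\<in>carrier G. \<forall>y\<in>carrier H. B (g \<otimes>\<^bsub>G\<^esub> g') y = B g (B g' y)) \<and>
    smooth_map (carrier G \<times> carrier H) (prod_charts (charts G) (charts H))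
      (carrier H) (charts H) (\<lambda>(g, y). B g y)"

definition semidirect ::
    "('g, 'a) lie_gp \<Rightarrow> ('h, 'b) lie_gp \<Rightarrow> ('g \<Rightarrow> 'h \<Rightarrow> 'h) \<Rightarrow> ('g \<times> 'h, 'a \<times> 'b) lie_gp"
  where "semidirect G H B =
    \<lparr> carrier = carrier G \<times> carrier H,
      mult = (\<lambda>(g\<^sub>1, h\<^sub>1) (g\<^sub>2, h\<^sub>2). (g\<^sub>1 \<otimes>\<^bsub>G\<^esub> g\<^sub>2, h\<^sub>1 \<otimes>\<^bsub>H\<^esub> B g\<^sub>1 h\<^sub>2)),
      one = (\<one>\<^bsub>G\<^esub>, \<one>\<^bsub>H\<^esub>),
      charts = prod_charts (charts G) (charts H) \<rparr>"

definition prod_ip ::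
    "('a \<Rightarrow> 'a \<Rightarrow> real) \<Rightarrow> ('b \<Rightarrow> 'b \<Rightarrow> real) \<Rightarrow> 'a \<times> 'b \<Rightarrow> 'a \<times> 'b \<Rightarrow> real"
  where "prod_ip ipG ipH = (\<lambda>(X\<^sub>1, Y\<^sub>1) (X\<^sub>2, Y\<^sub>2). ipG X\<^sub>1 X\<^sub>2 + ipH Y\<^sub>1 Y\<^sub>2)"

text \<open>\<open>\<beta>(g) = T\<^sub>e B(g)\<close>, and the differential \<open>b\<close> of \<open>\<beta>\<close> at the identity,
  taken pointwise on the Lie algebra of \<open>H\<close>.\<close>

definition induced_action ::
    "('h, 'b::locally_convex_space) lie_gp \<Rightarrow> ('g \<Rightarrow> 'h \<Rightarrow> 'h) \<Rightarrow> 'g \<Rightarrow> 'b \<Rightarrow> 'b"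
  where "induced_action H B g Y = tangent_map (charts H) (charts H) (B g) \<one>\<^bsub>H\<^esub> Y"

definition infinitesimal_action ::
    "('g, 'a::locally_convex_space) lie_gp \<Rightarrow> ('h, 'b::locally_convex_space) lie_gp \<Rightarrow>
     ('g \<Rightarrow> 'h \<Rightarrow> 'h) \<Rightarrow> 'a \<Rightarrow> 'b \<Rightarrow> 'b"
  where "infinitesimal_action G H B X Y =
    diff_at (charts G) (\<lambda>g. induced_action H B g Y) \<one>\<^bsub>G\<^esub> X"

end

theory Submission
  imports Defs
begin

text \<open>Curvature at the identity only involves constant functions into the Lie algebra, i.e. right
  invariant fields.  Their bracket is \<open>- [X, Y]\<close>, so the curvature is the algebraic expression
  \<open>D X (D Y Z) - D Y (D X Z) + D [X, Y] Z\<close> with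
  \<open>D X Y = 1/2 (ad(X)\<^sup>T Y + ad(Y)\<^sup>T X - [X, Y])\<close>.  For the semidirect product the second
  derivative of the multiplication in a chart gives the bracket of \<open>\<gg> \<ltimes> \<hh>\<close>; since \<open>b(X)\<close> is skew, \<open>h\<close> is
  antisymmetric and the connection becomes \<open>(D X\<^sub>1 X\<^sub>2, D Y\<^sub>1 Y\<^sub>2 - b(X\<^sub>1) Y\<^sub>2)\<close>.  As \<open>b(X)\<close> is a skew
  derivation it commutes with \<open>D\<close>, and as \<open>b\<close> is a representation its commutators cancel against
  \<open>b([X\<^sub>1, X\<^sub>2])\<close>, so the curvature tensor is the direct sum of the two curvature tensors.\<close>

section \<open>Differential calculus of class \<open>C\<^sup>1\<close> and \<open>C\<^sup>2\<close>\<close>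

text \<open>The model spaces are arbitrary locally convex spaces, so neither a norm nor a useful
  topology on spaces of operators is at hand; limit arguments rest on convex neighbourhoods and on
  joint continuity in point and direction. \<open>semidirect G H B\<close> is never shown to be a
  Lie group, which would involve derivatives of every order. Curvature at the identity sees two
  derivatives of the multiplication near the unit and no inverse but that of the unit, so it is
  computed in the weaker structure \<open>C2_group\<close>, which the semidirect product inherits by
  the chain rule. The action stays smooth, because the representation property of b involves third
  derivatives of it. The inner products are another obstacle: they are bounded on bounded sets,
  which in a general locally convex space does not make them continuous, so the isometry condition
  cannot be differentiated by the product rule. The map h supplies the transpose of ad on the
  semidirect product; \<open>transp\<close> is a definite description and says nothing before a
  transpose is known to exist.\<close>

lemma continuous_on_scaleR_lcs:
  fixes g :: "'a::topological_space \<Rightarrow> 'b::locally_convex_space"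
  assumes "continuous_on S f" "continuous_on S g"
  shows "continuous_on S (\<lambda>z. f z *\<^sub>R g z)"
  using assms unfolding continuous_on_def by (auto intro: tendsto_scaleR_lcs)

lemma open_scaleR_lcs:
  fixes C :: "'a::locally_convex_space set"
  assumes "open C" "r \<noteq> 0"
  shows "open ((\<lambda>z. r *\<^sub>R z) ` C)"
proof -
  have "(\<lambda>z. r *\<^sub>R z) ` C = (\<lambda>z. inverse r *\<^sub>R z) -` C"
    using assms(2) by (force simp: image_iff)
  then show ?thesis
    using open_vimage[OF assms(1), of "\<lambda>z. inverse r *\<^sub>R z"]
    by (simp add: continuous_on_scaleR_lcs)
qed

lemma convex_nhds:
  fixes U :: "'a::locally_convex_space set"
  assumes "open U" "x \<in> U"
  obtains C where "open C" "convex C" "x \<in> C" "C \<subseteq> U"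
proof -
  have "open ((\<lambda>z. x + z) -` U)"
    by (intro open_vimage assms continuous_intros)
  then obtain C where C: "open C" "convex C" "0 \<in> C" "C \<subseteq> (\<lambda>z. x + z) -` U"
    using convex_nhds_zero'[of "(\<lambda>z. x + z) -` U"] assms(2) by auto
  have "(\<lambda>z. x + z) ` C = (\<lambda>z. z - x) -` C"
    by (force simp: image_iff)
  moreover have "open ((\<lambda>z. z - x) -` C)"
    by (intro open_vimage C continuous_intros)
  ultimately have "open ((\<lambda>z. x + z) ` C)"
    by simp
  then show thesis
    using C by (intro that[of "(\<lambda>z. x + z) ` C"] convex_translation) force+
qed

section \<open>Directional derivatives\<close>

lemma has_dir_deriv_unique:
  "has_dir_deriv f x v l \<Longrightarrow> has_dir_deriv f x v m \<Longrightarrow> l = m"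
  unfolding has_dir_deriv_def by (rule tendsto_unique[OF trivial_limit_at])

lemma dir_derivI: "has_dir_deriv f x v l \<Longrightarrow> dir_deriv f x v = l"
  unfolding dir_deriv_def by (rule the_equality) (auto intro: has_dir_deriv_unique)

lemma tendsto_line:
  fixes x :: "'a::locally_convex_space"
  shows "((\<lambda>t. x + t *\<^sub>R v) \<longlongrightarrow> x) (at (0::real))"
proof -
  have "((\<lambda>t. x + t *\<^sub>R v) \<longlongrightarrow> x + 0 *\<^sub>R v) (at (0::real))"
    by (intro tendsto_intros tendsto_scaleR_lcs)
  then show ?thesis by simp
qed

lemma has_dir_deriv_transform:
  assumes "has_dir_deriv f x v l" "open U" "x \<in> U" "\<And>z. z \<in> U \<Longrightarrow> f z = g z"
  shows "has_dir_deriv g x v l"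
proof -
  have "\<forall>\<^sub>F t in at (0::real). x + t *\<^sub>R v \<in> U"
    by (rule topological_tendstoD[OF tendsto_line assms(2,3)])
  then have "\<forall>\<^sub>F t in at 0. inverse t *\<^sub>R (f (x + t *\<^sub>R v) - f x) = inverse t *\<^sub>R (g (x + t *\<^sub>R v) - g x)"
    by eventually_elim (simp add: assms(3,4))
  then show ?thesis
    using assms(1) unfolding has_dir_deriv_def by (rule Lim_transform_eventually[rotated])
qed

lemma dir_deriv_cong:
  assumes "open U" "x \<in> U" "\<And>z. z \<in> U \<Longrightarrow> f z = g z"
  shows "dir_deriv f x v = dir_deriv g x v"
proof -
  have "has_dir_deriv f x v l \<longleftrightarrow> has_dir_deriv g x v l" for l
    using has_dir_deriv_transform[OF _ assms(1,2), of f v l g]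
      has_dir_deriv_transform[OF _ assms(1,2), of g v l f] assms(3) by auto
  then have "has_dir_deriv f x v = has_dir_deriv g x v"
    by (intro ext)
  then show ?thesis
    unfolding dir_deriv_def by simp
qed

lemma has_dir_deriv_const: "has_dir_deriv (\<lambda>_. c) x v 0"
  unfolding has_dir_deriv_def by simp

lemma dir_deriv_const: "dir_deriv (\<lambda>_. c) x v = 0"
  by (rule dir_derivI[OF has_dir_deriv_const])

lemma has_dir_deriv_ident: "has_dir_deriv (\<lambda>z. z) x v v"
  unfolding has_dir_deriv_def
  by (rule Lim_transform_eventually[OF tendsto_const]) (auto simp: eventually_at_filter)

lemma has_dir_deriv_Pair:
  assumes "has_dir_deriv f x v l" "has_dir_deriv g x v m"
  shows "has_dir_deriv (\<lambda>z. (f z, g z)) x v (l, m)"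
  using tendsto_Pair[OF assms[unfolded has_dir_deriv_def]]
  unfolding has_dir_deriv_def by simp

lemma has_dir_deriv_fst:
  assumes "has_dir_deriv f x v l" shows "has_dir_deriv (\<lambda>z. fst (f z)) x v (fst l)"
  using tendsto_fst[OF assms[unfolded has_dir_deriv_def]]
  unfolding has_dir_deriv_def by (simp add: fst_diff fst_scaleR)

lemma has_dir_deriv_snd:
  assumes "has_dir_deriv f x v l" shows "has_dir_deriv (\<lambda>z. snd (f z)) x v (snd l)"
  using tendsto_snd[OF assms[unfolded has_dir_deriv_def]]
  unfolding has_dir_deriv_def by (simp add: snd_diff snd_scaleR)

lemma has_dir_deriv_diff:
  assumes "has_dir_deriv f x v l" "has_dir_deriv g x v m"
  shows "has_dir_deriv (\<lambda>z. f z - g z) x v (l - m)"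
  using tendsto_diff[OF assms[unfolded has_dir_deriv_def]]
  unfolding has_dir_deriv_def by (simp add: algebra_simps)

lemma has_dir_deriv_line:
  assumes "has_dir_deriv f (x + s *\<^sub>R v) v l"
  shows "has_dir_deriv (\<lambda>r. f (x + r *\<^sub>R v)) s 1 l"
  using assms unfolding has_dir_deriv_def by (simp add: algebra_simps)

text \<open>Bisection makes the Hahn--Banach theorem unnecessary here.\<close>

lemma mean_value_convex:
  fixes c :: "real \<Rightarrow> 'a::locally_convex_space"
  assumes "a \<le> b" and C: "open C" "convex C"
    and der: "\<And>t. a \<le> t \<Longrightarrow> t \<le> b \<Longrightarrow> \<exists>l\<in>C. has_dir_deriv c t 1 l"
  shows "\<exists>z\<in>C. c b - c a = (b - a) *\<^sub>R z"
proof -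
  define P where "P = (\<lambda>a b. \<exists>z\<in>C. c b - c a = (b - a) *\<^sub>R z)"
  \<comment> \<open>The mean slope over a union of adjacent intervals is the convex combination of
    the two mean slopes, weighted by the lengths.\<close>
  have trans: "P r t" if "P r s" "P s t" "r \<le> s" "s \<le> t" for r s t
  proof (cases "r = t")
    case True
    then show ?thesis using that by force
  next
    case False
    then have "t - r > 0" using that by simp
    from that obtain y z where yz: "y \<in> C" "c s - c r = (s - r) *\<^sub>R y" "z \<in> C" "c t - c s = (t - s) *\<^sub>R z"
      unfolding P_def by blast
    define w where "w = ((s - r) / (t - r)) *\<^sub>R y + ((t - s) / (t - r)) *\<^sub>R z"
    have "w \<in> C"
      unfolding w_def using C(2) yz that \<open>t - r > 0\<close>
      by (intro convexD) (auto simp flip: add_divide_distrib)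
    have "(t - r) *\<^sub>R w = (s - r) *\<^sub>R y + (t - s) *\<^sub>R z"
      using \<open>t - r > 0\<close> by (simp add: w_def scaleR_add_right)
    moreover have "c t - c r = (c s - c r) + (c t - c s)"
      by simp
    ultimately have "c t - c r = (t - r) *\<^sub>R w"
      using yz(2,4) by simp
    then show ?thesis
      using \<open>w \<in> C\<close> unfolding P_def by blast
  qed
  \<comment> \<open>A quotient with one endpoint at t lies in the open set C once the other endpoint
    is close, and \<open>trans\<close> joins the two sides of t. On a degenerate interval any
    element of C serves, for instance l.\<close>
  have local: "\<exists>d>0. \<forall>r s. r \<le> t \<and> t \<le> s \<and> s - r < d \<longrightarrow> P r s" if t: "a \<le> t" "t \<le> b" for t
  proof -
    obtain l where l: "l \<in> C" "has_dir_deriv c t 1 l"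
      using der[OF t] by blast
    have "\<forall>\<^sub>F h in at 0. inverse h *\<^sub>R (c (t + h *\<^sub>R 1) - c t) \<in> C"
      using l C(1) unfolding has_dir_deriv_def by (intro topological_tendstoD)
    then obtain d where d: "d > 0"
      "\<And>h. h \<noteq> 0 \<Longrightarrow> \<bar>h\<bar> < d \<Longrightarrow> inverse h *\<^sub>R (c (t + h) - c t) \<in> C"
      by (auto simp: eventually_at)
    have right: "P t s" if "t \<le> s" "s - t < d" for s
    proof (cases "s = t")
      case True
      then show ?thesis using l unfolding P_def by auto
    next
      case False
      then show ?thesis
        unfolding P_def using that d(2)[of "s - t"]
        by (intro bexI[of _ "inverse (s - t) *\<^sub>R (c s - c t)"]) auto
    qed
    have left: "P r t" if "r \<le> t" "t - r < d" for r
    proof (cases "r = t")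
      case True
      then show ?thesis using l unfolding P_def by auto
    next
      case False
      then have "inverse (r - t) *\<^sub>R (c r - c t) \<in> C"
        using that d(2)[of "r - t"] by auto
      moreover have "c t - c r = (t - r) *\<^sub>R inverse (r - t) *\<^sub>R (c r - c t)"
      proof -
        have "(t - r) * inverse (r - t) = -1"
          using False by (simp add: field_simps)
        then show ?thesis by simp
      qed
      ultimately show ?thesis unfolding P_def by blast
    qed
    show ?thesis
    proof (intro exI[of _ d] conjI allI impI)
      fix r s assume "r \<le> t \<and> t \<le> s \<and> s - r < d"
      then show "P r s"
        using trans[OF left right, of r s] by auto
    qed (fact d(1))
  qed
  have "P a b"
    using assms(1) trans local by (rule Bolzano)
  then show ?thesis
    unfolding P_def .
qed

text \<open>The quotient does not depend on the order of the endpoints, so negative t is reduced to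
  the interval from t to 0. The parameter r in [0, 1] matches the convex combinations by which the
  intermediate points are later located.\<close>

lemma mean_value_quotient:
  fixes c :: "real \<Rightarrow> 'a::locally_convex_space"
  assumes "t \<noteq> 0" and C: "open C" "convex C"
    and der: "\<And>r. 0 \<le> r \<Longrightarrow> r \<le> 1 \<Longrightarrow> \<exists>l\<in>C. has_dir_deriv c (r * t) 1 l"
  shows "inverse t *\<^sub>R (c t - c 0) \<in> C"
proof -
  have *: "\<exists>l\<in>C. has_dir_deriv c s 1 l" if "0 \<le> s / t" "s / t \<le> 1" for s
    using der[of "s / t"] that assms(1) by auto
  have "\<exists>z\<in>C. c t - c 0 = t *\<^sub>R z"
  proof (cases "t > 0")
    case True
    then show ?thesis
      using mean_value_convex[of 0 t C c] C * by auto
  next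
    case False
    then have "t < 0" using assms(1) by simp
    then have "\<exists>z\<in>C. c 0 - c t = (0 - t) *\<^sub>R z"
      using C by (intro mean_value_convex *) (auto simp: divide_simps)
    then obtain z where "z \<in> C" "c 0 - c t = (0 - t) *\<^sub>R z"
      by blast
    then have "c t - c 0 = t *\<^sub>R z"
      by (simp add: algebra_simps)
    then show ?thesis
      using \<open>z \<in> C\<close> by blast
  qed
  then show ?thesis
    using assms(1) by auto
qed

text \<open>The common source of the chain rule, of additivity of derivatives and of the step to
  class C2: base point, direction and a parameter may all move while t tends to 0. Near the limit
  the derivatives lie in a convex neighbourhood C of \<open>D p x v\<close>, and the mean value
  lemma puts the quotients into the same C.\<close>

lemma strict_quotient_param:
  fixes F :: "'p::topological_space \<Rightarrow> 'a::locally_convex_space \<Rightarrow> 'b::locally_convex_space"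
  assumes "open U" "x \<in> U"
    and der: "\<And>p y v. y \<in> U \<Longrightarrow> has_dir_deriv (F p) y v (D p y v)"
    and cont: "continuous_on (UNIV \<times> U \<times> UNIV) (\<lambda>(p, y, v). D p y v)"
    and lim: "(p' \<longlongrightarrow> p) \<F>" "(y \<longlongrightarrow> x) \<F>" "(w \<longlongrightarrow> v) \<F>" "filterlim t (at (0::real)) \<F>"
  shows "((\<lambda>n. inverse (t n) *\<^sub>R (F (p' n) (y n + t n *\<^sub>R w n) - F (p' n) (y n)))
           \<longlongrightarrow> D p x v) \<F>"
proof (rule topological_tendstoI)
  fix O' assume O': "open O'" "D p x v \<in> O'"
  then obtain C where C: "open C" "convex C" "D p x v \<in> C" "C \<subseteq> O'"
    by (rule convex_nhds)
  have "open ((\<lambda>(p, y, v). D p y v) -` C \<inter> UNIV \<times> U \<times> UNIV)"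
    by (intro continuous_on_open_vimage[THEN iffD1, rule_format] open_Times open_UNIV assms(1) cont C(1))
  moreover have "(p, x, v) \<in> (\<lambda>(p, y, v). D p y v) -` C \<inter> UNIV \<times> U \<times> UNIV"
    using C assms(2) by simp
  ultimately obtain N1 N' where N1: "open N1" "open N'" "(p, x, v) \<in> N1 \<times> N'"
      "N1 \<times> N' \<subseteq> (\<lambda>(p, y, v). D p y v) -` C \<inter> UNIV \<times> U \<times> UNIV"
    by (rule open_prod_elim)
  obtain N2 N3 where N2: "open N2" "open N3" "(x, v) \<in> N2 \<times> N3" "N2 \<times> N3 \<subseteq> N'"
    using open_prod_elim[of N' "(x, v)"] N1 by auto
  \<comment> \<open>Convexity of A keeps the whole segment in the region of controlled derivatives
    as soon as its endpoints are in A.\<close>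
  obtain A where A: "open A" "convex A" "x \<in> A" "A \<subseteq> N2"
    using convex_nhds[of N2 x] N2 by auto
  have t0: "(t \<longlongrightarrow> 0) \<F>"
    using lim(4) unfolding filterlim_at by simp
  have "((\<lambda>n. y n + t n *\<^sub>R w n) \<longlongrightarrow> x + 0 *\<^sub>R v) \<F>"
    by (intro tendsto_intros tendsto_scaleR_lcs lim t0)
  then have "\<forall>\<^sub>F n in \<F>. y n + t n *\<^sub>R w n \<in> A"
    using A by (intro topological_tendstoD) auto
  moreover have "\<forall>\<^sub>F n in \<F>. y n \<in> A" "\<forall>\<^sub>F n in \<F>. w n \<in> N3" "\<forall>\<^sub>F n in \<F>. p' n \<in> N1"
    using A(3) N1(3) N2(3)
    by (auto intro: topological_tendstoD[OF lim(2) A(1)] topological_tendstoD[OF lim(3) N2(2)]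
        topological_tendstoD[OF lim(1) N1(1)])
  moreover have "\<forall>\<^sub>F n in \<F>. t n \<noteq> 0"
    using lim(4) unfolding filterlim_at by simp
  ultimately show "\<forall>\<^sub>F n in \<F>. inverse (t n) *\<^sub>R (F (p' n) (y n + t n *\<^sub>R w n) - F (p' n) (y n)) \<in> O'"
  proof eventually_elim
    case (elim n)
    have "\<exists>l\<in>C. has_dir_deriv (\<lambda>r. F (p' n) (y n + r *\<^sub>R w n)) (r * t n) 1 l" if r: "0 \<le> r" "r \<le> 1" for r
    proof (intro bexI has_dir_deriv_line)
      have "(1 - r) *\<^sub>R y n + r *\<^sub>R (y n + t n *\<^sub>R w n) \<in> A"
        using A(2) elim r by (intro convexD) auto
      also have "(1 - r) *\<^sub>R y n + r *\<^sub>R (y n + t n *\<^sub>R w n) = y n + (r * t n) *\<^sub>R w n"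
        by (simp add: algebra_simps)
      finally have *: "(p' n, y n + (r * t n) *\<^sub>R w n, w n) \<in> (\<lambda>(p, y, v). D p y v) -` C \<inter> UNIV \<times> U \<times> UNIV"
        using A(4) N1(4) N2(4) elim by blast
      then show "has_dir_deriv (F (p' n)) (y n + (r * t n) *\<^sub>R w n) (w n) (D (p' n) (y n + (r * t n) *\<^sub>R w n) (w n))"
        by (intro der) auto
      show "D (p' n) (y n + (r * t n) *\<^sub>R w n) (w n) \<in> C"
        using * by simp
    qed
    then have "inverse (t n) *\<^sub>R (F (p' n) (y n + t n *\<^sub>R w n) - F (p' n) (y n + 0 *\<^sub>R w n)) \<in> C"
      using elim C by (intro mean_value_quotient)
    then show ?case
      using C(4) by auto
  qed
qed

section \<open>Maps of class C1\<close>

text \<open>Joint continuity in point and direction stands in for continuity of the derivative as an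
  operator valued map. Existence of the derivative is a separate clause because
  \<open>dir_deriv\<close> is a definite description.\<close>

definition C1_on :: "'a::locally_convex_space set \<Rightarrow> ('a \<Rightarrow> 'b::locally_convex_space) \<Rightarrow> bool"
  where "C1_on U f \<longleftrightarrow> open U \<and> continuous_on U f \<and> (\<forall>x\<in>U. \<forall>v. has_dir_deriv f x v (dir_deriv f x v)) \<and>
    continuous_on (U \<times> UNIV) (\<lambda>(x, v). dir_deriv f x v)"

lemma C1_onI:
  assumes "open U" "continuous_on U f" "\<And>x v. x \<in> U \<Longrightarrow> has_dir_deriv f x v (D x v)"
    and "continuous_on (U \<times> UNIV) (\<lambda>(x, v). D x v)"
  shows "C1_on U f"
proof -
  have *: "dir_deriv f x v = D x v" if "x \<in> U" for x v
    using that by (intro dir_derivI assms(3))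
  have "continuous_on (U \<times> UNIV) (\<lambda>(x, v). dir_deriv f x v)"
    using assms(4) * by (subst continuous_on_cong[OF refl, of _ _ "\<lambda>(x, v). D x v"]) auto
  with * show ?thesis
    unfolding C1_on_def using assms by auto
qed

lemma C1_on_has_dir_deriv: "C1_on U f \<Longrightarrow> x \<in> U \<Longrightarrow> has_dir_deriv f x v (dir_deriv f x v)"
  unfolding C1_on_def by blast

lemma C1_on_open: "C1_on U f \<Longrightarrow> open U"
  unfolding C1_on_def by blast

lemma C1_on_subset: "C1_on U f \<Longrightarrow> open V \<Longrightarrow> V \<subseteq> U \<Longrightarrow> C1_on V f"
  unfolding C1_on_def by (meson Sigma_mono continuous_on_subset order_refl subset_iff)

lemma C1_on_cong:
  assumes "C1_on U f" "\<And>x. x \<in> U \<Longrightarrow> f x = g x"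
  shows "C1_on U g"
proof (rule C1_onI)
  show "open U" using assms(1) by (rule C1_on_open)
  show "continuous_on U g"
    using assms unfolding C1_on_def by (auto cong: continuous_on_cong)
  show "continuous_on (U \<times> UNIV) (\<lambda>(x, v). dir_deriv f x v)"
    using assms unfolding C1_on_def by auto
  show "has_dir_deriv g x v (dir_deriv f x v)" if "x \<in> U" for x v
    using has_dir_deriv_transform[OF C1_on_has_dir_deriv[OF assms(1) that] \<open>open U\<close> that] assms(2) .
qed

lemma C1_on_strict_quotient:
  assumes "C1_on U f" "x \<in> U"
    and lim: "(y \<longlongrightarrow> x) \<F>" "(w \<longlongrightarrow> v) \<F>" "filterlim t (at (0::real)) \<F>"
  shows "((\<lambda>n. inverse (t n) *\<^sub>R (f (y n + t n *\<^sub>R w n) - f (y n))) \<longlongrightarrow> dir_deriv f x v) \<F>"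
proof (rule strict_quotient_param[where F = "\<lambda>_::real. f" and D = "\<lambda>_. dir_deriv f" and p' = "\<lambda>_. 0" and U = U])
  have "continuous_on (U \<times> UNIV) (\<lambda>(y, v). dir_deriv f y v)"
    using assms(1) unfolding C1_on_def by blast
  then have "continuous_on (UNIV \<times> U \<times> UNIV) (\<lambda>z::real \<times> 'a \<times> 'a. (\<lambda>(y, v). dir_deriv f y v) (snd z))"
    by (rule continuous_on_compose2) (auto intro: continuous_intros)
  then show "continuous_on (UNIV \<times> U \<times> UNIV) (\<lambda>(_::real, y, v). dir_deriv f y v)"
    by (simp add: case_prod_unfold)
qed (use assms in \<open>auto intro: C1_on_open C1_on_has_dir_deriv\<close>)

lemma filterlim_ident_at_0: "filterlim (\<lambda>t. t) (at 0) (at (0::real))"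
  by (rule filterlim_ident)

text \<open>The inner map needs no more than one directional derivative: with w(t) its difference
  quotient, its value at x + t v is g x + t w(t), and the outer map tolerates a moving
  direction.\<close>

lemma has_dir_deriv_compose:
  assumes "C1_on U f" "g x \<in> U" "has_dir_deriv g x v l"
  shows "has_dir_deriv (\<lambda>z. f (g z)) x v (dir_deriv f (g x) l)"
proof -
  have "((\<lambda>t. inverse t *\<^sub>R (f (g x + t *\<^sub>R (inverse t *\<^sub>R (g (x + t *\<^sub>R v) - g x))) - f (g x)))
      \<longlongrightarrow> dir_deriv f (g x) l) (at 0)"
    using assms unfolding has_dir_deriv_def
    by (intro C1_on_strict_quotient[where y = "\<lambda>_. g x"] tendsto_const filterlim_ident_at_0) auto
  then show ?thesis
    unfolding has_dir_deriv_def
    by (rule Lim_transform_eventually) (auto simp: eventually_at_filter)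
qed

lemma dir_deriv_compose:
  assumes "C1_on U f" "g x \<in> U" "C1_on V g" "x \<in> V"
  shows "dir_deriv (\<lambda>z. f (g z)) x v = dir_deriv f (g x) (dir_deriv g x v)"
  by (rule dir_derivI[OF has_dir_deriv_compose[OF assms(1,2) C1_on_has_dir_deriv[OF assms(3,4)]]])

text \<open>The increment along v + w is split into one along v from x and one along w from the
  moving point x + t v; the second is a strict quotient.\<close>

lemma dir_deriv_add_direction:
  assumes "C1_on U f" "x \<in> U"
  shows "dir_deriv f x (v + w) = dir_deriv f x v + dir_deriv f x w"
proof (rule dir_derivI)
  have "((\<lambda>t. inverse t *\<^sub>R (f ((x + t *\<^sub>R v) + t *\<^sub>R w) - f (x + t *\<^sub>R v))) \<longlongrightarrow> dir_deriv f x w) (at 0)"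
    by (intro C1_on_strict_quotient[OF assms] tendsto_const filterlim_ident_at_0 tendsto_line)
  from tendsto_add[OF C1_on_has_dir_deriv[OF assms, of v, unfolded has_dir_deriv_def] this]
  show "has_dir_deriv f x (v + w) (dir_deriv f x v + dir_deriv f x w)"
    unfolding has_dir_deriv_def by (simp add: algebra_simps)
qed

lemma dir_deriv_scaleR_direction:
  assumes "C1_on U f" "x \<in> U"
  shows "dir_deriv f x (r *\<^sub>R v) = r *\<^sub>R dir_deriv f x v"
proof (cases "r = 0")
  case True
  then show ?thesis
    by (intro dir_derivI) (simp add: has_dir_deriv_def)
next
  case False
  have "filterlim (\<lambda>t. t * r) (at 0) (at (0::real))"
    unfolding filterlim_at using False
    by (auto simp: eventually_at_filter intro: tendsto_eq_intros)
  then have "((\<lambda>t. r *\<^sub>R inverse (t * r) *\<^sub>R (f (x + (t * r) *\<^sub>R v) - f x)) \<longlongrightarrow> r *\<^sub>R dir_deriv f x v) (at 0)"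
    by (intro C1_on_strict_quotient[OF assms, where y = "\<lambda>_. x"] tendsto_scaleR_lcs tendsto_const)
  moreover have "r * (inverse t * inverse r) = inverse t" for t
    using False by simp
  ultimately show ?thesis
    using False by (intro dir_derivI) (simp add: has_dir_deriv_def)
qed

lemma dir_deriv_zero_direction: "dir_deriv f x 0 = 0"
  by (intro dir_derivI) (simp add: has_dir_deriv_def)

lemma linear_dir_deriv: "C1_on U f \<Longrightarrow> x \<in> U \<Longrightarrow> linear (dir_deriv f x)"
  by (intro linearI dir_deriv_add_direction dir_deriv_scaleR_direction)

lemma C1_on_continuous: "C1_on U f \<Longrightarrow> continuous_on U f"
  unfolding C1_on_def by blast

lemma continuous_on_dir_deriv: "C1_on U f \<Longrightarrow> continuous_on (U \<times> UNIV) (\<lambda>(x, v). dir_deriv f x v)"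
  unfolding C1_on_def by blast

lemma C1_on_compose:
  assumes "C1_on U f" "C1_on V g"
  shows "C1_on (g -` U \<inter> V) (\<lambda>z. f (g z))"
proof (rule C1_onI)
  show "open (g -` U \<inter> V)"
    by (intro continuous_on_open_vimage[THEN iffD1, rule_format] C1_on_continuous[OF assms(2)]
        C1_on_open[OF assms(1)] C1_on_open[OF assms(2)])
  have g: "continuous_on (g -` U \<inter> V) g"
    using C1_on_continuous[OF assms(2)] by (rule continuous_on_subset) auto
  show "continuous_on (g -` U \<inter> V) (\<lambda>z. f (g z))"
    using C1_on_continuous[OF assms(1)] g by (rule continuous_on_compose2) auto
  show "has_dir_deriv (\<lambda>z. f (g z)) x v (dir_deriv f (g x) (dir_deriv g x v))" if "x \<in> g -` U \<inter> V" for x v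
    using that by (intro has_dir_deriv_compose[OF assms(1)] C1_on_has_dir_deriv[OF assms(2)]) auto
  have "continuous_on ((g -` U \<inter> V) \<times> UNIV) (\<lambda>z. (\<lambda>(x, v). dir_deriv f x v) (g (fst z), (\<lambda>(x, v). dir_deriv g x v) z))"
  proof (rule continuous_on_compose2[OF continuous_on_dir_deriv[OF assms(1)] continuous_on_Pair])
    show "continuous_on ((g -` U \<inter> V) \<times> UNIV) (\<lambda>z. g (fst z))"
      by (rule continuous_on_compose2[OF g]) (auto intro: continuous_intros)
    show "continuous_on ((g -` U \<inter> V) \<times> UNIV) (\<lambda>(x, v). dir_deriv g x v)"
      by (rule continuous_on_subset[OF continuous_on_dir_deriv[OF assms(2)]]) auto
  qed auto
  then show "continuous_on ((g -` U \<inter> V) \<times> UNIV) (\<lambda>(x, v). dir_deriv f (g x) (dir_deriv g x v))"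
    by (simp add: case_prod_unfold)
qed

lemma C1_on_Pair:
  assumes "C1_on U f" "C1_on U g"
  shows "C1_on U (\<lambda>z. (f z, g z))"
proof (rule C1_onI)
  show "open U" "continuous_on U (\<lambda>z. (f z, g z))"
    using assms by (auto intro: C1_on_open continuous_on_Pair C1_on_continuous)
  show "has_dir_deriv (\<lambda>z. (f z, g z)) x v (dir_deriv f x v, dir_deriv g x v)" if "x \<in> U" for x v
    using that by (intro has_dir_deriv_Pair C1_on_has_dir_deriv[OF assms(1)] C1_on_has_dir_deriv[OF assms(2)])
  show "continuous_on (U \<times> UNIV) (\<lambda>(x, v). (dir_deriv f x v, dir_deriv g x v))"
    using continuous_on_Pair[OF continuous_on_dir_deriv[OF assms(1)] continuous_on_dir_deriv[OF assms(2)]]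
    by (simp add: case_prod_unfold)
qed

lemma has_dir_deriv_linear: "linear f \<Longrightarrow> has_dir_deriv f x v (f v)"
  unfolding has_dir_deriv_def
  by (intro Lim_transform_eventually[OF tendsto_const]) (auto simp: eventually_at_filter linear_add linear_scale)

lemma dir_deriv_linear: "linear f \<Longrightarrow> dir_deriv f x v = f v"
  by (rule dir_derivI[OF has_dir_deriv_linear])

lemma C1_on_linear:
  assumes "linear f" "continuous_on UNIV f" "open U"
  shows "C1_on U f"
proof (rule C1_onI)
  show "continuous_on U f" using assms(2) by (rule continuous_on_subset) simp
  show "has_dir_deriv f x v (f v)" for x v
    by (rule has_dir_deriv_linear[OF assms(1)])
  show "continuous_on (U \<times> UNIV) (\<lambda>(x, v). f v)"
    using continuous_on_compose2[OF assms(2) continuous_on_snd[OF continuous_on_id], of "U \<times> UNIV"]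
    by (simp add: case_prod_unfold)
qed (fact assms(3))

lemma C1_on_const: "open U \<Longrightarrow> C1_on U (\<lambda>_. c)"
  by (rule C1_onI[where D = "\<lambda>_ _. 0"]) (auto intro: has_dir_deriv_const simp: case_prod_unfold)

section \<open>Maps of class C2\<close>

text \<open>The derivative is regarded as one map on the tangent bundle U x UNIV, so that the chain
  rule for class C2 is the C1 chain rule applied to tangent maps.\<close>

definition C2_on :: "'a::locally_convex_space set \<Rightarrow> ('a \<Rightarrow> 'b::locally_convex_space) \<Rightarrow> bool"
  where "C2_on U f \<longleftrightarrow> C1_on U f \<and> C1_on (U \<times> UNIV) (\<lambda>z. dir_deriv f (fst z) (snd z))"

lemma C2_on_C1: "C2_on U f \<Longrightarrow> C1_on U f"
  unfolding C2_on_def by blast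

lemma C2_on_open: "C2_on U f \<Longrightarrow> open U"
  by (intro C1_on_open C2_on_C1)

lemma C2_on_subset: "C2_on U f \<Longrightarrow> open V \<Longrightarrow> V \<subseteq> U \<Longrightarrow> C2_on V f"
  unfolding C2_on_def
  using C1_on_subset[of U f V] C1_on_subset[of "U \<times> UNIV" "\<lambda>z. dir_deriv f (fst z) (snd z)" "V \<times> UNIV"]
  by (auto intro: open_Times)

lemma C2_on_cong:
  assumes "C2_on U f" "\<And>x. x \<in> U \<Longrightarrow> f x = g x"
  shows "C2_on U g"
  unfolding C2_on_def
proof
  show "C1_on U g"
    using C1_on_cong[OF C2_on_C1[OF assms(1)]] assms(2) .
  show "C1_on (U \<times> UNIV) (\<lambda>z. dir_deriv g (fst z) (snd z))"
  proof (rule C1_on_cong)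
    show "C1_on (U \<times> UNIV) (\<lambda>z. dir_deriv f (fst z) (snd z))"
      using assms(1) unfolding C2_on_def by blast
    show "dir_deriv f (fst z) (snd z) = dir_deriv g (fst z) (snd z)" if "z \<in> U \<times> UNIV" for z
      using that assms(2) by (intro dir_deriv_cong[OF C2_on_open[OF assms(1)]]) auto
  qed
qed

lemma linear_fst_prod: "linear (fst :: 'a::real_vector \<times> 'b::real_vector \<Rightarrow> 'a)"
  by (rule linearI) (simp_all add: fst_add fst_scaleR)

lemma linear_snd_prod: "linear (snd :: 'a::real_vector \<times> 'b::real_vector \<Rightarrow> 'b)"
  by (rule linearI) (simp_all add: snd_add snd_scaleR)

lemma C1_on_fst_compose:
  assumes "C1_on U f"
  shows "C1_on (U \<times> UNIV) (\<lambda>z::'a::locally_convex_space \<times> 'b::locally_convex_space. f (fst z))"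
proof -
  have "C1_on UNIV (fst :: 'a \<times> 'b \<Rightarrow> 'a)"
    by (intro C1_on_linear linear_fst_prod continuous_on_fst continuous_on_id open_UNIV)
  from C1_on_compose[OF assms this] show ?thesis
    by (simp add: vimage_fst)
qed

lemma C2_on_compose:
  assumes "C2_on U f" "C2_on V g"
  shows "C2_on (g -` U \<inter> V) (\<lambda>z. f (g z))"
  unfolding C2_on_def
proof
  show "C1_on (g -` U \<inter> V) (\<lambda>z. f (g z))"
    by (intro C1_on_compose C2_on_C1 assms)
  have "C1_on (V \<times> UNIV) (\<lambda>z. (g (fst z), dir_deriv g (fst z) (snd z)))"
    using assms(2) unfolding C2_on_def by (intro C1_on_Pair C1_on_fst_compose) auto
  moreover have "C1_on (U \<times> UNIV) (\<lambda>z. dir_deriv f (fst z) (snd z))"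
    using assms(1) unfolding C2_on_def by blast
  ultimately have "C1_on ((\<lambda>z. (g (fst z), dir_deriv g (fst z) (snd z))) -` (U \<times> UNIV) \<inter> V \<times> UNIV)
      (\<lambda>z. dir_deriv f (g (fst z)) (dir_deriv g (fst z) (snd z)))"
    using C1_on_compose[of "U \<times> UNIV" "\<lambda>z. dir_deriv f (fst z) (snd z)" "V \<times> UNIV"
        "\<lambda>z. (g (fst z), dir_deriv g (fst z) (snd z))"] by simp
  also have "(\<lambda>z. (g (fst z), dir_deriv g (fst z) (snd z))) -` (U \<times> UNIV) \<inter> V \<times> UNIV = (g -` U \<inter> V) \<times> UNIV"
    by auto
  finally show "C1_on ((g -` U \<inter> V) \<times> UNIV) (\<lambda>z. dir_deriv (\<lambda>z. f (g z)) (fst z) (snd z))"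
  proof (rule C1_on_cong)
    fix z assume "z \<in> (g -` U \<inter> V) \<times> (UNIV :: 'c set)"
    then show "dir_deriv f (g (fst z)) (dir_deriv g (fst z) (snd z)) = dir_deriv (\<lambda>z. f (g z)) (fst z) (snd z)"
      by (subst dir_deriv_compose[OF C2_on_C1[OF assms(1)] _ C2_on_C1[OF assms(2)]]) auto
  qed
qed

lemma C2_on_Pair:
  assumes "C2_on U f" "C2_on U g"
  shows "C2_on U (\<lambda>z. (f z, g z))"
  unfolding C2_on_def
proof
  show "C1_on U (\<lambda>z. (f z, g z))"
    using assms by (intro C1_on_Pair C2_on_C1)
  have "C1_on (U \<times> UNIV) (\<lambda>z. (dir_deriv f (fst z) (snd z), dir_deriv g (fst z) (snd z)))"
    using assms unfolding C2_on_def by (intro C1_on_Pair) auto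
  then show "C1_on (U \<times> UNIV) (\<lambda>z. dir_deriv (\<lambda>z. (f z, g z)) (fst z) (snd z))"
  proof (rule C1_on_cong)
    fix z :: "'a \<times> 'a" assume "z \<in> U \<times> UNIV"
    then show "(dir_deriv f (fst z) (snd z), dir_deriv g (fst z) (snd z)) = dir_deriv (\<lambda>z. (f z, g z)) (fst z) (snd z)"
      by (intro dir_derivI[symmetric] has_dir_deriv_Pair C1_on_has_dir_deriv[OF C2_on_C1[OF assms(1)]]
          C1_on_has_dir_deriv[OF C2_on_C1[OF assms(2)]]) auto
  qed
qed

lemma C2_on_linear:
  assumes "linear f" "continuous_on UNIV f" "open U"
  shows "C2_on U f"
  unfolding C2_on_def
proof
  show "C1_on U f"
    by (rule C1_on_linear[OF assms])
  have "continuous_on UNIV (\<lambda>z::'a \<times> 'a. f (snd z))"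
    using continuous_on_compose2[OF assms(2) continuous_on_snd[OF continuous_on_id]] by simp
  then have "C1_on (U \<times> UNIV) (\<lambda>z::'a \<times> 'a. f (snd z))"
    using assms by (intro C1_on_linear linear_compose[OF linear_snd_prod assms(1), unfolded o_def] open_Times) auto
  then show "C1_on (U \<times> UNIV) (\<lambda>z. dir_deriv f (fst z) (snd z))"
    by (simp add: dir_deriv_linear[OF assms(1)])
qed

lemma C2_on_const: "open U \<Longrightarrow> C2_on U (\<lambda>_. c)"
  unfolding C2_on_def by (simp add: dir_deriv_const C1_on_const open_Times)

lemma C2_on_fst: "open U \<Longrightarrow> C2_on U fst"
  by (intro C2_on_linear linear_fst_prod continuous_on_fst continuous_on_id)

lemma C2_on_snd: "open U \<Longrightarrow> C2_on U snd"
  by (intro C2_on_linear linear_snd_prod continuous_on_snd continuous_on_id)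

lemma C2_on_ident: "open U \<Longrightarrow> C2_on U (\<lambda>z. z)"
  by (intro C2_on_linear linear_ident continuous_on_id)

section \<open>Second derivatives and their symmetry\<close>

definition second_deriv ::
    "('a::locally_convex_space \<Rightarrow> 'b::locally_convex_space) \<Rightarrow> 'a \<Rightarrow> 'a \<Rightarrow> 'a \<Rightarrow> 'b"
  where "second_deriv f x v w = dir_deriv (\<lambda>z. dir_deriv f z v) x w"

lemma second_deriv_tangent:
  "second_deriv f x v w = dir_deriv (\<lambda>z. dir_deriv f (fst z) (snd z)) (x, v) (w, 0)"
  unfolding second_deriv_def dir_deriv_def has_dir_deriv_def by simp

lemma has_dir_deriv_second:
  assumes "C2_on U f" "x \<in> U"
  shows "has_dir_deriv (\<lambda>z. dir_deriv f z v) x w (second_deriv f x v w)"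
proof -
  have "has_dir_deriv (\<lambda>z. dir_deriv f (fst z) (snd z)) (x, v) (w, 0) (second_deriv f x v w)"
    unfolding second_deriv_tangent using assms unfolding C2_on_def
    by (intro C1_on_has_dir_deriv[of "U \<times> UNIV"]) auto
  then show ?thesis
    unfolding has_dir_deriv_def by simp
qed

text \<open>By additivity the direction splits into a horizontal part, where v is frozen, and a
  vertical part, where the map is linear and hence its own derivative.\<close>

lemma dir_deriv_tangent:
  assumes "C2_on U f" "x \<in> U"
  shows "dir_deriv (\<lambda>z. dir_deriv f (fst z) (snd z)) (x, v) (y, w) = second_deriv f x v y + dir_deriv f x w"
proof -
  let ?F = "\<lambda>z. dir_deriv f (fst z) (snd z)"
  have C: "C1_on (U \<times> UNIV) ?F" and f: "C1_on U f"
    using assms(1) unfolding C2_on_def by auto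
  have "has_dir_deriv ?F (x, v) (0, w) (dir_deriv f x w)"
    unfolding has_dir_deriv_def
    by (intro Lim_transform_eventually[OF tendsto_const])
      (auto simp: eventually_at_filter dir_deriv_add_direction[OF f assms(2)] dir_deriv_scaleR_direction[OF f assms(2)])
  then have "dir_deriv ?F (x, v) (0, w) = dir_deriv f x w"
    by (rule dir_derivI)
  moreover have "dir_deriv ?F (x, v) ((y, 0) + (0, w)) = dir_deriv ?F (x, v) (y, 0) + dir_deriv ?F (x, v) (0, w)"
    using C assms(2) by (intro dir_deriv_add_direction) auto
  ultimately show ?thesis
    by (simp add: second_deriv_tangent)
qed

text \<open>Product rule for a derivative evaluated at a moving point on a moving vector; this is
  how identities between fields in a chart are differentiated below.\<close>

lemma has_dir_deriv_dir_deriv: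
  assumes "C2_on U f" "g x \<in> U" "has_dir_deriv g x u g'" "has_dir_deriv h x u h'"
  shows "has_dir_deriv (\<lambda>z. dir_deriv f (g z) (h z)) x u (second_deriv f (g x) (h x) g' + dir_deriv f (g x) h')"
proof -
  have "C1_on (U \<times> UNIV) (\<lambda>z. dir_deriv f (fst z) (snd z))"
    using assms(1) unfolding C2_on_def by blast
  from has_dir_deriv_compose[OF this, where g = "\<lambda>z. (g z, h z)", OF _ has_dir_deriv_Pair[OF assms(3,4)]]
  show ?thesis
    using assms(2) by (simp add: dir_deriv_tangent[OF assms(1,2)])
qed

lemma continuous_on_second_deriv:
  assumes "C2_on U f"
  shows "continuous_on (U \<times> UNIV \<times> UNIV) (\<lambda>(x, v, w). second_deriv f x v w)"
proof -
  have "continuous_on ((U \<times> UNIV) \<times> UNIV) (\<lambda>(z, w). dir_deriv (\<lambda>z. dir_deriv f (fst z) (snd z)) z w)"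
    using assms unfolding C2_on_def by (intro continuous_on_dir_deriv) auto
  then have "continuous_on (U \<times> UNIV \<times> UNIV)
     (\<lambda>z. (\<lambda>(z, w). dir_deriv (\<lambda>z. dir_deriv f (fst z) (snd z)) z w) ((fst z, fst (snd z)), (snd (snd z), 0)))"
    by (rule continuous_on_compose2) (auto intro!: continuous_intros)
  then show ?thesis
    by (simp add: second_deriv_tangent case_prod_unfold)
qed

lemma linear_second_deriv_right:
  assumes "C2_on U f" "x \<in> U"
  shows "linear (second_deriv f x v)"
proof -
  have "linear (dir_deriv (\<lambda>z. dir_deriv f (fst z) (snd z)) (x, v))"
    using assms unfolding C2_on_def by (intro linear_dir_deriv[of "U \<times> UNIV"]) auto
  from linear_compose[OF _ this, of "\<lambda>w. (w, 0)"]
  show ?thesis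
    by (simp add: o_def second_deriv_tangent[abs_def] linear_iff)
qed

text \<open>Two applications of the mean value lemma: along v to the difference of f at points
  shifted by t w, then along w to the derivative of f in direction v. The second difference is
  symmetric in v and w, and symmetry of the second derivative is read off from that.\<close>

lemma second_difference_limit:
  assumes "C2_on U f" "x \<in> U"
  shows "((\<lambda>t. inverse t *\<^sub>R inverse t *\<^sub>R
      ((f (x + t *\<^sub>R v + t *\<^sub>R w) - f (x + t *\<^sub>R v)) - (f (x + t *\<^sub>R w) - f x)))
    \<longlongrightarrow> second_deriv f x v w) (at_right 0)"
proof (rule topological_tendstoI)
  fix O' assume O': "open O'" "second_deriv f x v w \<in> O'"
  then obtain C where C: "open C" "convex C" "second_deriv f x v w \<in> C" "C \<subseteq> O'"
    by (rule convex_nhds)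
  let ?D = "\<lambda>z. second_deriv f z v w"
  have "continuous_on U (\<lambda>z. (\<lambda>(x, v, w). second_deriv f x v w) (z, v, w))"
    by (rule continuous_on_compose2[OF continuous_on_second_deriv[OF assms(1)]])
      (auto intro!: continuous_intros)
  then have "continuous_on U ?D" by simp
  then have N: "open (?D -` C \<inter> U)"
    using C(1) C2_on_open[OF assms(1)] by (intro continuous_on_open_vimage[THEN iffD1, rule_format])
  have xN: "x \<in> ?D -` C \<inter> U" using C assms by simp
  obtain A where A: "open A" "convex A" "x \<in> A" "A \<subseteq> ?D -` C \<inter> U"
    by (rule convex_nhds[OF N xN])
  have lim: "((\<lambda>t. x + t *\<^sub>R u) \<longlongrightarrow> x) (at_right 0)" for u :: 'a
    using tendsto_line by (rule filterlim_mono) (auto intro: at_le)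
  have "((\<lambda>t. (x + t *\<^sub>R v) + t *\<^sub>R w) \<longlongrightarrow> x) (at_right 0)"
    using lim[of "v + w"] by (simp add: algebra_simps)
  then have "\<forall>\<^sub>F t in at_right 0. x + t *\<^sub>R v + t *\<^sub>R w \<in> A"
    by (rule topological_tendstoD) fact+
  moreover have "\<forall>\<^sub>F t in at_right 0. x + t *\<^sub>R v \<in> A" "\<forall>\<^sub>F t in at_right 0. x + t *\<^sub>R w \<in> A"
    by (rule topological_tendstoD[OF lim A(1,3)])+
  moreover have "\<forall>\<^sub>F t in at_right 0. 0 < (t::real)"
    by (rule eventually_at_right_less)
  ultimately show "\<forall>\<^sub>F t in at_right 0. inverse t *\<^sub>R inverse t *\<^sub>R
      ((f (x + t *\<^sub>R v + t *\<^sub>R w) - f (x + t *\<^sub>R v)) - (f (x + t *\<^sub>R w) - f x)) \<in> O'"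
  proof eventually_elim
    case (elim t)
    \<comment> \<open>The four corners of the parallelogram lie in the convex set A, hence so do all
      its points.\<close>
    have inA: "x + (r * t) *\<^sub>R v + (s * t) *\<^sub>R w \<in> A" if "0 \<le> r" "r \<le> 1" "0 \<le> s" "s \<le> 1" for r s
    proof -
      have a: "(1 - r) *\<^sub>R x + r *\<^sub>R (x + t *\<^sub>R v) \<in> A"
        using A(2,3) elim that by (intro convexD) auto
      have b: "(1 - r) *\<^sub>R (x + t *\<^sub>R w) + r *\<^sub>R (x + t *\<^sub>R v + t *\<^sub>R w) \<in> A"
        using A(2,3) elim that by (intro convexD) auto
      have "(1 - s) *\<^sub>R ((1 - r) *\<^sub>R x + r *\<^sub>R (x + t *\<^sub>R v)) +
          s *\<^sub>R ((1 - r) *\<^sub>R (x + t *\<^sub>R w) + r *\<^sub>R (x + t *\<^sub>R v + t *\<^sub>R w)) \<in> A"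
        by (rule convexD[OF A(2) a b]) (use that in auto)
      then show ?thesis by (simp add: algebra_simps)
    qed
    let ?tC = "(\<lambda>z. t *\<^sub>R z) ` C"
    have tC: "open ?tC" "convex ?tC"
      using open_scaleR_lcs[OF C(1), of t] convex_scaling[OF C(2)] elim by auto
    \<comment> \<open>The mean value lemma along w shows that the derivative along v changes by an
      element of t C; this dilate is again open and convex and is the target set for the mean value
      lemma along v.\<close>
    have inner: "dir_deriv f (x + (r * t) *\<^sub>R v + t *\<^sub>R w) v - dir_deriv f (x + (r * t) *\<^sub>R v) v \<in> ?tC"
      if r: "0 \<le> r" "r \<le> 1" for r
    proof -
      have "\<exists>l\<in>C. has_dir_deriv (\<lambda>q. dir_deriv f (x + (r * t) *\<^sub>R v + q *\<^sub>R w) v) (s * t) 1 l"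
        if s: "0 \<le> s" "s \<le> 1" for s
        using inA[OF r s] A(4)
        by (intro bexI[of _ "?D (x + (r * t) *\<^sub>R v + (s * t) *\<^sub>R w)"] has_dir_deriv_line
            has_dir_deriv_second[OF assms(1)]) auto
      then have "inverse t *\<^sub>R (dir_deriv f (x + (r * t) *\<^sub>R v + t *\<^sub>R w) v
          - dir_deriv f (x + (r * t) *\<^sub>R v + 0 *\<^sub>R w) v) \<in> C"
        using elim C by (intro mean_value_quotient) auto
      then have "t *\<^sub>R inverse t *\<^sub>R (dir_deriv f (x + (r * t) *\<^sub>R v + t *\<^sub>R w) v
          - dir_deriv f (x + (r * t) *\<^sub>R v + 0 *\<^sub>R w) v) \<in> ?tC"
        by (rule imageI)
      then show ?thesis using elim by simp
    qed
    have "\<exists>l\<in>?tC. has_dir_deriv (\<lambda>q. f (x + t *\<^sub>R w + q *\<^sub>R v) - f (x + q *\<^sub>R v)) (r * t) 1 l"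
      if r: "0 \<le> r" "r \<le> 1" for r
    proof (rule bexI[OF _ inner[OF r]], intro has_dir_deriv_diff has_dir_deriv_line)
      have "x + t *\<^sub>R w + (r * t) *\<^sub>R v \<in> U"
        using inA[OF r, of 1] A(4) by (auto simp: add_ac)
      from C1_on_has_dir_deriv[OF C2_on_C1[OF assms(1)] this]
      show "has_dir_deriv f (x + t *\<^sub>R w + (r * t) *\<^sub>R v) v (dir_deriv f (x + (r * t) *\<^sub>R v + t *\<^sub>R w) v)"
        by (simp add: add_ac)
      show "has_dir_deriv f (x + (r * t) *\<^sub>R v) v (dir_deriv f (x + (r * t) *\<^sub>R v) v)"
        using inA[OF r, of 0] A(4) by (intro C1_on_has_dir_deriv[OF C2_on_C1[OF assms(1)]]) auto
    qed
    then have "inverse t *\<^sub>R ((f (x + t *\<^sub>R w + t *\<^sub>R v) - f (x + t *\<^sub>R v))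
        - (f (x + t *\<^sub>R w + 0 *\<^sub>R v) - f (x + 0 *\<^sub>R v))) \<in> ?tC"
      using elim tC by (intro mean_value_quotient) auto
    then have "inverse t *\<^sub>R ((f (x + t *\<^sub>R v + t *\<^sub>R w) - f (x + t *\<^sub>R v)) - (f (x + t *\<^sub>R w) - f x)) \<in> ?tC"
      by (simp add: add_ac)
    then obtain z where "z \<in> C" "inverse t *\<^sub>R ((f (x + t *\<^sub>R v + t *\<^sub>R w) - f (x + t *\<^sub>R v))
        - (f (x + t *\<^sub>R w) - f x)) = t *\<^sub>R z"
      by blast
    then show ?case
      using elim C(4) by (simp only:) auto
  qed
qed

lemma second_deriv_symmetric:
  assumes "C2_on U f" "x \<in> U"
  shows "second_deriv f x v w = second_deriv f x w v"
proof (rule tendsto_unique[OF _ second_difference_limit[OF assms]])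
  show "((\<lambda>t. inverse t *\<^sub>R inverse t *\<^sub>R
      ((f (x + t *\<^sub>R v + t *\<^sub>R w) - f (x + t *\<^sub>R v)) - (f (x + t *\<^sub>R w) - f x)))
    \<longlongrightarrow> second_deriv f x w v) (at_right 0)"
    using second_difference_limit[OF assms, of w v] by (simp add: algebra_simps)
qed simp

lemma linear_second_deriv_left:
  assumes "C2_on U f" "x \<in> U"
  shows "linear (\<lambda>v. second_deriv f x v w)"
  using linear_second_deriv_right[OF assms, of w] by (simp add: second_deriv_symmetric[OF assms, of _ w])

section \<open>Smooth maps are of class C2\<close>

lemma smooth_on_has_dir_deriv:
  "smooth_on U f \<Longrightarrow> x \<in> U \<Longrightarrow> has_dir_deriv (\<lambda>z. iter_deriv k f z v) x w (dir_deriv (\<lambda>z. iter_deriv k f z v) x w)"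
  unfolding smooth_on_def by (metis dir_derivI)

lemma smooth_on_continuous: "smooth_on U f \<Longrightarrow> continuous_on (U \<times> UNIV) (\<lambda>(x, v). iter_deriv k f x v)"
  unfolding smooth_on_def by blast

lemma smooth_on_open: "smooth_on U f \<Longrightarrow> open U"
  unfolding smooth_on_def by blast

text \<open>Direction number 0 is the innermost one, so differentiating first along v amounts to
  prepending v to the sequence of directions.\<close>

lemma iter_deriv_dir_deriv:
  "iter_deriv k (\<lambda>z. dir_deriv f z v) x w = iter_deriv (Suc k) f x (case_nat v w)"
  by (induction k arbitrary: x) simp_all

lemma smooth_on_dir_deriv:
  assumes "smooth_on U f"
  shows "smooth_on U (\<lambda>z. dir_deriv f z v)"
  unfolding smooth_on_def
proof (intro conjI allI ballI)
  fix k
  show "\<exists>l. has_dir_deriv (\<lambda>z. iter_deriv k (\<lambda>z. dir_deriv f z v) z u) x w l" if "x \<in> U" for x u w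
    unfolding iter_deriv_dir_deriv using smooth_on_has_dir_deriv[OF assms that] by blast
  have "continuous_on (U \<times> UNIV) (\<lambda>z. (\<lambda>(x, u). iter_deriv (Suc k) f x u) (fst z, case_nat v (snd z)))"
  proof (rule continuous_on_compose2[OF smooth_on_continuous[OF assms, of "Suc k"] continuous_on_Pair])
    show "continuous_on (U \<times> UNIV) (\<lambda>z::'a \<times> (nat \<Rightarrow> 'a). case_nat v (snd z))"
    proof (rule continuous_on_coordinatewise_then_product)
      fix i
      have "continuous_on (U \<times> UNIV) (\<lambda>z::'a \<times> (nat \<Rightarrow> 'a). snd z j)" for j
        by (rule continuous_on_product_then_coordinatewise) (intro continuous_intros)
      then show "continuous_on (U \<times> UNIV) (\<lambda>z::'a \<times> (nat \<Rightarrow> 'a). case_nat v (snd z) i)"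
        by (cases i) auto
    qed
  qed (auto intro: continuous_intros)
  then show "continuous_on (U \<times> UNIV) (\<lambda>(x, u). iter_deriv k (\<lambda>z. dir_deriv f z v) x u)"
    unfolding iter_deriv_dir_deriv by (simp add: case_prod_unfold)
qed (rule smooth_on_open[OF assms])

lemma smooth_on_C1:
  assumes "smooth_on U f"
  shows "C1_on U f"
proof (rule C1_onI[OF smooth_on_open[OF assms]])
  have "continuous_on U (\<lambda>x. (\<lambda>(x, v). iter_deriv 0 f x v) (x, \<lambda>_. 0))"
    by (rule continuous_on_compose2[OF smooth_on_continuous[OF assms]]) (auto intro: continuous_intros)
  then show "continuous_on U f" by simp
  show "has_dir_deriv f x v (dir_deriv f x v)" if "x \<in> U" for x v
    using smooth_on_has_dir_deriv[OF assms that, of 0] by simp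
  have "continuous_on (U \<times> UNIV) (\<lambda>z. (\<lambda>(x, v). iter_deriv (Suc 0) f x v) (fst z, \<lambda>_. snd z))"
    by (rule continuous_on_compose2[OF smooth_on_continuous[OF assms]])
      (auto intro!: continuous_intros continuous_on_coordinatewise_then_product)
  then show "continuous_on (U \<times> UNIV) (\<lambda>(x, v). dir_deriv f x v)"
    by (simp add: case_prod_unfold)
qed

text \<open>Smoothness differentiates in the point with the directions held fixed, whereas class C2
  moves point and direction together. The increment is therefore split: first the point moves, at
  direction v + t w, then the direction moves at the fixed point x, where linearity applies.\<close>

lemma smooth_on_C2:
  assumes "smooth_on U f"
  shows "C2_on U f"
  unfolding C2_on_def
proof
  let ?F = "\<lambda>z. dir_deriv f (fst z) (snd z)"
  show f: "C1_on U f"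
    by (rule smooth_on_C1[OF assms])
  have "continuous_on (U \<times> UNIV \<times> UNIV) (\<lambda>z. (\<lambda>(x, v). iter_deriv (Suc (Suc 0)) f x v)
      (fst z, case_nat (fst (snd z)) (\<lambda>_. snd (snd z))))"
  proof (rule continuous_on_compose2[OF smooth_on_continuous[OF assms] continuous_on_Pair])
    show "continuous_on (U \<times> UNIV \<times> UNIV) (\<lambda>z::'a \<times> 'a \<times> 'a. case_nat (fst (snd z)) (\<lambda>_. snd (snd z)))"
    proof (rule continuous_on_coordinatewise_then_product)
      fix i
      show "continuous_on (U \<times> UNIV \<times> UNIV) (\<lambda>z::'a \<times> 'a \<times> 'a. case_nat (fst (snd z)) (\<lambda>_. snd (snd z)) i)"
        by (cases i) (auto intro!: continuous_intros)
    qed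
  qed (auto intro: continuous_intros)
  then have cont: "continuous_on (U \<times> UNIV \<times> UNIV) (\<lambda>z. second_deriv f (fst z) (fst (snd z)) (snd (snd z)))"
    by (simp add: second_deriv_def)
  have der: "has_dir_deriv ?F (x, v) (y, w) (second_deriv f x v y + dir_deriv f x w)" if x: "x \<in> U" for x v y w
  proof -
    \<comment> \<open>The direction v + t w is the moving parameter of the strict quotient.\<close>
    have lim: "((\<lambda>t. inverse t *\<^sub>R (dir_deriv f (x + t *\<^sub>R y) (v + t *\<^sub>R w) - dir_deriv f x (v + t *\<^sub>R w)))
      \<longlongrightarrow> second_deriv f x v y) (at 0)"
    proof (rule strict_quotient_param[where F = "\<lambda>p z. dir_deriv f z p" and D = "\<lambda>p z. second_deriv f z p"
          and U = U and y = "\<lambda>_. x" and w = "\<lambda>_. y" and t = "\<lambda>t. t"])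
      show "has_dir_deriv (\<lambda>z. dir_deriv f z p) z v (second_deriv f z p v)" if "z \<in> U" for p z v
        unfolding second_deriv_def
        by (intro C1_on_has_dir_deriv[OF smooth_on_C1[OF smooth_on_dir_deriv[OF assms]] that])
      have "continuous_on (UNIV \<times> U \<times> UNIV) (\<lambda>q. (\<lambda>z. second_deriv f (fst z) (fst (snd z)) (snd (snd z)))
          (fst (snd q), fst q, snd (snd q)))"
        by (rule continuous_on_compose2[OF cont]) (auto intro!: continuous_intros)
      then show "continuous_on (UNIV \<times> U \<times> UNIV) (\<lambda>(p, z, v). second_deriv f z p v)"
        by (simp add: case_prod_unfold)
    qed (use x smooth_on_open[OF assms] in \<open>auto intro: tendsto_line filterlim_ident_at_0\<close>)
    have "((\<lambda>t. inverse t *\<^sub>R (dir_deriv f x (v + t *\<^sub>R w) - dir_deriv f x v)) \<longlongrightarrow> dir_deriv f x w) (at 0)"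
      by (intro Lim_transform_eventually[OF tendsto_const])
        (auto simp: eventually_at_filter dir_deriv_add_direction[OF f x] dir_deriv_scaleR_direction[OF f x])
    from tendsto_add[OF lim this] show ?thesis
      unfolding has_dir_deriv_def by (simp add: algebra_simps)
  qed
  show "C1_on (U \<times> UNIV) ?F"
  proof (rule C1_onI)
    show "open (U \<times> (UNIV::'a set))"
      by (intro open_Times smooth_on_open[OF assms] open_UNIV)
    show "continuous_on (U \<times> UNIV) ?F"
      using continuous_on_dir_deriv[OF f] by (simp add: case_prod_unfold)
    show "has_dir_deriv ?F z u (second_deriv f (fst z) (snd z) (fst u) + dir_deriv f (fst z) (snd u))"
      if "z \<in> U \<times> UNIV" for z u
      using der[of "fst z" "snd z" "fst u" "snd u"] that by auto
    have 1: "continuous_on ((U \<times> UNIV) \<times> UNIV) (\<lambda>q. (\<lambda>z. second_deriv f (fst z) (fst (snd z)) (snd (snd z)))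
        (fst (fst q), snd (fst q), fst (snd q)))"
      by (rule continuous_on_compose2[OF cont]) (auto intro!: continuous_intros)
    have 2: "continuous_on ((U \<times> UNIV) \<times> UNIV) (\<lambda>q. (\<lambda>(x, v). dir_deriv f x v) (fst (fst q), snd (snd q)))"
      by (rule continuous_on_compose2[OF continuous_on_dir_deriv[OF f]]) (auto intro!: continuous_intros)
    show "continuous_on ((U \<times> UNIV) \<times> UNIV)
        (\<lambda>(z, u). second_deriv f (fst z) (snd z) (fst u) + dir_deriv f (fst z) (snd u))"
      using continuous_on_add[OF 1 2] by (simp add: case_prod_unfold)
  qed
qed

section \<open>Bounded sets and bounded inner products\<close>

lemma lcs_absorbing:
  fixes C :: "'a::locally_convex_space set"
  assumes "open C" "0 \<in> C"
  obtains k where "k > 0" "x \<in> (\<lambda>z. k *\<^sub>R z) ` C"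
proof -
  have "\<forall>\<^sub>F t in at_right 0. 0 + t *\<^sub>R x \<in> C"
    by (rule topological_tendstoD[OF filterlim_mono[OF tendsto_line]]) (auto intro: at_le assms)
  moreover have "\<forall>\<^sub>F t in at_right 0. 0 < (t::real)"
    by (rule eventually_at_right_less)
  ultimately have "\<forall>\<^sub>F t in at_right 0. 0 < t \<and> t *\<^sub>R x \<in> C"
    by eventually_elim simp
  then obtain t :: real where "0 < t" "t *\<^sub>R x \<in> C"
    using eventually_happens'[of "at_right (0::real)"] by auto
  then show thesis
    by (intro that[of "inverse t"]) (auto simp: image_iff intro!: bexI[of _ "t *\<^sub>R x"])
qed

lemma scaleR_convex_mono:
  assumes "convex C" "0 \<in> C" "0 \<le> a" "a \<le> b" "0 < b"
  shows "(\<lambda>z. a *\<^sub>R z) ` C \<subseteq> (\<lambda>z. b *\<^sub>R z) ` C"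
proof clarify
  fix z assume "z \<in> C"
  then have "(1 - a / b) *\<^sub>R 0 + (a / b) *\<^sub>R z \<in> C"
    using assms by (intro convexD) auto
  then show "a *\<^sub>R z \<in> (\<lambda>z. b *\<^sub>R z) ` C"
    using assms(5) by (intro image_eqI[of _ _ "(a / b) *\<^sub>R z"]) auto
qed

text \<open>Dilates of a convex neighbourhood of 0 increase with the factor, so the larger of the
  factors for S and for x absorbs both.\<close>

lemma vn_bounded_insert:
  assumes "vn_bounded S"
  shows "vn_bounded (insert x S)"
  unfolding vn_bounded_def
proof (intro allI impI)
  fix U :: "'a set" assume "open U \<and> 0 \<in> U"
  then obtain C where C: "open C" "convex C" "0 \<in> C" "C \<subseteq> U"
    using convex_nhds_zero'[of U] by blast
  obtain r where r: "r > 0" "S \<subseteq> (\<lambda>z. r *\<^sub>R z) ` C"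
    using assms C(1,3) unfolding vn_bounded_def by blast
  obtain k where k: "k > 0" "x \<in> (\<lambda>z. k *\<^sub>R z) ` C"
    by (rule lcs_absorbing[OF C(1,3)])
  have "insert x S \<subseteq> (\<lambda>z. max r k *\<^sub>R z) ` C"
    using scaleR_convex_mono[OF C(2,3), of r "max r k"] scaleR_convex_mono[OF C(2,3), of k "max r k"] r k
    by (auto simp: less_max_iff_disj)
  then show "\<exists>r>0. insert x S \<subseteq> (\<lambda>z. r *\<^sub>R z) ` U"
    using r(1) by (intro exI[of _ "max r k"] conjI order_trans[OF _ image_mono[OF C(4)]]) auto
qed

lemma vn_bounded_finite: "finite S \<Longrightarrow> vn_bounded S"
proof (induction rule: finite_induct)
  case empty
  show ?case unfolding vn_bounded_def by (auto intro: exI[of _ 1])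
qed (rule vn_bounded_insert)

text \<open>The index from which a neighbourhood absorbs the sequence may depend on the
  neighbourhood; the finitely many earlier terms form a bounded set anyway.\<close>

lemma vn_bounded_range:
  fixes r :: "nat \<Rightarrow> 'a::locally_convex_space"
  assumes "\<And>C. open C \<Longrightarrow> convex C \<Longrightarrow> 0 \<in> C \<Longrightarrow> \<exists>k>0. \<forall>\<^sub>F n in sequentially. r n \<in> (\<lambda>z. k *\<^sub>R z) ` C"
  shows "vn_bounded (range r)"
  unfolding vn_bounded_def
proof (intro allI impI)
  fix U :: "'a set" assume "open U \<and> 0 \<in> U"
  then obtain C where C: "open C" "convex C" "0 \<in> C" "C \<subseteq> U"
    using convex_nhds_zero'[of U] by blast
  obtain k N where k: "k > 0" "\<And>n. n \<ge> N \<Longrightarrow> r n \<in> (\<lambda>z. k *\<^sub>R z) ` C"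
    using assms[OF C(1-3)] unfolding eventually_sequentially by blast
  obtain l where l: "l > 0" "r ` {..<N} \<subseteq> (\<lambda>z. l *\<^sub>R z) ` C"
    using vn_bounded_finite[of "r ` {..<N}"] C unfolding vn_bounded_def by blast
  have "r n \<in> (\<lambda>z. max l k *\<^sub>R z) ` C" for n
  proof (cases "n < N")
    case True
    then have "r n \<in> (\<lambda>z. l *\<^sub>R z) ` C" using l by blast
    then show ?thesis
      using scaleR_convex_mono[OF C(2,3), of l "max l k"] l(1) by (auto simp: less_max_iff_disj)
  next
    case False
    then have "r n \<in> (\<lambda>z. k *\<^sub>R z) ` C" using k by simp
    then show ?thesis
      using scaleR_convex_mono[OF C(2,3), of k "max l k"] k(1) by (auto simp: less_max_iff_disj)
  qed
  then show "\<exists>s>0. range r \<subseteq> (\<lambda>z. s *\<^sub>R z) ` U"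
    using k(1) by (intro exI[of _ "max l k"] conjI order_trans[OF _ image_mono[OF C(4)]]) auto
qed

section \<open>Differentiating a constant norm\<close>

text \<open>A Taylor estimate that asks for the second derivative at 0 alone. On [0, t] the curve
  minus its linear part has derivative \<open>c' (r * t) - c' 0\<close>, which lies in t K, and the
  mean value lemma contributes the second factor t.\<close>

lemma taylor_remainder_bounded:
  fixes c :: "real \<Rightarrow> 'a::locally_convex_space"
  assumes "\<delta> > 0" and c: "\<And>t. \<bar>t\<bar> < \<delta> \<Longrightarrow> has_dir_deriv c t 1 (c' t)"
    and c': "has_dir_deriv c' 0 1 l"
    and C: "open C" "convex C" "0 \<in> C"
  shows "\<exists>k>0. \<forall>\<^sub>F t in at_right 0. inverse (t * t) *\<^sub>R (c t - c 0 - t *\<^sub>R c' 0) \<in> (\<lambda>z. k *\<^sub>R z) ` C"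
proof -
  obtain k where k: "k > 0" "l \<in> (\<lambda>z. k *\<^sub>R z) ` C"
    by (rule lcs_absorbing[OF C(1,3)])
  \<comment> \<open>C is enlarged until it contains the second derivative l; the quotients of
    \<open>c'\<close> then lie in K near 0.\<close>
  define K where "K = (\<lambda>z. k *\<^sub>R z) ` C"
  have K: "open K" "convex K" "0 \<in> K" "l \<in> K"
    using open_scaleR_lcs[OF C(1), of k] convex_scaling[OF C(2)] k C(3) unfolding K_def by force+
  have "\<forall>\<^sub>F h in at 0. inverse h *\<^sub>R (c' (0 + h *\<^sub>R 1) - c' 0) \<in> K"
    using c' K unfolding has_dir_deriv_def by (intro topological_tendstoD)
  then obtain d where d: "d > 0" "\<And>h. h \<noteq> 0 \<Longrightarrow> \<bar>h\<bar> < d \<Longrightarrow> inverse h *\<^sub>R (c' h - c' 0) \<in> K"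
    by (auto simp: eventually_at)
  have "inverse (t * t) *\<^sub>R (c t - c 0 - t *\<^sub>R c' 0) \<in> K" if t: "0 < t" "t < min d \<delta>" for t
  proof -
    let ?e = "\<lambda>s. c s - s *\<^sub>R c' 0"
    let ?tK = "(\<lambda>z. t *\<^sub>R z) ` K"
    have tK: "open ?tK" "convex ?tK"
      using open_scaleR_lcs[OF K(1), of t] convex_scaling[OF K(2)] t by auto
    have "\<exists>l\<in>?tK. has_dir_deriv ?e (r * t) 1 l" if r: "0 \<le> r" "r \<le> 1" for r
    proof (rule bexI)
      have rt: "\<bar>r * t\<bar> < \<delta>" "\<bar>r * t\<bar> < d"
        using r t order_le_less_trans[OF mult_right_mono[of r 1 t]] by (auto simp: abs_mult)
      have "has_dir_deriv (\<lambda>s. s *\<^sub>R c' 0) (r * t) 1 (c' 0)"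
        unfolding has_dir_deriv_def
        by (intro Lim_transform_eventually[OF tendsto_const]) (auto simp: eventually_at_filter algebra_simps)
      then show "has_dir_deriv ?e (r * t) 1 (c' (r * t) - c' 0)"
        by (intro has_dir_deriv_diff c rt)
      show "c' (r * t) - c' 0 \<in> ?tK"
      proof (cases "r = 0")
        case True
        then show ?thesis using K(3) by force
      next
        case False
        then have "inverse (r * t) *\<^sub>R (c' (r * t) - c' 0) \<in> K"
          using rt t by (intro d) auto
        then have "(r * t) *\<^sub>R inverse (r * t) *\<^sub>R (c' (r * t) - c' 0) \<in> (\<lambda>z. (r * t) *\<^sub>R z) ` K"
          by (rule imageI)
        also have "\<dots> \<subseteq> ?tK"
          using r t mult_right_mono[of r 1 t] by (intro scaleR_convex_mono K) auto
        finally show ?thesis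
          using False t unfolding scaleR_scaleR by (subst (asm) right_inverse) auto
      qed
    qed
    then have "inverse t *\<^sub>R (?e t - ?e 0) \<in> ?tK"
      using t tK by (intro mean_value_quotient) auto
    then obtain z where z: "z \<in> K" "inverse t *\<^sub>R (?e t - ?e 0) = t *\<^sub>R z"
      by blast
    then have "inverse t *\<^sub>R inverse t *\<^sub>R (?e t - ?e 0) = z"
      using t by simp
    then show ?thesis
      using z(1) by (simp add: algebra_simps)
  qed
  then have "\<forall>\<^sub>F t in at_right 0. inverse (t * t) *\<^sub>R (c t - c 0 - t *\<^sub>R c' 0) \<in> K"
    using d(1) assms(1) unfolding eventually_at_right_field by (intro exI[of _ "min d \<delta>"]) auto
  then show ?thesis
    using k(1) unfolding K_def by blast
qed

text \<open>The inner product is only bounded, not continuous; a curve with a second derivative converges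
  fast enough for its derivative to be compatible with it.\<close>

lemma constant_norm_curve:
  fixes c :: "real \<Rightarrow> 'a::locally_convex_space"
  assumes ip: "bounded_inner_product ip"
    and "\<delta> > 0" and c: "\<And>t. \<bar>t\<bar> < \<delta> \<Longrightarrow> has_dir_deriv c t 1 (c' t)"
    and c': "has_dir_deriv c' 0 1 l"
    and const: "\<And>t. \<bar>t\<bar> < \<delta> \<Longrightarrow> ip (c t) (c t) = ip (c 0) (c 0)"
  shows "ip (c 0) (c' 0) = 0"
proof -
  have bil: "bilinear ip" and sym: "\<And>X Y. ip X Y = ip Y X"
    using ip unfolding bounded_inner_product_def by auto
  \<comment> \<open>A null sequence in (0, 1]: passing to a sequence turns the remainders into one
    bounded set, and t \<le> 1 lets powers of t be dropped from the estimate.\<close>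
  define t where "t n = inverse (real (Suc n))" for n
  have t0: "t n > 0" "t n \<le> 1" for n
    by (auto simp: t_def field_simps)
  have t_to_0: "t \<longlonglongrightarrow> 0"
    unfolding t_def by (rule LIMSEQ_inverse_real_of_nat)
  then have tlim: "filterlim t (at_right 0) sequentially"
    unfolding filterlim_at using t0(1) by (auto intro!: always_eventually simp: less_imp_neq[THEN not_sym])
  define r where "r n = inverse (t n * t n) *\<^sub>R (c (t n) - c 0 - t n *\<^sub>R c' 0)" for n
  have c_eq: "c (t n) = c 0 + t n *\<^sub>R c' 0 + (t n * t n) *\<^sub>R r n" for n
  proof -
    have "t n * t n * inverse (t n * t n) = 1"
      using t0(1)[of n] by (intro right_inverse) auto
    then show ?thesis
      unfolding r_def scaleR_scaleR by simp
  qed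
  have "vn_bounded (range r)"
  proof (rule vn_bounded_range)
    fix C :: "'a set" assume C: "open C" "convex C" "0 \<in> C"
    obtain k where k: "k > 0" "\<forall>\<^sub>F t in at_right 0. inverse (t * t) *\<^sub>R (c t - c 0 - t *\<^sub>R c' 0) \<in> (\<lambda>z. k *\<^sub>R z) ` C"
      using taylor_remainder_bounded[OF assms(2) c c' C] by blast
    then show "\<exists>k>0. \<forall>\<^sub>F n in sequentially. r n \<in> (\<lambda>z. k *\<^sub>R z) ` C"
      using eventually_compose_filterlim[OF k(2) tlim] unfolding r_def by blast
  qed
  then have S: "vn_bounded (insert (c 0) (insert (c' 0) (range r)))" (is "vn_bounded ?S")
    by (intro vn_bounded_insert)
  then have "bounded ((\<lambda>(X, Y). ip X Y) ` (?S \<times> ?S))"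
    using ip unfolding bounded_inner_product_def by blast
  then obtain M where "\<forall>x\<in>(\<lambda>(X, Y). ip X Y) ` (?S \<times> ?S). norm x \<le> M"
    unfolding bounded_iff by blast
  then have M: "\<bar>ip X Y\<bar> \<le> M" if "X \<in> ?S" "Y \<in> ?S" for X Y
    using that unfolding ball_simps by (metis SigmaI case_prod_conv real_norm_def)
  \<comment> \<open>Insert c(t) = c(0) + t c'(0) + t^2 r into the constant norm, cancel the constant
    term and divide by t. Of the four remaining terms the two mixed ones count twice, hence 6 M = M
    + 2 M + 2 M + M.\<close>
  have est: "2 * \<bar>ip (c 0) (c' 0)\<bar> \<le> 6 * M * t n" if n: "t n < \<delta>" for n
  proof -
    let ?t = "t n" and ?a = "ip (c 0) (c' 0)"
    have "ip (c ?t) (c ?t) = ip (c 0) (c 0)"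
      using n t0(1)[of n] by (intro const) auto
    then have "2 * ?t * ?a + ?t * ?t * ip (c' 0) (c' 0) + 2 * (?t * ?t) * ip (c 0) (r n)
        + 2 * (?t * ?t * ?t) * ip (c' 0) (r n) + (?t * ?t * ?t * ?t) * ip (r n) (r n) = 0"
      unfolding c_eq
      by (simp add: bilinear_ladd[OF bil] bilinear_radd[OF bil] bilinear_lmul[OF bil] bilinear_rmul[OF bil]
          sym[of "r n" "c 0"] sym[of "r n" "c' 0"] sym[of "c' 0" "c 0"] algebra_simps)
    moreover define e where "e = ip (c' 0) (c' 0) + 2 * ip (c 0) (r n)
        + 2 * (?t * ip (c' 0) (r n)) + (?t * ?t) * ip (r n) (r n)"
    ultimately have "?t * (2 * ?a + ?t * e) = 0"
      by (simp add: algebra_simps)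
    then have "2 * ?a = - (?t * e)"
      using t0(1)[of n] by auto
    then have "\<bar>2 * ?a\<bar> = \<bar>?t * e\<bar>"
      by (simp only: abs_minus_cancel)
    then have "2 * \<bar>?a\<bar> = ?t * \<bar>e\<bar>"
      using t0(1)[of n] by (simp add: abs_mult)
    also have "\<dots> \<le> ?t * (M + 2 * M + 2 * M + M)"
    proof (rule mult_left_mono)
      have "\<bar>?t * ip (c' 0) (r n)\<bar> \<le> 1 * M"
        unfolding abs_mult using t0[of n] M[of "c' 0" "r n"] by (intro mult_mono) auto
      moreover have "\<bar>(?t * ?t) * ip (r n) (r n)\<bar> \<le> 1 * M"
        unfolding abs_mult[of "?t * ?t"] using t0[of n] M[of "r n" "r n"] mult_mono[of "t n" 1 "t n" 1]
        by (intro mult_mono) auto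
      moreover have "\<bar>ip (c' 0) (c' 0)\<bar> \<le> M" "\<bar>ip (c 0) (r n)\<bar> \<le> M"
        by (auto intro: M)
      ultimately show "\<bar>e\<bar> \<le> M + 2 * M + 2 * M + M"
        unfolding e_def by linarith
    qed (use t0(1)[of n] in simp)
    finally show ?thesis by (simp add: algebra_simps)
  qed
  have "(\<lambda>n. 6 * M * t n) \<longlonglongrightarrow> 6 * M * 0"
    by (intro tendsto_intros t_to_0)
  moreover have "\<forall>\<^sub>F n in sequentially. 2 * \<bar>ip (c 0) (c' 0)\<bar> \<le> 6 * M * t n"
    using order_tendstoD(2)[OF t_to_0 assms(2)] by eventually_elim (rule est)
  ultimately have "2 * \<bar>ip (c 0) (c' 0)\<bar> \<le> 6 * M * 0"
    by (intro tendsto_lowerbound[where F = sequentially]) auto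
  then show ?thesis by simp
qed

section \<open>Partial derivatives and products of maps\<close>

lemma dir_deriv_slice_left: "dir_deriv (\<lambda>u. f (u, v)) u X = dir_deriv f (u, v) (X, 0)"
  unfolding dir_deriv_def has_dir_deriv_def by simp

lemma dir_deriv_slice_right: "dir_deriv (\<lambda>v. f (u, v)) v X = dir_deriv f (u, v) (0, X)"
  unfolding dir_deriv_def has_dir_deriv_def by simp

lemma has_dir_deriv_slice_left: "has_dir_deriv (\<lambda>u. f (u, v)) u X = has_dir_deriv f (u, v) (X, 0)"
  unfolding has_dir_deriv_def by (intro ext) simp

lemma C2_on_slice_left: "C2_on W f \<Longrightarrow> C2_on ((\<lambda>u. (u, v)) -` W) (\<lambda>u. f (u, v))"
  using C2_on_compose[of W f UNIV "\<lambda>u. (u, v)"]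
  by (simp add: C2_on_Pair C2_on_ident C2_on_const)

lemma C2_on_slice_right: "C2_on W f \<Longrightarrow> C2_on ((\<lambda>v. (u, v)) -` W) (\<lambda>v. f (u, v))"
  using C2_on_compose[of W f UNIV "\<lambda>v. (u, v)"]
  by (simp add: C2_on_Pair C2_on_ident C2_on_const)

lemma C1_on_map_prod:
  fixes f :: "'a::locally_convex_space \<Rightarrow> 'b::locally_convex_space"
    and g :: "'c::locally_convex_space \<Rightarrow> 'd::locally_convex_space"
  assumes "C1_on U f" "C1_on V g"
  shows "C1_on (U \<times> V) (map_prod f g)"
proof -
  have op: "open (U \<times> V)"
    using assms by (intro open_Times C1_on_open)
  have "C1_on (U \<times> V) (fst :: 'a \<times> 'c \<Rightarrow> 'a)" "C1_on (U \<times> V) (snd :: 'a \<times> 'c \<Rightarrow> 'c)"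
    by (intro C2_on_C1 C2_on_fst C2_on_snd op)+
  from C1_on_compose[OF assms(1) this(1)] C1_on_compose[OF assms(2) this(2)]
  have "C1_on (U \<times> V) (\<lambda>z. f (fst z))" "C1_on (U \<times> V) (\<lambda>z. g (snd z))"
    using op by (auto elim!: C1_on_subset)
  then have "C1_on (U \<times> V) (\<lambda>z. (f (fst z), g (snd z)))"
    by (rule C1_on_Pair)
  then show ?thesis
    by (rule C1_on_cong) (simp add: map_prod_def case_prod_unfold)
qed

section \<open>Lie groups in the chart at the identity\<close>

text \<open>Chart changes enter only through their first derivatives, in
  \<open>tangent_map_in_chart\<close>, and class C1 passes to product atlases by
  \<open>C1_on_map_prod\<close>.\<close>

definition C1_manifold :: "'p set \<Rightarrow> ('p, 'a::locally_convex_space) charts \<Rightarrow> bool"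
  where "C1_manifold S A \<longleftrightarrow>
    (\<forall>x\<in>S. x \<in> chart_dom A x \<and> chart_dom A x \<subseteq> S \<and> inj_on (chart A x) (chart_dom A x) \<and>
       open (chart A x ` chart_dom A x)) \<and>
    (\<forall>x\<in>S. \<forall>y\<in>S. C1_on (chart A x ` (chart_dom A x \<inter> chart_dom A y)) (chart A y \<circ> chart_inv A x))"

lemma manifold_C1: "manifold S A \<Longrightarrow> C1_manifold S A"
  unfolding manifold_def C1_manifold_def by (blast intro: smooth_on_C1)

lemma
  assumes "C1_manifold S A" "x \<in> S"
  shows chart_dom_mem: "x \<in> chart_dom A x"
    and chart_dom_subset: "chart_dom A x \<subseteq> S"
    and chart_inj: "inj_on (chart A x) (chart_dom A x)"
    and open_chart_image: "open (chart A x ` chart_dom A x)"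
  using assms unfolding C1_manifold_def by auto

lemma C1_transition:
  assumes "C1_manifold S A" "x \<in> S" "y \<in> S"
  shows "C1_on (chart A x ` (chart_dom A x \<inter> chart_dom A y)) (\<lambda>u. chart A y (chart_inv A x u))"
  using assms unfolding C1_manifold_def o_def by auto

lemma chart_inv_chart:
  assumes "C1_manifold S A" "x \<in> S" "y \<in> chart_dom A x"
  shows "chart_inv A x (chart A x y) = y"
  unfolding chart_inv_def using chart_inj[OF assms(1,2)] assms(3) by (rule inv_into_f_f)

lemma chart_chart_inv: "u \<in> chart A x ` chart_dom A x \<Longrightarrow> chart A x (chart_inv A x u) = u"
  unfolding chart_inv_def by (rule f_inv_into_f)

lemma chart_inv_mem: "u \<in> chart A x ` chart_dom A x \<Longrightarrow> chart_inv A x u \<in> chart_dom A x"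
  unfolding chart_inv_def by (rule inv_into_into)

lemma chart_dom_prod: "chart_dom (prod_charts A B) p = chart_dom A (fst p) \<times> chart_dom B (snd p)"
  unfolding chart_dom_def prod_charts_def by (simp add: case_prod_unfold)

lemma chart_prod: "chart (prod_charts A B) p = map_prod (chart A (fst p)) (chart B (snd p))"
  unfolding chart_def prod_charts_def by (simp add: case_prod_unfold)

text \<open>\<open>chart_inv\<close> is a choice inverse and is determined only on the image of the
  chart; hence the restriction on z.\<close>

lemma chart_inv_prod:
  assumes A: "C1_manifold S A" and B: "C1_manifold T B" and p: "fst p \<in> S" "snd p \<in> T"
    and z: "z \<in> chart (prod_charts A B) p ` chart_dom (prod_charts A B) p"
  shows "chart_inv (prod_charts A B) p z = map_prod (chart_inv A (fst p)) (chart_inv B (snd p)) z"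
proof -
  obtain a b where ab: "a \<in> chart_dom A (fst p)" "b \<in> chart_dom B (snd p)"
    "z = (chart A (fst p) a, chart B (snd p) b)"
    using z by (auto simp: chart_prod chart_dom_prod)
  have "inj_on (chart (prod_charts A B) p) (chart_dom (prod_charts A B) p)"
    unfolding chart_prod chart_dom_prod
    by (intro map_prod_inj_on chart_inj[OF A p(1)] chart_inj[OF B p(2)])
  then have "chart_inv (prod_charts A B) p (chart (prod_charts A B) p (a, b)) = (a, b)"
    unfolding chart_inv_def using ab by (intro inv_into_f_f) (auto simp: chart_dom_prod)
  then show ?thesis
    using ab chart_inv_chart[OF A p(1)] chart_inv_chart[OF B p(2)] by (simp add: chart_prod)
qed

lemma C1_manifold_prod:
  assumes A: "C1_manifold S A" and B: "C1_manifold T B"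
  shows "C1_manifold (S \<times> T) (prod_charts A B)"
  unfolding C1_manifold_def
proof (intro conjI ballI)
  fix x assume x: "x \<in> S \<times> T"
  then show "x \<in> chart_dom (prod_charts A B) x"
    using chart_dom_mem[OF A] chart_dom_mem[OF B] by (auto simp: chart_dom_prod)
  show "chart_dom (prod_charts A B) x \<subseteq> S \<times> T"
    unfolding chart_dom_prod using x
    by (intro Sigma_mono chart_dom_subset[OF A] chart_dom_subset[OF B]) auto
  show "inj_on (chart (prod_charts A B) x) (chart_dom (prod_charts A B) x)"
    unfolding chart_prod chart_dom_prod using x by (intro map_prod_inj_on chart_inj[OF A] chart_inj[OF B]) auto
  have "chart (prod_charts A B) x ` chart_dom (prod_charts A B) x =
      (chart A (fst x) ` chart_dom A (fst x)) \<times> (chart B (snd x) ` chart_dom B (snd x))"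
    by (auto simp: chart_prod chart_dom_prod)
  then show "open (chart (prod_charts A B) x ` chart_dom (prod_charts A B) x)"
    using x open_chart_image[OF A] open_chart_image[OF B] by (auto intro: open_Times)
  fix y assume y: "y \<in> S \<times> T"
  let ?U = "chart A (fst x) ` (chart_dom A (fst x) \<inter> chart_dom A (fst y))"
  let ?V = "chart B (snd x) ` (chart_dom B (snd x) \<inter> chart_dom B (snd y))"
  have eq: "chart (prod_charts A B) x ` (chart_dom (prod_charts A B) x \<inter> chart_dom (prod_charts A B) y) = ?U \<times> ?V"
    by (auto simp: chart_prod chart_dom_prod image_iff)
  show "C1_on (chart (prod_charts A B) x ` (chart_dom (prod_charts A B) x \<inter> chart_dom (prod_charts A B) y))
      (chart (prod_charts A B) y \<circ> chart_inv (prod_charts A B) x)"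
  proof (rule C1_on_cong)
    show "C1_on (chart (prod_charts A B) x ` (chart_dom (prod_charts A B) x \<inter> chart_dom (prod_charts A B) y))
      (map_prod (\<lambda>u. chart A (fst y) (chart_inv A (fst x) u)) (\<lambda>v. chart B (snd y) (chart_inv B (snd x) v)))"
      unfolding eq using x y by (intro C1_on_map_prod C1_transition[OF A] C1_transition[OF B]) auto
    fix z assume "z \<in> chart (prod_charts A B) x ` (chart_dom (prod_charts A B) x \<inter> chart_dom (prod_charts A B) y)"
    then have "z \<in> chart (prod_charts A B) x ` chart_dom (prod_charts A B) x"
      by blast
    from chart_inv_prod[OF A B _ _ this] x
    show "map_prod (\<lambda>u. chart A (fst y) (chart_inv A (fst x) u)) (\<lambda>v. chart B (snd y) (chart_inv B (snd x) v)) z =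
        (chart (prod_charts A B) y \<circ> chart_inv (prod_charts A B) x) z"
      by (auto simp: chart_prod map_prod_def case_prod_unfold)
  qed
qed

text \<open>A tangent vector at x is given by its coordinates in the chart at x, whereas brackets at
  e need the chart at e throughout. The chart change there and back cancels by the chain rule, which
  leaves the plain derivative of f in the chart at e.\<close>

lemma tangent_map_in_chart:
  assumes man: "C1_manifold S A" and e: "e \<in> S" and x: "x \<in> chart_dom A e" "f e = x"
    and N: "C1_on N (\<lambda>u. chart A e (f (chart_inv A e u)))" "chart A e e \<in> N"
      "N \<subseteq> chart A e ` chart_dom A e" "\<And>u. u \<in> N \<Longrightarrow> f (chart_inv A e u) \<in> chart_dom A e"
  shows "diff_at A (chart A e) x (tangent_map A A f e X)
    = dir_deriv (\<lambda>u. chart A e (f (chart_inv A e u))) (chart A e e) X"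
proof -
  let ?F = "\<lambda>u. chart A e (f (chart_inv A e u))"
  let ?\<tau> = "\<lambda>u. chart A x (chart_inv A e u)" and ?\<sigma> = "\<lambda>u. chart A e (chart_inv A x u)"
  let ?T = "chart A e ` (chart_dom A e \<inter> chart_dom A x)"
  let ?T' = "chart A x ` (chart_dom A x \<inter> chart_dom A e)"
  let ?L = "dir_deriv ?F (chart A e e) X"
  have xS: "x \<in> S" using chart_dom_subset[OF man e] x by blast
  have \<tau>: "C1_on ?T ?\<tau>" and \<sigma>: "C1_on ?T' ?\<sigma>"
    using C1_transition[OF man e xS] C1_transition[OF man xS e] .
  have Fe: "?F (chart A e e) = chart A e x"
    using chart_inv_chart[OF man e chart_dom_mem[OF man e]] x by simp
  have xT: "chart A e x \<in> ?T"
    using x chart_dom_mem[OF man xS] by blast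
  have \<tau>x: "?\<tau> (chart A e x) = chart A x x"
    using chart_inv_chart[OF man e x(1)] by simp
  have "C1_on (?F -` ?T \<inter> N) (\<lambda>u. ?\<tau> (?F u))"
    by (rule C1_on_compose[OF \<tau> N(1)])
  then have op: "open (?F -` ?T \<inter> N)"
    by (rule C1_on_open)
  have "tangent_map A A f e X = dir_deriv (\<lambda>u. chart A x (f (chart_inv A e u))) (chart A e e) X"
    unfolding tangent_map_def diff_at_def x(2) by (simp add: o_def)
  also have "\<dots> = dir_deriv (\<lambda>u. ?\<tau> (?F u)) (chart A e e) X"
    by (rule dir_deriv_cong[OF op]) (use Fe xT N in \<open>auto simp: chart_inv_chart[OF man e]\<close>)
  also have "\<dots> = dir_deriv ?\<tau> (chart A e x) ?L"
    using dir_deriv_compose[where g = ?F, OF \<tau> _ N(1,2)] Fe xT by simp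
  finally have V: "tangent_map A A f e X = dir_deriv ?\<tau> (chart A e x) ?L" .
  have "diff_at A (chart A e) x (tangent_map A A f e X) = dir_deriv ?\<sigma> (?\<tau> (chart A e x)) (dir_deriv ?\<tau> (chart A e x) ?L)"
    unfolding V diff_at_def \<tau>x by (simp add: o_def)
  also have "\<dots> = dir_deriv (\<lambda>u. ?\<sigma> (?\<tau> u)) (chart A e x) ?L"
    using x(1) chart_dom_mem[OF man xS] \<tau>x by (intro dir_deriv_compose[OF \<sigma> _ \<tau> xT, symmetric]) auto
  also have "\<dots> = dir_deriv (\<lambda>u. u) (chart A e x) ?L"
    by (rule dir_deriv_cong[OF C1_on_open[OF \<tau>] xT])
      (auto simp: chart_inv_chart[OF man e] chart_inv_chart[OF man xS])
  also have "\<dots> = ?L"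
    by (rule dir_derivI[OF has_dir_deriv_ident])
  finally show ?thesis .
qed

section \<open>Brackets from the second derivative of the multiplication\<close>

text \<open>As much of a Lie group as the curvature at the unit sees: W is a neighbourhood of the
  pair of units, in coordinates, on which the multiplication stays in the chart at the unit. It is
  open as part of \<open>C2_on\<close>.\<close>

locale C2_group = monoid K for K :: "('g, 'a::locally_convex_space) lie_gp" (structure) +
  fixes W :: "('a \<times> 'a) set"
  assumes C1_man: "C1_manifold (carrier K) (charts K)"
    and W_unit: "(chart (charts K) \<one> \<one>, chart (charts K) \<one> \<one>) \<in> W"
    and W_subset: "W \<subseteq> chart (charts K) \<one> ` chart_dom (charts K) \<one> \<times> chart (charts K) \<one> ` chart_dom (charts K) \<one>"
    and W_mult: "(u, v) \<in> W \<Longrightarrow> chart_inv (charts K) \<one> u \<otimes> chart_inv (charts K) \<one> v \<in> chart_dom (charts K) \<one>"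
    and W_C2: "C2_on W (\<lambda>z. chart (charts K) \<one> (chart_inv (charts K) \<one> (fst z) \<otimes> chart_inv (charts K) \<one> (snd z)))"
begin

abbreviation "dom1 \<equiv> chart_dom (charts K) \<one>"
abbreviation "\<phi> \<equiv> chart (charts K) \<one>"
abbreviation "\<psi> \<equiv> chart_inv (charts K) \<one>"
abbreviation "u0 \<equiv> \<phi> \<one>"

definition chart_mult :: "'a \<times> 'a \<Rightarrow> 'a"
  where "chart_mult z = \<phi> (\<psi> (fst z) \<otimes> \<psi> (snd z))"

text \<open>The mixed bilinear term in the second order expansion of the group law in the chart. The
  directions are arranged so that this is the derivative along X of the left invariant field of
  Y.\<close>

definition mult_hessian :: "'a \<Rightarrow> 'a \<Rightarrow> 'a"
  where "mult_hessian X Y = second_deriv chart_mult (u0, u0) (0, Y) (X, 0)"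

lemma \<psi>_\<phi>: "x \<in> dom1 \<Longrightarrow> \<psi> (\<phi> x) = x"
  by (rule chart_inv_chart[OF C1_man one_closed])

lemma one_dom1: "\<one> \<in> dom1"
  by (rule chart_dom_mem[OF C1_man one_closed])

lemma dom1_carrier: "x \<in> dom1 \<Longrightarrow> x \<in> carrier K"
  using chart_dom_subset[OF C1_man one_closed] by blast

lemma \<psi>_u0: "\<psi> u0 = \<one>"
  by (rule \<psi>_\<phi>[OF one_dom1])

lemma u0_image: "u0 \<in> \<phi> ` dom1"
  using one_dom1 by blast

lemma open_image: "open (\<phi> ` dom1)"
  by (rule open_chart_image[OF C1_man one_closed])

lemma \<psi>_carrier: "u \<in> \<phi> ` dom1 \<Longrightarrow> \<psi> u \<in> carrier K"
  by (intro dom1_carrier chart_inv_mem)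

lemma chart_mult_C2: "C2_on W chart_mult"
  using W_C2 unfolding chart_mult_def[abs_def] .

lemma chart_mult_unit_right: "u \<in> \<phi> ` dom1 \<Longrightarrow> chart_mult (u, u0) = u"
  by (simp add: chart_mult_def \<psi>_u0 \<psi>_carrier chart_chart_inv)

lemma chart_mult_unit_left: "u \<in> \<phi> ` dom1 \<Longrightarrow> chart_mult (u0, u) = u"
  by (simp add: chart_mult_def \<psi>_u0 \<psi>_carrier chart_chart_inv)

lemma dir_deriv_chart_mult_right:
  "u \<in> \<phi> ` dom1 \<Longrightarrow> dir_deriv chart_mult (u0, u) (0, X) = X"
  unfolding dir_deriv_slice_right[symmetric]
  using dir_deriv_cong[OF open_image, of u "\<lambda>v. chart_mult (u0, v)" "\<lambda>v. v" X]
  by (simp add: chart_mult_unit_left dir_derivI[OF has_dir_deriv_ident])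

lemma diff_at_left_field:
  assumes "(u, u0) \<in> W"
  shows "diff_at (charts K) \<phi> (\<psi> u) (left_field K X (\<psi> u)) = dir_deriv chart_mult (u, u0) (0, X)"
proof -
  have u: "u \<in> \<phi> ` dom1" using assms W_subset by blast
  show ?thesis
    unfolding left_field_def dir_deriv_slice_right[symmetric]
    unfolding chart_mult_def fst_conv snd_conv
  proof (rule tangent_map_in_chart[OF C1_man one_closed chart_inv_mem[OF u]])
    show "C1_on ((\<lambda>v. (u, v)) -` W) (\<lambda>v. \<phi> (\<psi> u \<otimes> \<psi> v))"
      using C2_on_C1[OF C2_on_slice_right[OF chart_mult_C2]] by (simp add: chart_mult_def)
  qed (use assms u W_subset W_mult \<psi>_carrier in auto)
qed

lemma diff_at_right_field:
  assumes "(u0, u) \<in> W"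
  shows "diff_at (charts K) \<phi> (\<psi> u) (right_field K (\<lambda>_. X) (\<psi> u)) = dir_deriv chart_mult (u0, u) (X, 0)"
proof -
  have u: "u \<in> \<phi> ` dom1" using assms W_subset by blast
  show ?thesis
    unfolding right_field_def dir_deriv_slice_left[symmetric]
    unfolding chart_mult_def fst_conv snd_conv
  proof (rule tangent_map_in_chart[OF C1_man one_closed chart_inv_mem[OF u]])
    show "C1_on ((\<lambda>v. (v, u)) -` W) (\<lambda>v. \<phi> (\<psi> v \<otimes> \<psi> u))"
      using C2_on_C1[OF C2_on_slice_left[OF chart_mult_C2]] by (simp add: chart_mult_def)
  qed (use assms u W_subset W_mult \<psi>_carrier in auto)
qed

lemma tangent_map_ident:
  assumes "f \<one> = \<one>" "\<And>x. x \<in> carrier K \<Longrightarrow> f x = x"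
  shows "tangent_map (charts K) (charts K) f \<one> X = X"
proof -
  have "tangent_map (charts K) (charts K) f \<one> X = dir_deriv (\<lambda>u. \<phi> (f (\<psi> u))) u0 X"
    unfolding tangent_map_def diff_at_def assms(1) by (simp add: o_def)
  also have "\<dots> = dir_deriv (\<lambda>u. u) u0 X"
    by (rule dir_deriv_cong[OF open_image u0_image]) (simp add: assms(2) \<psi>_carrier chart_chart_inv)
  finally show ?thesis
    by (simp add: dir_derivI[OF has_dir_deriv_ident])
qed

lemma left_field_one: "left_field K X \<one> = X"
  unfolding left_field_def by (rule tangent_map_ident) auto

lemma right_field_one: "right_field K U \<one> = U \<one>"
  unfolding right_field_def by (rule tangent_map_ident) auto

lemma right_coeff_one: "right_coeff K F \<one> = F \<one>"
  unfolding right_coeff_def by (rule tangent_map_ident) auto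

lemma open_slices: "open {u. (u, u0) \<in> W}" "open {u. (u0, u) \<in> W}"
  using C2_on_open[OF C2_on_slice_left[OF chart_mult_C2, of u0]]
    C2_on_open[OF C2_on_slice_right[OF chart_mult_C2, of u0]]
  by (simp_all add: vimage_def)

text \<open>In the chart at the unit the left invariant field of Y at u is the derivative of the
  multiplication at (u, 1) in its right factor; differentiating it in u along X yields the mixed
  second derivative.\<close>

lemma ad_mult_hessian: "ad K X Y = mult_hessian X Y - mult_hessian Y X"
proof -
  have "diff_at (charts K) (\<lambda>x. diff_at (charts K) \<phi> x (left_field K Y x)) \<one> X = mult_hessian X Y" for X Y
  proof -
    have "diff_at (charts K) (\<lambda>x. diff_at (charts K) \<phi> x (left_field K Y x)) \<one> X
        = dir_deriv (\<lambda>u. diff_at (charts K) \<phi> (\<psi> u) (left_field K Y (\<psi> u))) u0 X"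
      unfolding diff_at_def[of "charts K" _ \<one>] by (simp add: o_def)
    also have "\<dots> = dir_deriv (\<lambda>u. dir_deriv chart_mult (u, u0) (0, Y)) u0 X"
      by (rule dir_deriv_cong[OF open_slices(1)]) (use W_unit diff_at_left_field in auto)
    also have "\<dots> = mult_hessian X Y"
      unfolding mult_hessian_def second_deriv_def by (rule dir_deriv_slice_left)
    finally show ?thesis .
  qed
  then show ?thesis
    unfolding ad_def vf_bracket_def by (simp add: left_field_one)
qed

text \<open>A right invariant field is a derivative in the left factor, so the two arguments of the
  mixed derivative change places and symmetry of the second derivative produces the minus
  sign.\<close>

lemma field_bracket_const: "field_bracket K (\<lambda>_. X) (\<lambda>_. Y) \<one> = - ad K X Y"
proof -
  have "diff_at (charts K) (\<lambda>x. diff_at (charts K) \<phi> x (right_field K (\<lambda>_. Y) x)) \<one> X = mult_hessian Y X" for X Y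
  proof -
    have "diff_at (charts K) (\<lambda>x. diff_at (charts K) \<phi> x (right_field K (\<lambda>_. Y) x)) \<one> X
        = dir_deriv (\<lambda>u. diff_at (charts K) \<phi> (\<psi> u) (right_field K (\<lambda>_. Y) (\<psi> u))) u0 X"
      unfolding diff_at_def[of "charts K" _ \<one>] by (simp add: o_def)
    also have "\<dots> = dir_deriv (\<lambda>u. dir_deriv chart_mult (u0, u) (Y, 0)) u0 X"
      by (rule dir_deriv_cong[OF open_slices(2)]) (use W_unit diff_at_right_field in auto)
    also have "\<dots> = second_deriv chart_mult (u0, u0) (Y, 0) (0, X)"
      unfolding second_deriv_def by (rule dir_deriv_slice_right)
    also have "\<dots> = mult_hessian Y X"
      unfolding mult_hessian_def by (rule second_deriv_symmetric[OF chart_mult_C2 W_unit])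
    finally show ?thesis .
  qed
  then show ?thesis
    unfolding field_bracket_def right_coeff_one vf_bracket_def
    by (simp add: right_field_one ad_mult_hessian)
qed

lemma bilinear_mult_hessian: "bilinear mult_hessian"
proof -
  have "linear (\<lambda>X. second_deriv chart_mult (u0, u0) (0, Y) (X, 0))" for Y
    using linear_compose[OF _ linear_second_deriv_right[OF chart_mult_C2 W_unit], of "\<lambda>X. (X, 0)"]
    by (simp add: o_def linear_iff)
  moreover have "linear (\<lambda>Y. second_deriv chart_mult (u0, u0) (0, Y) (X, 0))" for X
    using linear_compose[OF _ linear_second_deriv_left[OF chart_mult_C2 W_unit], of "\<lambda>X. (0, X)"]
    by (simp add: o_def linear_iff)
  ultimately show ?thesis
    unfolding bilinear_def mult_hessian_def by simp
qed

lemma bilinear_ad: "bilinear (ad K)"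
proof -
  have "linear (\<lambda>Y. mult_hessian X Y - mult_hessian Y X)" "linear (\<lambda>Y. mult_hessian Y X - mult_hessian X Y)" for X
    using bilinear_mult_hessian unfolding bilinear_def by (auto intro: linear_compose_sub)
  then show ?thesis
    unfolding bilinear_def ad_mult_hessian by blast
qed

text \<open>Leibniz rule. Besides bilinearity it needs joint continuity, which comes from the
  continuity of the second derivative of the multiplication.\<close>

lemma has_dir_deriv_mult_hessian:
  assumes f: "has_dir_deriv f x v f'" and g: "has_dir_deriv g x v g'"
  shows "has_dir_deriv (\<lambda>z. mult_hessian (f z) (g z)) x v (mult_hessian f' (g x) + mult_hessian (f x) g')"
proof -
  let ?D = "\<lambda>h t. inverse t *\<^sub>R (h (x + t *\<^sub>R v) - h x)"
  have cont: "continuous_on UNIV (\<lambda>(X, Y). mult_hessian X Y)"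
  proof -
    have "continuous_on UNIV (\<lambda>p. (\<lambda>(x, v, w). second_deriv chart_mult x v w) ((u0, u0), (0, snd p), (fst p, 0)))"
      by (rule continuous_on_compose2[OF continuous_on_second_deriv[OF chart_mult_C2]])
        (use W_unit in \<open>auto intro!: continuous_intros\<close>)
    then show ?thesis
      by (simp add: mult_hessian_def case_prod_unfold)
  qed
  have lim: "((\<lambda>t. mult_hessian (a t) (b t)) \<longlongrightarrow> mult_hessian a0 b0) (at (0::real))"
    if "(a \<longlongrightarrow> a0) (at 0)" "(b \<longlongrightarrow> b0) (at 0)" for a b a0 b0
  proof -
    have "isCont (\<lambda>(X, Y). mult_hessian X Y) (a0, b0)"
      using cont by (simp add: continuous_on_eq_continuous_at)
    from isCont_tendsto_compose[OF this tendsto_Pair[OF that]] show ?thesis by simp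
  qed
  have fx: "((\<lambda>t. f (x + t *\<^sub>R v)) \<longlongrightarrow> f x) (at 0)"
  proof -
    have "((\<lambda>t. f x + t *\<^sub>R ?D f t) \<longlongrightarrow> f x + 0 *\<^sub>R f') (at 0)"
      by (intro tendsto_intros tendsto_scaleR_lcs f[unfolded has_dir_deriv_def])
    then have "((\<lambda>t. f (x + t *\<^sub>R v)) \<longlongrightarrow> f x + 0 *\<^sub>R f') (at 0)"
      by (rule Lim_transform_eventually) (auto simp: eventually_at_filter)
    then show ?thesis by simp
  qed
  have "((\<lambda>t. mult_hessian (?D f t) (g x) + mult_hessian (f (x + t *\<^sub>R v)) (?D g t))
      \<longlongrightarrow> mult_hessian f' (g x) + mult_hessian (f x) g') (at 0)"
    by (intro tendsto_add lim tendsto_const fx f[unfolded has_dir_deriv_def] g[unfolded has_dir_deriv_def])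
  then show ?thesis
    unfolding has_dir_deriv_def
    by (simp add: bilinear_lmul[OF bilinear_mult_hessian] bilinear_rmul[OF bilinear_mult_hessian]
        bilinear_lsub[OF bilinear_mult_hessian] bilinear_rsub[OF bilinear_mult_hessian] algebra_simps)
qed

lemma has_dir_deriv_ad:
  assumes "has_dir_deriv f x v f'" "has_dir_deriv g x v g'"
  shows "has_dir_deriv (\<lambda>z. ad K (f z) (g z)) x v (ad K f' (g x) + ad K (f x) g')"
  using has_dir_deriv_diff[OF has_dir_deriv_mult_hessian[OF assms] has_dir_deriv_mult_hessian[OF assms(2,1)]]
  by (simp add: ad_mult_hessian algebra_simps)

end

section \<open>The connection on right invariant fields\<close>

definition cov :: "('g, 'a::locally_convex_space) lie_gp \<Rightarrow> ('a \<Rightarrow> 'a \<Rightarrow> real) \<Rightarrow> 'a \<Rightarrow> 'a \<Rightarrow> 'a"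
  where "cov K ip X Y = (1/2) *\<^sub>R transp ip (ad K X) Y + (1/2) *\<^sub>R transp ip (ad K Y) X - (1/2) *\<^sub>R ad K X Y"

lemma cov_deriv_const: "cov_deriv K ip U (\<lambda>_. Z) x = cov K ip (U x) Z"
  unfolding cov_deriv_def cov_def diff_at_def by (simp add: o_def dir_deriv_const)

text \<open>The covariant derivative of a constant function along a constant function is again
  constant, so no derivative term survives. The connection depends on its first argument only
  through the value at the point, so the bracket field matters only at the unit.\<close>

lemma (in C2_group) curvature_cov:
  "curvature K ip X Y Z = cov K ip X (cov K ip Y Z) - cov K ip Y (cov K ip X Z) - cov K ip (- ad K X Y) Z"
  unfolding curvature_def curvature_field_def cov_deriv_const[abs_def] field_bracket_const ..

section \<open>Actions\<close>

lemma iter_deriv_cong: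
  assumes "open U" "\<And>x. x \<in> U \<Longrightarrow> f x = g x" "x \<in> U"
  shows "iter_deriv k f x v = iter_deriv k g x v"
  using assms(3)
proof (induction k arbitrary: x)
  case (Suc k)
  then show ?case
    using dir_deriv_cong[OF assms(1), of x "\<lambda>z. iter_deriv k f z v" "\<lambda>z. iter_deriv k g z v"] by simp
qed (use assms in auto)

lemma smooth_on_cong:
  assumes f: "smooth_on U f" and eq: "\<And>x. x \<in> U \<Longrightarrow> f x = g x"
  shows "smooth_on U g"
  unfolding smooth_on_def
proof (intro conjI allI ballI)
  show U: "open U" by (rule smooth_on_open[OF f])
  fix k
  have iter: "iter_deriv k f x v = iter_deriv k g x v" if "x \<in> U" for x v
    using iter_deriv_cong[OF U, of f g x k v] eq that by auto
  show "\<exists>l. has_dir_deriv (\<lambda>z. iter_deriv k g z v) x w l" if "x \<in> U" for x v w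
    using has_dir_deriv_transform[OF smooth_on_has_dir_deriv[OF f that, of k v w] U that iter] by blast
  show "continuous_on (U \<times> UNIV) (\<lambda>(x, v). iter_deriv k g x v)"
    using smooth_on_continuous[OF f, of k]
    by (subst continuous_on_cong[OF refl, of _ _ "\<lambda>(x, v). iter_deriv k f x v"]) (auto simp: iter)
qed

text \<open>Replaces the inverse of the product chart by the pair of inverses. They agree on W, and
  smoothness on an open set depends only on the values there.\<close>

lemma smooth_map_prod_at:
  assumes f: "smooth_map (S \<times> T) (prod_charts A B) R C (\<lambda>(x, y). f x y)"
    and A: "C1_manifold S A" and B: "C1_manifold T B" and xy: "x \<in> S" "y \<in> T" "f x y = r"
  obtains W where "(chart A x x, chart B y y) \<in> W" "W \<subseteq> chart A x ` chart_dom A x \<times> chart B y ` chart_dom B y"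
    "\<And>u v. (u, v) \<in> W \<Longrightarrow> f (chart_inv A x u) (chart_inv B y v) \<in> chart_dom C r"
    "smooth_on W (\<lambda>z. chart C r (f (chart_inv A x (fst z)) (chart_inv B y (snd z))))"
proof -
  let ?P = "prod_charts A B"
  obtain W where W: "W \<subseteq> chart ?P (x, y) ` chart_dom ?P (x, y)" "chart ?P (x, y) (x, y) \<in> W"
    "\<And>z. z \<in> W \<Longrightarrow> (\<lambda>(x, y). f x y) (chart_inv ?P (x, y) z) \<in> chart_dom C r"
    "smooth_on W (chart C r \<circ> (\<lambda>(x, y). f x y) \<circ> chart_inv ?P (x, y))"
    using f xy unfolding smooth_map_def by (force dest!: bspec[of _ _ "(x, y)"])
  have inv: "chart_inv ?P (x, y) z = (chart_inv A x (fst z), chart_inv B y (snd z))" if "z \<in> W" for z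
    using chart_inv_prod[OF A B, of "(x, y)" z] xy W(1) that by (auto simp: map_prod_def case_prod_unfold)
  show thesis
  proof (rule that)
    show "(chart A x x, chart B y y) \<in> W" using W(2) by (simp add: chart_prod)
    show "W \<subseteq> chart A x ` chart_dom A x \<times> chart B y ` chart_dom B y"
      using W(1) by (force simp: chart_prod chart_dom_prod)
    show "f (chart_inv A x u) (chart_inv B y v) \<in> chart_dom C r" if "(u, v) \<in> W" for u v
      using W(3)[OF that] inv[OF that] by simp
    show "smooth_on W (\<lambda>z. chart C r (f (chart_inv A x (fst z)) (chart_inv B y (snd z))))"
      by (rule smooth_on_cong[OF W(4)]) (simp add: inv)
  qed
qed

lemma lie_group_C2_group:
  assumes "lie_group K"
  obtains W where "C2_group K W"
proof -
  interpret group K using assms unfolding lie_group_def by blast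
  have man: "C1_manifold (carrier K) (charts K)"
    using assms unfolding lie_group_def by (blast intro: manifold_C1)
  have "smooth_map (carrier K \<times> carrier K) (prod_charts (charts K) (charts K)) (carrier K) (charts K)
      (\<lambda>(x, y). x \<otimes>\<^bsub>K\<^esub> y)"
    using assms unfolding lie_group_def by blast
  from smooth_map_prod_at[OF this man man one_closed one_closed, of "\<one>\<^bsub>K\<^esub>"]
  obtain W where W: "(chart (charts K) \<one>\<^bsub>K\<^esub> \<one>\<^bsub>K\<^esub>, chart (charts K) \<one>\<^bsub>K\<^esub> \<one>\<^bsub>K\<^esub>) \<in> W"
    "W \<subseteq> chart (charts K) \<one>\<^bsub>K\<^esub> ` chart_dom (charts K) \<one>\<^bsub>K\<^esub> \<times> chart (charts K) \<one>\<^bsub>K\<^esub> ` chart_dom (charts K) \<one>\<^bsub>K\<^esub>"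
    "\<And>u v. (u, v) \<in> W \<Longrightarrow> chart_inv (charts K) \<one>\<^bsub>K\<^esub> u \<otimes>\<^bsub>K\<^esub> chart_inv (charts K) \<one>\<^bsub>K\<^esub> v \<in> chart_dom (charts K) \<one>\<^bsub>K\<^esub>"
    "smooth_on W (\<lambda>z. chart (charts K) \<one>\<^bsub>K\<^esub> (chart_inv (charts K) \<one>\<^bsub>K\<^esub> (fst z) \<otimes>\<^bsub>K\<^esub> chart_inv (charts K) \<one>\<^bsub>K\<^esub> (snd z)))"
    by auto
  have "C2_group K W"
    by unfold_locales (use man W smooth_on_C2 in auto)
  then show thesis by (rule that)
qed

section \<open>The linearized action: automorphisms, derivations, representation\<close>

text \<open>The action is kept smooth and not merely C2: \<open>beta\<close> is already a first
  derivative of it, and \<open>beta_C2\<close> asks for two more in the group variable.\<close>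

locale C2_action = G: C2_group G WG + H: C2_group H WH
  for G :: "('g, 'a::locally_convex_space) lie_gp" and WG
    and H :: "('h, 'b::locally_convex_space) lie_gp" and WH +
  fixes B :: "'g \<Rightarrow> 'h \<Rightarrow> 'h" and V :: "('a \<times> 'b) set"
  assumes B_hom: "g \<in> carrier G \<Longrightarrow> B g \<in> hom H H"
    and B_unit: "g \<in> carrier G \<Longrightarrow> B g \<one>\<^bsub>H\<^esub> = \<one>\<^bsub>H\<^esub>"
    and B_one: "y \<in> carrier H \<Longrightarrow> B \<one>\<^bsub>G\<^esub> y = y"
    and B_mult: "g \<in> carrier G \<Longrightarrow> g' \<in> carrier G \<Longrightarrow> y \<in> carrier H \<Longrightarrow> B (g \<otimes>\<^bsub>G\<^esub> g') y = B g (B g' y)"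
    and V_unit: "(G.u0, H.u0) \<in> V"
    and V_subset: "V \<subseteq> G.\<phi> ` G.dom1 \<times> H.\<phi> ` H.dom1"
    and V_dom1: "(u, v) \<in> V \<Longrightarrow> B (G.\<psi> u) (H.\<psi> v) \<in> H.dom1"
    and V_smooth: "smooth_on V (\<lambda>z. H.\<phi> (B (G.\<psi> (fst z)) (H.\<psi> (snd z))))"
begin

definition act :: "'a \<times> 'b \<Rightarrow> 'b"
  where "act z = H.\<phi> (B (G.\<psi> (fst z)) (H.\<psi> (snd z)))"

definition beta :: "'a \<Rightarrow> 'b \<Rightarrow> 'b"
  where "beta u Y = dir_deriv act (u, H.u0) (0, Y)"

abbreviation "b \<equiv> infinitesimal_action G H B"

abbreviation "V0 \<equiv> {u. (u, H.u0) \<in> V}"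

lemma act_smooth: "smooth_on V act"
  using V_smooth unfolding act_def[abs_def] .

lemma act_C2: "C2_on V act"
  by (rule smooth_on_C2[OF act_smooth])

lemma act_unit: "u \<in> G.\<phi> ` G.dom1 \<Longrightarrow> act (u, H.u0) = H.u0"
  by (simp add: act_def H.\<psi>_u0 B_unit G.\<psi>_carrier)

lemma V0_image: "u \<in> V0 \<Longrightarrow> u \<in> G.\<phi> ` G.dom1"
  using V_subset by auto

lemma open_V0: "open V0"
  using C2_on_open[OF C2_on_slice_left[OF act_C2, of H.u0]] by (simp add: vimage_def)

lemma beta_slice: "beta u Y = dir_deriv (\<lambda>v. act (u, v)) H.u0 Y"
  unfolding beta_def by (rule dir_deriv_slice_right[symmetric])

lemma induced_action_beta:
  assumes "u \<in> G.\<phi> ` G.dom1"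
  shows "induced_action H B (G.\<psi> u) Y = beta u Y"
  unfolding induced_action_def tangent_map_def diff_at_def B_unit[OF G.\<psi>_carrier[OF assms]] beta_slice act_def
  by (simp add: o_def)

lemma beta_u0: "beta G.u0 Y = Y"
proof -
  have "beta G.u0 Y = dir_deriv (\<lambda>v. v) H.u0 Y"
    unfolding beta_slice
    by (rule dir_deriv_cong[OF H.open_image H.u0_image])
      (simp add: act_def G.\<psi>_u0 B_one H.\<psi>_carrier chart_chart_inv)
  then show ?thesis
    by (simp add: dir_derivI[OF has_dir_deriv_ident])
qed

lemma beta_C2: "C2_on V0 (\<lambda>u. beta u Y)"
  using C2_on_slice_left[OF smooth_on_C2[OF smooth_on_dir_deriv[OF act_smooth]], of H.u0 "(0, Y)"]
  unfolding beta_def by (simp add: vimage_def)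

lemma b_dir_deriv: "b X Y = dir_deriv (\<lambda>u. beta u Y) G.u0 X"
  unfolding infinitesimal_action_def diff_at_def o_def
  by (rule dir_deriv_cong[OF G.open_image G.u0_image]) (rule induced_action_beta)

lemma u0_V0: "G.u0 \<in> V0"
  using V_unit by simp

lemma has_dir_deriv_beta: "has_dir_deriv (\<lambda>u. beta u Y) G.u0 X (b X Y)"
  unfolding b_dir_deriv by (rule C1_on_has_dir_deriv[OF C2_on_C1[OF beta_C2] u0_V0])

text \<open>Exhibits b as a mixed second derivative of the action, from which linearity in Y
  follows.\<close>

lemma b_second_deriv: "b X Y = second_deriv act (G.u0, H.u0) (0, Y) (X, 0)"
  unfolding b_dir_deriv beta_def second_deriv_def by (rule dir_deriv_slice_left)

lemma linear_b_left: "linear (\<lambda>X. b X Y)"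
  unfolding b_dir_deriv by (rule linear_dir_deriv[OF C2_on_C1[OF beta_C2] u0_V0])

lemma linear_b: "linear (b X)"
proof -
  have "linear (\<lambda>Y. (0::'a, Y :: 'b))" by (simp add: linear_iff)
  from linear_compose[OF this linear_second_deriv_left[OF act_C2 V_unit]]
  show ?thesis
    unfolding b_second_deriv[abs_def] o_def .
qed

text \<open>A continuous linear operator commutes with derivatives; here this is the tangent formula
  with a fixed base point, where the second derivative term is taken in direction 0.\<close>

lemma has_dir_deriv_beta_apply:
  assumes "u \<in> V0" "has_dir_deriv h x v h'"
  shows "has_dir_deriv (\<lambda>z. beta u (h z)) x v (beta u h')"
proof -
  have "has_dir_deriv (\<lambda>z. dir_deriv act (u, H.u0) (0, h z)) x v
     (second_deriv act (u, H.u0) (0, h x) 0 + dir_deriv act (u, H.u0) (0, h'))"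
    using has_dir_deriv_dir_deriv[OF act_C2, of "\<lambda>_. (u, H.u0)" x v 0 "\<lambda>z. (0, h z)" "(0, h')"]
      has_dir_deriv_Pair[OF has_dir_deriv_const assms(2)] has_dir_deriv_const assms(1) by auto
  then show ?thesis
    using linear_second_deriv_right[OF act_C2, of "(u, H.u0)"] assms(1)
    by (simp add: linear_0 beta_def)
qed

text \<open>The tangent map of a group homomorphism preserves brackets. In the chart, f(m(v, w)) =
  m(f v, f w) is differentiated in w and then in v at the unit. This leaves a second derivative of
  f, which is symmetric and drops out after antisymmetrization.\<close>

lemma beta_ad:
  assumes u: "u \<in> V0"
  shows "beta u (ad H Y Z) = ad H (beta u Y) (beta u Z)"
proof -
  let ?f = "\<lambda>v. act (u, v)" and ?N = "{v. (u, v) \<in> V}" and ?m = H.chart_mult and ?v0 = H.u0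
  have fC: "C2_on ?N ?f"
    using C2_on_slice_right[OF act_C2, of u] by (simp add: vimage_def)
  have f1: "C1_on ?N ?f" and m1: "C1_on WH ?m"
    by (intro C2_on_C1 fC H.chart_mult_C2)+
  have v0N: "?v0 \<in> ?N" using u by simp
  have fv0: "?f ?v0 = ?v0"
    by (rule act_unit[OF V0_image[OF u]])
  have uG: "G.\<psi> u \<in> carrier G"
    by (rule G.\<psi>_carrier[OF V0_image[OF u]])
  have hess: "dir_deriv ?f ?v0 (H.mult_hessian Y Z) + second_deriv ?f ?v0 Z Y =
      H.mult_hessian (beta u Y) (beta u Z)" for Y Z
  proof -
    let ?N1 = "{v. (v, ?v0) \<in> WH}"
    have slice: "C1_on ?N1 (\<lambda>v. ?m (v, ?v0))"
      using C2_on_C1[OF C2_on_slice_left[OF H.chart_mult_C2, of ?v0]] by (simp add: vimage_def)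
    have fslice: "open (?f -` ?N1 \<inter> ?N)"
      using C1_on_open[OF C1_on_compose[OF slice f1]] .
    \<comment> \<open>For v in \<open>N0\<close> both v and its image under f can be multiplied in
      the chart by elements near the unit.\<close>
    define N0 where "N0 = ?N1 \<inter> (?f -` ?N1 \<inter> ?N)"
    have N0: "open N0" "?v0 \<in> N0"
      using fslice H.open_slices(1) H.W_unit v0N fv0 unfolding N0_def by auto
    have eq: "dir_deriv ?f v (dir_deriv ?m (v, ?v0) (0, Z)) = dir_deriv ?m (?f v, ?v0) (0, beta u Z)"
      if v: "v \<in> N0" for v
    proof -
      have v': "(v, ?v0) \<in> WH" "(?f v, ?v0) \<in> WH" "v \<in> ?N" using v unfolding N0_def by auto
      have vi: "v \<in> H.\<phi> ` H.dom1" using v'(1) H.W_subset by blast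
      have mv: "?m (v, ?v0) = v" by (rule H.chart_mult_unit_right[OF vi])
      let ?M = "{w. (v, w) \<in> WH}"
      have mC: "C1_on ?M (\<lambda>w. ?m (v, w))"
        using C2_on_C1[OF C2_on_slice_right[OF H.chart_mult_C2, of v]] by (simp add: vimage_def)
      let ?M' = "(\<lambda>w. ?m (v, w)) -` ?N \<inter> ?M"
      have M': "open ?M'" by (rule C1_on_open[OF C1_on_compose[OF f1 mC]])
      \<comment> \<open>The homomorphism property of \<open>B\<close>, transported to coordinates;
        it holds for w near the unit, which is enough to differentiate there.\<close>
      have *: "?f (?m (v, w)) = ?m (?f v, ?f w)" if w: "w \<in> ?M' \<inter> ?N" for w
      proof -
        have wi: "w \<in> H.\<phi> ` H.dom1" using w H.W_subset by blast
        have "H.\<psi> (?m (v, w)) = H.\<psi> v \<otimes>\<^bsub>H\<^esub> H.\<psi> w"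
          using H.W_mult[of v w] w by (simp add: H.chart_mult_def H.\<psi>_\<phi>)
        then have "?f (?m (v, w)) = H.\<phi> (B (G.\<psi> u) (H.\<psi> v) \<otimes>\<^bsub>H\<^esub> B (G.\<psi> u) (H.\<psi> w))"
          using hom_mult[OF B_hom[OF uG] H.\<psi>_carrier[OF vi] H.\<psi>_carrier[OF wi]] by (simp add: act_def)
        also have "\<dots> = ?m (?f v, ?f w)"
          using V_dom1[of u v] V_dom1[of u w] v'(3) w by (simp add: H.chart_mult_def act_def H.\<psi>_\<phi>)
        finally show ?thesis .
      qed
      have v0M: "?v0 \<in> ?M' \<inter> ?N" using v' v0N mv by simp
      have "dir_deriv ?f v (dir_deriv ?m (v, ?v0) (0, Z)) = dir_deriv ?f (?m (v, ?v0)) (dir_deriv (\<lambda>w. ?m (v, w)) ?v0 Z)"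
        unfolding mv dir_deriv_slice_right ..
      also have "\<dots> = dir_deriv (\<lambda>w. ?f (?m (v, w))) ?v0 Z"
        using v' mv by (intro dir_deriv_compose[OF f1 _ mC, symmetric]) auto
      also have "\<dots> = dir_deriv (\<lambda>w. ?m (?f v, ?f w)) ?v0 Z"
        by (rule dir_deriv_cong[OF open_Int[OF M' C1_on_open[OF f1]] v0M *])
      also have "\<dots> = dir_deriv ?m (?f v, ?v0) (0, dir_deriv ?f ?v0 Z)"
      proof (rule dir_derivI)
        have "has_dir_deriv (\<lambda>w. (?f v, ?f w)) ?v0 Z (0, dir_deriv ?f ?v0 Z)"
          by (intro has_dir_deriv_Pair has_dir_deriv_const C1_on_has_dir_deriv[OF f1 v0N])
        from has_dir_deriv_compose[OF m1 _ this]
        show "has_dir_deriv (\<lambda>w. ?m (?f v, ?f w)) ?v0 Z (dir_deriv ?m (?f v, ?v0) (0, dir_deriv ?f ?v0 Z))"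
          using v'(2) fv0 by simp
      qed
      finally show ?thesis unfolding beta_slice .
    qed
    \<comment> \<open>Both sides of \<open>eq\<close> are differentiated along Y at the unit and
      compared by uniqueness of derivatives.\<close>
    have "has_dir_deriv (\<lambda>v. dir_deriv ?f v (dir_deriv ?m (v, ?v0) (0, Z))) ?v0 Y
        (second_deriv ?f ?v0 (dir_deriv ?m (?v0, ?v0) (0, Z)) Y + dir_deriv ?f ?v0 (H.mult_hessian Y Z))"
    proof (rule has_dir_deriv_dir_deriv[OF fC v0N has_dir_deriv_ident])
      show "has_dir_deriv (\<lambda>v. dir_deriv ?m (v, ?v0) (0, Z)) ?v0 Y (H.mult_hessian Y Z)"
        unfolding H.mult_hessian_def has_dir_deriv_slice_left[of "\<lambda>z. dir_deriv ?m z (0, Z)"]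
        by (rule has_dir_deriv_second[OF H.chart_mult_C2 H.W_unit])
    qed
    then have L: "has_dir_deriv (\<lambda>v. dir_deriv ?m (?f v, ?v0) (0, beta u Z)) ?v0 Y
        (second_deriv ?f ?v0 Z Y + dir_deriv ?f ?v0 (H.mult_hessian Y Z))"
      using has_dir_deriv_transform[OF _ N0 eq] by (simp add: H.dir_deriv_chart_mult_right[OF H.u0_image])
    have "has_dir_deriv (\<lambda>v. dir_deriv ?m (?f v, ?v0) (0, beta u Z)) ?v0 Y
        (second_deriv ?m (?f ?v0, ?v0) (0, beta u Z) (beta u Y, 0) + dir_deriv ?m (?f ?v0, ?v0) 0)"
      unfolding beta_slice[of u Y]
      by (intro has_dir_deriv_dir_deriv[OF H.chart_mult_C2] has_dir_deriv_Pair has_dir_deriv_const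
          C1_on_has_dir_deriv[OF f1 v0N]) (simp add: fv0 H.W_unit)
    from has_dir_deriv_unique[OF L this] show ?thesis
      by (simp add: fv0 dir_deriv_zero_direction H.mult_hessian_def add.commute)
  qed
  have "linear (dir_deriv ?f ?v0)"
    by (rule linear_dir_deriv[OF f1 v0N])
  then have "beta u (ad H Y Z) = dir_deriv ?f ?v0 (H.mult_hessian Y Z) - dir_deriv ?f ?v0 (H.mult_hessian Z Y)"
    unfolding beta_slice H.ad_mult_hessian by (rule linear_diff)
  \<comment> \<open>The same symmetric term is added and subtracted so that \<open>hess\<close>
    applies to each summand.\<close>
  also have "\<dots> = (dir_deriv ?f ?v0 (H.mult_hessian Y Z) + second_deriv ?f ?v0 Z Y)
      - (dir_deriv ?f ?v0 (H.mult_hessian Z Y) + second_deriv ?f ?v0 Y Z)"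
    by (simp add: second_deriv_symmetric[OF fC v0N, of Y Z])
  finally show ?thesis
    unfolding hess H.ad_mult_hessian .
qed

text \<open>The derivative at the unit, along X, of the automorphism property
  \<open>beta_ad\<close>.\<close>

lemma b_derivation: "b X (ad H Y Z) = ad H (b X Y) Z + ad H Y (b X Z)"
proof -
  have "has_dir_deriv (\<lambda>u. beta u (ad H Y Z)) G.u0 X (ad H (b X Y) (beta G.u0 Z) + ad H (beta G.u0 Y) (b X Z))"
    by (rule has_dir_deriv_transform[OF H.has_dir_deriv_ad[OF has_dir_deriv_beta has_dir_deriv_beta] open_V0 u0_V0])
      (rule beta_ad[symmetric])
  from has_dir_deriv_unique[OF has_dir_deriv_beta this] show ?thesis
    by (simp add: beta_u0)
qed

text \<open>The chain rule applied to the action law in charts: T(B(g) o B(g')) is the composite of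
  the tangent maps at the unit, which every B(g) fixes.\<close>

lemma beta_mult:
  assumes "(u, v) \<in> WG" "u \<in> V0" "v \<in> V0" "G.chart_mult (u, v) \<in> V0"
  shows "beta (G.chart_mult (u, v)) Y = beta u (beta v Y)"
proof -
  let ?f = "\<lambda>u y. act (u, y)"
  have sl: "C1_on {y. (u, y) \<in> V} (?f u)" for u
    using C2_on_C1[OF C2_on_slice_right[OF act_C2, of u]] by (simp add: vimage_def)
  have ui: "u \<in> G.\<phi> ` G.dom1" and vi: "v \<in> G.\<phi> ` G.dom1"
    using assms V0_image by auto
  have "?f (G.chart_mult (u, v)) y = ?f u (?f v y)" if y: "y \<in> {y. (v, y) \<in> V}" for y
  proof -
    have yi: "y \<in> H.\<phi> ` H.dom1" using y V_subset by blast
    have "G.\<psi> (G.chart_mult (u, v)) = G.\<psi> u \<otimes>\<^bsub>G\<^esub> G.\<psi> v"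
      using G.W_mult[OF assms(1)] by (simp add: G.chart_mult_def G.\<psi>_\<phi>)
    moreover have "H.\<psi> (?f v y) = B (G.\<psi> v) (H.\<psi> y)"
      using V_dom1[of v y] y by (simp add: act_def H.\<psi>_\<phi>)
    ultimately show ?thesis
      using B_mult[OF G.\<psi>_carrier[OF ui] G.\<psi>_carrier[OF vi] H.\<psi>_carrier[OF yi]] by (simp add: act_def)
  qed
  then have "beta (G.chart_mult (u, v)) Y = dir_deriv (\<lambda>y. ?f u (?f v y)) H.u0 Y"
    unfolding beta_slice using assms(3) by (intro dir_deriv_cong[OF C1_on_open[OF sl[of v]]]) auto
  also have "\<dots> = beta u (beta v Y)"
    unfolding beta_slice using assms act_unit[OF vi]
    by (subst dir_deriv_compose[OF sl[of u] _ sl[of v]]) auto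
  finally show ?thesis .
qed

text \<open>The pattern of \<open>beta_ad\<close> for the representation: \<open>beta_mult\<close>
  is differentiated in the right factor, then in the left one, and the symmetric second derivative
  of \<open>beta\<close> cancels in the commutator.\<close>

lemma b_ad: "b (ad G X X') Y = b X (b X' Y) - b X' (b X Y)"
proof -
  let ?f = "\<lambda>u. beta u Y" and ?m = G.chart_mult and ?u0 = G.u0
  have f1: "C1_on V0 ?f" by (intro C2_on_C1 beta_C2)
  have hess: "second_deriv ?f ?u0 X' X + b (G.mult_hessian X X') Y = b X (b X' Y)" for X X'
  proof -
    define N0 where "N0 = {u. (u, ?u0) \<in> WG} \<inter> V0"
    have N0: "open N0" "?u0 \<in> N0"
      unfolding N0_def using G.open_slices(1) open_V0 G.W_unit u0_V0 by auto
    have eq: "dir_deriv ?f u (dir_deriv ?m (u, ?u0) (0, X')) = beta u (b X' Y)" if u: "u \<in> N0" for u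
    proof -
      let ?M = "{v. (u, v) \<in> WG}"
      have mC: "C1_on ?M (\<lambda>v. ?m (u, v))"
        using C2_on_C1[OF C2_on_slice_right[OF G.chart_mult_C2, of u]] by (simp add: vimage_def)
      have uV: "u \<in> V0" and u0M: "?u0 \<in> ?M" using u unfolding N0_def by auto
      have mu: "?m (u, ?u0) = u" by (rule G.chart_mult_unit_right[OF V0_image[OF uV]])
      let ?M' = "(\<lambda>v. ?m (u, v)) -` V0 \<inter> ?M"
      have M': "open ?M'" by (rule C1_on_open[OF C1_on_compose[OF f1 mC]])
      have "dir_deriv ?f u (dir_deriv ?m (u, ?u0) (0, X')) = dir_deriv ?f (?m (u, ?u0)) (dir_deriv (\<lambda>v. ?m (u, v)) ?u0 X')"
        unfolding mu dir_deriv_slice_right ..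
      also have "\<dots> = dir_deriv (\<lambda>v. ?f (?m (u, v))) ?u0 X'"
        using mu uV u0M by (intro dir_deriv_compose[OF f1 _ mC, symmetric]) auto
      also have "\<dots> = dir_deriv (\<lambda>v. beta u (beta v Y)) ?u0 X'"
        using mu uV u0M u0_V0 by (intro dir_deriv_cong[OF open_Int[OF M' open_V0]] beta_mult) auto
      also have "\<dots> = beta u (b X' Y)"
        by (intro dir_derivI has_dir_deriv_beta_apply[OF uV] has_dir_deriv_beta)
      finally show ?thesis .
    qed
    have "has_dir_deriv (\<lambda>u. dir_deriv ?f u (dir_deriv ?m (u, ?u0) (0, X'))) ?u0 X
        (second_deriv ?f ?u0 (dir_deriv ?m (?u0, ?u0) (0, X')) X + dir_deriv ?f ?u0 (G.mult_hessian X X'))"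
    proof (rule has_dir_deriv_dir_deriv[OF beta_C2 u0_V0 has_dir_deriv_ident])
      show "has_dir_deriv (\<lambda>v. dir_deriv ?m (v, ?u0) (0, X')) ?u0 X (G.mult_hessian X X')"
        unfolding G.mult_hessian_def has_dir_deriv_slice_left[of "\<lambda>z. dir_deriv ?m z (0, X')"]
        by (rule has_dir_deriv_second[OF G.chart_mult_C2 G.W_unit])
    qed
    then have "has_dir_deriv (\<lambda>u. beta u (b X' Y)) ?u0 X
        (second_deriv ?f ?u0 X' X + b (G.mult_hessian X X') Y)"
      unfolding b_dir_deriv[of "G.mult_hessian X X'" Y]
      using has_dir_deriv_transform[OF _ N0 eq] by (simp add: G.dir_deriv_chart_mult_right[OF G.u0_image])
    from has_dir_deriv_unique[OF this has_dir_deriv_beta] show ?thesis .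
  qed
  have "b (ad G X X') Y = b (G.mult_hessian X X') Y - b (G.mult_hessian X' X) Y"
    unfolding G.ad_mult_hessian using linear_diff[OF linear_b_left] by simp
  also have "\<dots> = (second_deriv ?f ?u0 X' X + b (G.mult_hessian X X') Y)
      - (second_deriv ?f ?u0 X X' + b (G.mult_hessian X' X) Y)"
    by (simp add: second_deriv_symmetric[OF beta_C2 u0_V0, where v = X' and w = X])
  finally show ?thesis
    unfolding hess .
qed

text \<open>The orbit curve of Y along the coordinate line in direction X has constant norm and
  initial velocity b(X) Y.\<close>

lemma b_skew:
  assumes ip: "bounded_inner_product ip"
    and iso: "\<And>g Y Y'. g \<in> carrier G \<Longrightarrow> ip (induced_action H B g Y) (induced_action H B g Y') = ip Y Y'"
  shows "ip (b X Y) Z = - ip Y (b X Z)"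
proof -
  have bil: "bilinear ip" and sym: "\<And>X Y. ip X Y = ip Y X"
    using ip unfolding bounded_inner_product_def by auto
  \<comment> \<open>Only the diagonal is differentiated, since \<open>constant_norm_curve\<close>
    concerns a single curve; polarization recovers skewness.\<close>
  have diag: "ip Y (b X Y) = 0" for Y
  proof -
    have "\<forall>\<^sub>F t in at 0. G.u0 + t *\<^sub>R X \<in> V0"
      by (rule topological_tendstoD[OF tendsto_line open_V0 u0_V0])
    then obtain \<delta> where \<delta>: "\<delta> > 0" "\<And>t. t \<noteq> 0 \<Longrightarrow> \<bar>t\<bar> < \<delta> \<Longrightarrow> G.u0 + t *\<^sub>R X \<in> V0"
      by (auto simp: eventually_at)
    have inV: "G.u0 + t *\<^sub>R X \<in> V0" if "\<bar>t\<bar> < \<delta>" for t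
      using \<delta>(2)[of t] that u0_V0 by (cases "t = 0") auto
    let ?c = "\<lambda>t. beta (G.u0 + t *\<^sub>R X) Y"
    let ?c' = "\<lambda>t. dir_deriv (\<lambda>u. beta u Y) (G.u0 + t *\<^sub>R X) X"
    have "ip (?c 0) (?c' 0) = 0"
    proof (rule constant_norm_curve[OF ip \<delta>(1)])
      show "has_dir_deriv ?c t 1 (?c' t)" if "\<bar>t\<bar> < \<delta>" for t
        by (intro has_dir_deriv_line C1_on_has_dir_deriv[OF C2_on_C1[OF beta_C2] inV[OF that]])
      show "has_dir_deriv ?c' 0 1 (second_deriv (\<lambda>u. beta u Y) (G.u0 + 0 *\<^sub>R X) X X)"
        using inV[of 0] \<delta>(1) by (intro has_dir_deriv_line has_dir_deriv_second[OF beta_C2]) auto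
      show "ip (?c t) (?c t) = ip (?c 0) (?c 0)" if "\<bar>t\<bar> < \<delta>" for t
        using V0_image[OF inV[OF that]] V0_image[OF inV[of 0]] \<delta>(1)
        by (simp flip: induced_action_beta add: iso G.\<psi>_carrier)
    qed
    then show ?thesis
      by (simp add: beta_u0 b_dir_deriv)
  qed
  have "ip (Y + Z) (b X (Y + Z)) = 0" by (rule diag)
  then have "ip Y (b X Z) + ip Z (b X Y) = 0"
    using diag[of Y] diag[of Z]
    by (simp add: linear_add[OF linear_b] bilinear_ladd[OF bil] bilinear_radd[OF bil])
  then show ?thesis
    using sym[of "b X Y" Z] by simp
qed

end

lemma smooth_action_C2_action:
  assumes "lie_group G" "lie_group H" "smooth_action G H B"
  obtains WG WH V where "C2_action G WG H WH B V"
proof -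
  obtain WG WH where GH: "C2_group G WG" "C2_group H WH"
    using lie_group_C2_group[OF assms(1)] lie_group_C2_group[OF assms(2)] by metis
  interpret G: C2_group G WG by (rule GH)
  interpret H: C2_group H WH by (rule GH)
  have grp: "group H" using assms(2) unfolding lie_group_def by blast
  have act: "\<And>g. g \<in> carrier G \<Longrightarrow> B g \<in> hom H H" "\<And>y. y \<in> carrier H \<Longrightarrow> B \<one>\<^bsub>G\<^esub> y = y"
    "\<And>g g' y. g \<in> carrier G \<Longrightarrow> g' \<in> carrier G \<Longrightarrow> y \<in> carrier H \<Longrightarrow> B (g \<otimes>\<^bsub>G\<^esub> g') y = B g (B g' y)"
    and sm: "smooth_map (carrier G \<times> carrier H) (prod_charts (charts G) (charts H))
      (carrier H) (charts H) (\<lambda>(g, y). B g y)"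
    using assms(3) unfolding smooth_action_def by auto
  obtain V where V: "(G.u0, H.u0) \<in> V" "V \<subseteq> G.\<phi> ` G.dom1 \<times> H.\<phi> ` H.dom1"
    "\<And>u v. (u, v) \<in> V \<Longrightarrow> B (G.\<psi> u) (H.\<psi> v) \<in> H.dom1"
    "smooth_on V (\<lambda>z. H.\<phi> (B (G.\<psi> (fst z)) (H.\<psi> (snd z))))"
    using smooth_map_prod_at[OF sm G.C1_man H.C1_man G.one_closed H.one_closed act(2)[OF H.one_closed]] by auto
  have "B g \<one>\<^bsub>H\<^esub> = \<one>\<^bsub>H\<^esub>" if "g \<in> carrier G" for g
    using hom_one[OF act(1)[OF that] grp grp] .
  then have "C2_action G WG H WH B V"
    by unfold_locales (use act V in auto)
  then show thesis by (rule that)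
qed

section \<open>Semidirect products\<close>

context C2_action
begin

text \<open>In order: the two G-components can be multiplied in the chart, the action is defined on
  the second H-component, and its result can be multiplied by the first.\<close>

definition W_semidirect :: "(('a \<times> 'b) \<times> 'a \<times> 'b) set"
  where "W_semidirect = {z. (fst (fst z), fst (snd z)) \<in> WG \<and> (fst (fst z), snd (snd z)) \<in> V \<and>
    (snd (fst z), act (fst (fst z), snd (snd z))) \<in> WH}"

definition semidirect_mult :: "('a \<times> 'b) \<times> 'a \<times> 'b \<Rightarrow> 'a \<times> 'b"
  where "semidirect_mult z = (G.chart_mult (fst (fst z), fst (snd z)),
    H.chart_mult (snd (fst z), act (fst (fst z), snd (snd z))))"

lemma C2_semidirect_mult: "C2_on W_semidirect semidirect_mult"
proof -
  have l1: "C2_on UNIV (\<lambda>z::('a \<times> 'b) \<times> 'a \<times> 'b. (fst (fst z), fst (snd z)))"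
    and l2: "C2_on UNIV (\<lambda>z::('a \<times> 'b) \<times> 'a \<times> 'b. (fst (fst z), snd (snd z)))"
    and l3: "C2_on UNIV (\<lambda>z::('a \<times> 'b) \<times> 'a \<times> 'b. snd (fst z))"
    by (intro C2_on_linear; force simp: linear_iff intro!: continuous_intros)+
  note c1 = C2_on_compose[OF G.chart_mult_C2 l1] and c2 = C2_on_compose[OF act_C2 l2]
  have c3: "C2_on ((\<lambda>z::('a \<times> 'b) \<times> 'a \<times> 'b. (fst (fst z), snd (snd z))) -` V \<inter> UNIV)
     (\<lambda>z. (snd (fst z), act (fst (fst z), snd (snd z))))"
    by (intro C2_on_Pair c2 C2_on_subset[OF l3] C2_on_open[OF c2]) auto
  note c4 = C2_on_compose[OF H.chart_mult_C2 c3]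
  have W: "W_semidirect = ((\<lambda>z::('a \<times> 'b) \<times> 'a \<times> 'b. (fst (fst z), fst (snd z))) -` WG \<inter> UNIV) \<inter>
      ((\<lambda>z. (snd (fst z), act (fst (fst z), snd (snd z)))) -` WH \<inter> ((\<lambda>z. (fst (fst z), snd (snd z))) -` V \<inter> UNIV))"
    unfolding W_semidirect_def by auto
  have "open W_semidirect"
    unfolding W by (intro open_Int[OF C2_on_open[OF c1] C2_on_open[OF c4]])
  then show ?thesis
    unfolding semidirect_mult_def[abs_def]
    by (intro C2_on_Pair C2_on_subset[OF c1] C2_on_subset[OF c4]) (auto simp: W_semidirect_def)
qed

lemma W_semidirect_image:
  "(p, q) \<in> W_semidirect \<Longrightarrow> fst p \<in> G.\<phi> ` G.dom1 \<and> snd p \<in> H.\<phi> ` H.dom1 \<and> fst q \<in> G.\<phi> ` G.dom1 \<and> snd q \<in> H.\<phi> ` H.dom1"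
  unfolding W_semidirect_def using G.W_subset H.W_subset V_subset by auto

lemma semidirect_simps:
  "charts (semidirect G H B) = prod_charts (charts G) (charts H)"
  "\<one>\<^bsub>semidirect G H B\<^esub> = (\<one>\<^bsub>G\<^esub>, \<one>\<^bsub>H\<^esub>)"
  "carrier (semidirect G H B) = carrier G \<times> carrier H"
  "p \<otimes>\<^bsub>semidirect G H B\<^esub> q = (fst p \<otimes>\<^bsub>G\<^esub> fst q, snd p \<otimes>\<^bsub>H\<^esub> B (fst p) (snd q))"
  unfolding semidirect_def by (simp_all add: case_prod_unfold)

lemma semidirect_chart_inv:
  assumes "fst p \<in> G.\<phi> ` G.dom1" "snd p \<in> H.\<phi> ` H.dom1"
  shows "chart_inv (prod_charts (charts G) (charts H)) (\<one>\<^bsub>G\<^esub>, \<one>\<^bsub>H\<^esub>) p = (G.\<psi> (fst p), H.\<psi> (snd p))"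
proof -
  have "p \<in> chart (prod_charts (charts G) (charts H)) (\<one>\<^bsub>G\<^esub>, \<one>\<^bsub>H\<^esub>) `
      chart_dom (prod_charts (charts G) (charts H)) (\<one>\<^bsub>G\<^esub>, \<one>\<^bsub>H\<^esub>)"
    using assms by (cases p) (auto simp: chart_prod chart_dom_prod)
  from chart_inv_prod[OF G.C1_man H.C1_man _ _ this] show ?thesis
    by (simp add: map_prod_def case_prod_unfold)
qed

lemma semidirect_mult_in_chart:
  assumes "(p, q) \<in> W_semidirect"
  defines "\<psi> \<equiv> chart_inv (prod_charts (charts G) (charts H)) (\<one>\<^bsub>G\<^esub>, \<one>\<^bsub>H\<^esub>)"
  shows "\<psi> p \<otimes>\<^bsub>semidirect G H B\<^esub> \<psi> q \<in> chart_dom (prod_charts (charts G) (charts H)) (\<one>\<^bsub>G\<^esub>, \<one>\<^bsub>H\<^esub>)"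
    and "chart (prod_charts (charts G) (charts H)) (\<one>\<^bsub>G\<^esub>, \<one>\<^bsub>H\<^esub>) (\<psi> p \<otimes>\<^bsub>semidirect G H B\<^esub> \<psi> q) = semidirect_mult (p, q)"
proof -
  have W: "(fst p, fst q) \<in> WG" "(fst p, snd q) \<in> V" "(snd p, act (fst p, snd q)) \<in> WH"
    using assms(1) unfolding W_semidirect_def by auto
  have "H.\<psi> (act (fst p, snd q)) = B (G.\<psi> (fst p)) (H.\<psi> (snd q))"
    using V_dom1[OF W(2)] by (simp add: act_def H.\<psi>_\<phi>)
  then have eq: "\<psi> p \<otimes>\<^bsub>semidirect G H B\<^esub> \<psi> q =
      (G.\<psi> (fst p) \<otimes>\<^bsub>G\<^esub> G.\<psi> (fst q), H.\<psi> (snd p) \<otimes>\<^bsub>H\<^esub> H.\<psi> (act (fst p, snd q)))"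
    using W_semidirect_image[OF assms(1)] by (simp add: \<psi>_def semidirect_chart_inv semidirect_simps)
  show "\<psi> p \<otimes>\<^bsub>semidirect G H B\<^esub> \<psi> q \<in> chart_dom (prod_charts (charts G) (charts H)) (\<one>\<^bsub>G\<^esub>, \<one>\<^bsub>H\<^esub>)"
    unfolding eq chart_dom_prod using G.W_mult[OF W(1)] H.W_mult[OF W(3)] by simp
  show "chart (prod_charts (charts G) (charts H)) (\<one>\<^bsub>G\<^esub>, \<one>\<^bsub>H\<^esub>) (\<psi> p \<otimes>\<^bsub>semidirect G H B\<^esub> \<psi> q) = semidirect_mult (p, q)"
    unfolding eq chart_prod by (simp add: semidirect_mult_def G.chart_mult_def H.chart_mult_def)
qed

lemma B_closed: "g \<in> carrier G \<Longrightarrow> y \<in> carrier H \<Longrightarrow> B g y \<in> carrier H"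
  using hom_in_carrier[OF B_hom] .

lemma monoid_semidirect: "monoid (semidirect G H B)"
  by unfold_locales
    (auto simp: semidirect_simps B_closed B_unit B_one B_mult hom_mult[OF B_hom] G.m_assoc H.m_assoc)

text \<open>Makes every result on \<open>C2_group\<close>, in particular the formulas for bracket
  and curvature, available for the semidirect product.\<close>

lemma C2_group_semidirect: "C2_group (semidirect G H B) W_semidirect"
proof (intro C2_group.intro monoid_semidirect C2_group_axioms.intro)
  have u0: "chart (charts (semidirect G H B)) \<one>\<^bsub>semidirect G H B\<^esub> \<one>\<^bsub>semidirect G H B\<^esub> = (G.u0, H.u0)"
    by (simp add: semidirect_simps chart_prod)
  show "C1_manifold (carrier (semidirect G H B)) (charts (semidirect G H B))"
    unfolding semidirect_simps by (rule C1_manifold_prod[OF G.C1_man H.C1_man])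
  show "(chart (charts (semidirect G H B)) \<one>\<^bsub>semidirect G H B\<^esub> \<one>\<^bsub>semidirect G H B\<^esub>,
      chart (charts (semidirect G H B)) \<one>\<^bsub>semidirect G H B\<^esub> \<one>\<^bsub>semidirect G H B\<^esub>) \<in> W_semidirect"
    unfolding u0 W_semidirect_def using G.W_unit H.W_unit V_unit act_unit[OF G.u0_image] by simp
  show "W_semidirect \<subseteq> chart (charts (semidirect G H B)) \<one>\<^bsub>semidirect G H B\<^esub> ` chart_dom (charts (semidirect G H B)) \<one>\<^bsub>semidirect G H B\<^esub>
      \<times> chart (charts (semidirect G H B)) \<one>\<^bsub>semidirect G H B\<^esub> ` chart_dom (charts (semidirect G H B)) \<one>\<^bsub>semidirect G H B\<^esub>"
    unfolding semidirect_simps chart_prod chart_dom_prod fst_conv snd_conv map_prod_surj_on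
    using W_semidirect_image by (force simp: image_iff)
  show "chart_inv (charts (semidirect G H B)) \<one>\<^bsub>semidirect G H B\<^esub> u \<otimes>\<^bsub>semidirect G H B\<^esub>
      chart_inv (charts (semidirect G H B)) \<one>\<^bsub>semidirect G H B\<^esub> v \<in> chart_dom (charts (semidirect G H B)) \<one>\<^bsub>semidirect G H B\<^esub>"
    if "(u, v) \<in> W_semidirect" for u v
    using semidirect_mult_in_chart(1)[OF that] unfolding semidirect_simps(1,2) .
  show "C2_on W_semidirect (\<lambda>z. chart (charts (semidirect G H B)) \<one>\<^bsub>semidirect G H B\<^esub>
      (chart_inv (charts (semidirect G H B)) \<one>\<^bsub>semidirect G H B\<^esub> (fst z) \<otimes>\<^bsub>semidirect G H B\<^esub>
       chart_inv (charts (semidirect G H B)) \<one>\<^bsub>semidirect G H B\<^esub> (snd z)))"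
    unfolding semidirect_simps(1,2)
    by (rule C2_on_cong[OF C2_semidirect_mult]) (use semidirect_mult_in_chart(2) in force)
qed

sublocale S: C2_group "semidirect G H B" W_semidirect
  by (rule C2_group_semidirect)

lemma S_u0: "S.u0 = (G.u0, H.u0)"
  by (simp add: semidirect_simps chart_prod)

lemma S_chart_mult: "z \<in> W_semidirect \<Longrightarrow> S.chart_mult z = semidirect_mult z"
  using semidirect_mult_in_chart(2)[of "fst z" "snd z"]
  unfolding S.chart_mult_def semidirect_simps(1,2) by simp

section \<open>The bracket of the semidirect product\<close>

text \<open>The extra term b(X1) Y2 arises because the left invariant field carries Y2 transformed
  by \<open>beta\<close>, which varies with the G-component of the base point.\<close>

lemma mult_hessian_semidirect:
  "S.mult_hessian (X\<^sub>1, Y\<^sub>1) (X\<^sub>2, Y\<^sub>2) = (G.mult_hessian X\<^sub>1 X\<^sub>2, H.mult_hessian Y\<^sub>1 Y\<^sub>2 + b X\<^sub>1 Y\<^sub>2)"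
proof -
  let ?D = "\<lambda>p. (dir_deriv G.chart_mult (fst p, G.u0) (0, X\<^sub>2), dir_deriv H.chart_mult (snd p, H.u0) (0, beta (fst p) Y\<^sub>2))"
  \<comment> \<open>Left invariant fields near the unit: the H-component of a direction passes
    through \<open>beta\<close> at the G-component of p before it is translated in H.\<close>
  have first: "dir_deriv S.chart_mult (p, S.u0) (0, (X\<^sub>2, Y\<^sub>2)) = ?D p" if p: "(p, S.u0) \<in> W_semidirect" for p
  proof (rule dir_derivI)
    have W: "(fst p, G.u0) \<in> WG" "(fst p, H.u0) \<in> V" "(snd p, H.u0) \<in> WH"
      using p act_unit[OF V0_image, of "fst p"] unfolding W_semidirect_def S_u0 by auto
    have act0: "act (fst p, H.u0) = H.u0" using W V0_image by (intro act_unit) auto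
    have 1: "has_dir_deriv (\<lambda>z. G.chart_mult (fst (fst z), fst (snd z))) (p, S.u0) (0, (X\<^sub>2, Y\<^sub>2)) (dir_deriv G.chart_mult (fst p, G.u0) (0, X\<^sub>2))"
      using has_dir_deriv_compose[OF C2_on_C1[OF G.chart_mult_C2] _ has_dir_deriv_linear[of "\<lambda>z. (fst (fst z), fst (snd z))"],
          of "(p, S.u0)" "(0, (X\<^sub>2, Y\<^sub>2))"] W(1)
      by (simp add: S_u0 linear_iff)
    have 2: "has_dir_deriv (\<lambda>z. act (fst (fst z), snd (snd z))) (p, S.u0) (0, (X\<^sub>2, Y\<^sub>2)) (beta (fst p) Y\<^sub>2)"
      using has_dir_deriv_compose[OF C2_on_C1[OF act_C2] _ has_dir_deriv_linear[of "\<lambda>z. (fst (fst z), snd (snd z))"],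
          of "(p, S.u0)" "(0, (X\<^sub>2, Y\<^sub>2))"] W(2)
      by (simp add: S_u0 linear_iff beta_def)
    have 3: "has_dir_deriv (\<lambda>z. snd (fst z)) (p, S.u0) (0, (X\<^sub>2, Y\<^sub>2)) 0"
      using has_dir_deriv_linear[of "\<lambda>z::('a \<times> 'b) \<times> 'a \<times> 'b. snd (fst z)" "(p, S.u0)" "(0, (X\<^sub>2, Y\<^sub>2))"]
      by (simp add: linear_iff)
    have 4: "has_dir_deriv (\<lambda>z. H.chart_mult (snd (fst z), act (fst (fst z), snd (snd z)))) (p, S.u0) (0, (X\<^sub>2, Y\<^sub>2))
        (dir_deriv H.chart_mult (snd p, H.u0) (0, beta (fst p) Y\<^sub>2))"
      using has_dir_deriv_compose[OF C2_on_C1[OF H.chart_mult_C2] _ has_dir_deriv_Pair[OF 3 2]] W(3) act0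
      by (simp add: S_u0)
    show "has_dir_deriv S.chart_mult (p, S.u0) (0, (X\<^sub>2, Y\<^sub>2)) (?D p)"
      by (rule has_dir_deriv_transform[OF has_dir_deriv_Pair[OF 1 4] C2_on_open[OF C2_semidirect_mult] p])
        (simp add: S_chart_mult semidirect_mult_def)
  qed
  have "S.mult_hessian (X\<^sub>1, Y\<^sub>1) (X\<^sub>2, Y\<^sub>2) = dir_deriv (\<lambda>p. dir_deriv S.chart_mult (p, S.u0) (0, (X\<^sub>2, Y\<^sub>2))) S.u0 (X\<^sub>1, Y\<^sub>1)"
    unfolding S.mult_hessian_def second_deriv_def by (rule dir_deriv_slice_left[symmetric])
  also have "\<dots> = dir_deriv ?D S.u0 (X\<^sub>1, Y\<^sub>1)"
    by (rule dir_deriv_cong[OF S.open_slices(1)]) (use S.W_unit first in auto)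
  also have "\<dots> = (G.mult_hessian X\<^sub>1 X\<^sub>2, H.mult_hessian Y\<^sub>1 Y\<^sub>2 + b X\<^sub>1 Y\<^sub>2)"
  proof (rule dir_derivI[OF has_dir_deriv_Pair])
    have f: "has_dir_deriv fst S.u0 (X\<^sub>1, Y\<^sub>1) X\<^sub>1" and s: "has_dir_deriv snd S.u0 (X\<^sub>1, Y\<^sub>1) Y\<^sub>1"
      using has_dir_deriv_fst[OF has_dir_deriv_ident, of S.u0 "(X\<^sub>1, Y\<^sub>1)"]
        has_dir_deriv_snd[OF has_dir_deriv_ident, of S.u0 "(X\<^sub>1, Y\<^sub>1)"] by simp_all
    have "has_dir_deriv (\<lambda>p. dir_deriv G.chart_mult (fst p, G.u0) (0, X\<^sub>2)) S.u0 (X\<^sub>1, Y\<^sub>1)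
        (second_deriv G.chart_mult (fst S.u0, G.u0) (0, X\<^sub>2) (X\<^sub>1, 0) + dir_deriv G.chart_mult (fst S.u0, G.u0) 0)"
      by (intro has_dir_deriv_dir_deriv[OF G.chart_mult_C2] has_dir_deriv_Pair f has_dir_deriv_const)
        (simp add: S_u0 G.W_unit)
    then show "has_dir_deriv (\<lambda>p. dir_deriv G.chart_mult (fst p, G.u0) (0, X\<^sub>2)) S.u0 (X\<^sub>1, Y\<^sub>1) (G.mult_hessian X\<^sub>1 X\<^sub>2)"
      by (simp add: S_u0 dir_deriv_zero_direction G.mult_hessian_def)
    have "has_dir_deriv (\<lambda>p. beta (fst p) Y\<^sub>2) S.u0 (X\<^sub>1, Y\<^sub>1) (b X\<^sub>1 Y\<^sub>2)"
      using has_dir_deriv_compose[OF C2_on_C1[OF beta_C2] _ f] u0_V0 by (simp add: S_u0 b_dir_deriv)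
    then have "has_dir_deriv (\<lambda>p. dir_deriv H.chart_mult (snd p, H.u0) (0, beta (fst p) Y\<^sub>2)) S.u0 (X\<^sub>1, Y\<^sub>1)
        (second_deriv H.chart_mult (snd S.u0, H.u0) (0, beta (fst S.u0) Y\<^sub>2) (Y\<^sub>1, 0) + dir_deriv H.chart_mult (snd S.u0, H.u0) (0, b X\<^sub>1 Y\<^sub>2))"
      by (intro has_dir_deriv_dir_deriv[OF H.chart_mult_C2] has_dir_deriv_Pair s has_dir_deriv_const)
        (simp add: S_u0 H.W_unit)
    then show "has_dir_deriv (\<lambda>p. dir_deriv H.chart_mult (snd p, H.u0) (0, beta (fst p) Y\<^sub>2)) S.u0 (X\<^sub>1, Y\<^sub>1)
        (H.mult_hessian Y\<^sub>1 Y\<^sub>2 + b X\<^sub>1 Y\<^sub>2)"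
      by (simp add: S_u0 beta_u0 H.mult_hessian_def H.dir_deriv_chart_mult_right[OF H.u0_image])
  qed
  finally show ?thesis .
qed

lemma ad_semidirect:
  "ad (semidirect G H B) (X\<^sub>1, Y\<^sub>1) (X\<^sub>2, Y\<^sub>2) = (ad G X\<^sub>1 X\<^sub>2, ad H Y\<^sub>1 Y\<^sub>2 + b X\<^sub>1 Y\<^sub>2 - b X\<^sub>2 Y\<^sub>1)"
  unfolding S.ad_mult_hessian mult_hessian_semidirect G.ad_mult_hessian H.ad_mult_hessian by simp

end

section \<open>Connection and curvature\<close>

text \<open>Boundedness has done its work in \<open>b_skew\<close>; what remains is algebra, and for
  that this notion passes to the product metric directly.\<close>

definition pos_def_form :: "('a::real_vector \<Rightarrow> 'a \<Rightarrow> real) \<Rightarrow> bool"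
  where "pos_def_form ip \<longleftrightarrow> bilinear ip \<and> (\<forall>X Y. ip X Y = ip Y X) \<and> (\<forall>X. X \<noteq> 0 \<longrightarrow> ip X X > 0)"

lemma pos_def_form_bilinear: "pos_def_form ip \<Longrightarrow> bilinear ip"
  unfolding pos_def_form_def by (rule conjunct1)

lemma pos_def_form_sym: "pos_def_form ip \<Longrightarrow> ip X Y = ip Y X"
  unfolding pos_def_form_def by (drule conjunct2, drule conjunct1) (elim allE)

lemma pos_def_form_pos: "pos_def_form ip \<Longrightarrow> X \<noteq> 0 \<Longrightarrow> ip X X > 0"
  unfolding pos_def_form_def by simp

lemma bounded_inner_product_pos_def: "bounded_inner_product ip \<Longrightarrow> pos_def_form ip"
  unfolding bounded_inner_product_def pos_def_form_def by (elim conjE) (intro conjI)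

lemma pos_def_form_prod_ip:
  assumes G: "pos_def_form ipG" and H: "pos_def_form ipH"
  shows "pos_def_form (prod_ip ipG ipH)"
proof -
  note bG = pos_def_form_bilinear[OF G] and bH = pos_def_form_bilinear[OF H]
  have "bilinear (prod_ip ipG ipH)"
    unfolding bilinear_def linear_iff prod_ip_def
    by (auto simp: case_prod_unfold bilinear_ladd[OF bG] bilinear_radd[OF bG] bilinear_lmul[OF bG] bilinear_rmul[OF bG]
        bilinear_ladd[OF bH] bilinear_radd[OF bH] bilinear_lmul[OF bH] bilinear_rmul[OF bH] algebra_simps)
  moreover have "prod_ip ipG ipH X X > 0" if "X \<noteq> 0" for X
  proof -
    have G0: "ipG x x \<ge> 0" for x
      using pos_def_form_pos[OF G, of x] bilinear_lzero[OF bG, of 0] by (cases "x = 0") auto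
    have H0: "ipH y y \<ge> 0" for y
      using pos_def_form_pos[OF H, of y] bilinear_lzero[OF bH, of 0] by (cases "y = 0") auto
    from that have "fst X \<noteq> 0 \<or> snd X \<noteq> 0" by (auto simp: prod_eq_iff)
    then have "ipG (fst X) (fst X) > 0 \<or> ipH (snd X) (snd X) > 0"
      using pos_def_form_pos[OF G] pos_def_form_pos[OF H] by auto
    then show ?thesis
      using G0[of "fst X"] H0[of "snd X"] unfolding prod_ip_def case_prod_unfold by linarith
  qed
  moreover have "prod_ip ipG ipH X Y = prod_ip ipG ipH Y X" for X Y
    using pos_def_form_sym[OF G, of "fst X" "fst Y"] pos_def_form_sym[OF H, of "snd X" "snd Y"]
    unfolding prod_ip_def case_prod_unfold by simp
  ultimately show ?thesis
    unfolding pos_def_form_def by (intro conjI allI impI)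
qed

lemma pos_def_form_ext:
  assumes "pos_def_form ip" "\<And>Z. ip X Z = ip Y Z"
  shows "X = Y"
proof (rule ccontr)
  assume "X \<noteq> Y"
  then have "ip (X - Y) (X - Y) > 0"
    by (intro pos_def_form_pos[OF assms(1)]) simp
  moreover have "ip (X - Y) (X - Y) = ip X (X - Y) - ip Y (X - Y)"
    by (rule bilinear_lsub[OF pos_def_form_bilinear[OF assms(1)]])
  ultimately show False
    using assms(2) by simp
qed

text \<open>Nondegeneracy makes a transpose unique, so the definite description picks it
  out.\<close>

lemma is_transpose_transp:
  assumes "pos_def_form ip" "has_transpose ip T"
  shows "is_transpose ip T (transp ip T)"
proof -
  obtain S where S: "is_transpose ip T S"
    using assms(2) unfolding has_transpose_def by blast
  have "S' = S" if "is_transpose ip T S'" for S'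
    using that S pos_def_form_ext[OF assms(1)] unfolding is_transpose_def by (intro ext) metis
  with S show ?thesis
    unfolding transp_def by (rule theI[of "is_transpose ip T" S])
qed

text \<open>The Koszul formula for a right invariant metric. It trades the transposes for brackets,
  so identities of the connection can be tested against vectors.\<close>

lemma ip_cov:
  assumes ip: "pos_def_form ip" and tr: "\<And>X. has_transpose ip (ad K X)"
  shows "ip (cov K ip X Y) Z = (ip Y (ad K X Z) + ip X (ad K Y Z) - ip (ad K X Y) Z) / 2"
proof -
  note bil = pos_def_form_bilinear[OF ip]
  have "ip (transp ip (ad K X) Y) Z = ip Y (ad K X Z)" for X Y Z
    using is_transpose_transp[OF ip tr] unfolding is_transpose_def by blast
  then show ?thesis
    unfolding cov_def
    by (simp add: bilinear_ladd[OF bil] bilinear_lsub[OF bil] bilinear_lmul[OF bil] field_simps)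
qed

text \<open>Additivity of \<open>transp ip (ad K X)\<close> in X is not built in; it follows by
  testing against all Z.\<close>

lemma (in C2_group) bilinear_cov:
  assumes ip: "pos_def_form ip" and tr: "\<And>X. has_transpose ip (ad K X)"
  shows "bilinear (cov K ip)"
proof -
  note bil = pos_def_form_bilinear[OF ip]
  note simps = ip_cov[OF ip tr] bilinear_ladd[OF bil] bilinear_radd[OF bil] bilinear_lmul[OF bil] bilinear_rmul[OF bil]
    bilinear_ladd[OF bilinear_ad] bilinear_radd[OF bilinear_ad] bilinear_lmul[OF bilinear_ad] bilinear_rmul[OF bilinear_ad]
  show ?thesis
    unfolding bilinear_def linear_iff
    by (intro conjI allI pos_def_form_ext[OF ip]) (simp_all add: simps field_simps)
qed

lemma gram_determinant_pos:
  assumes ip: "pos_def_form ip" and ind: "independent {P, Q}" "P \<noteq> Q"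
  shows "ip P P * ip Q Q - (ip P Q)\<^sup>2 > 0"
proof -
  note bil = pos_def_form_bilinear[OF ip] and pos = pos_def_form_pos[OF ip] and sym = pos_def_form_sym[OF ip, of Q P]
  have "Q \<noteq> 0" using ind(1) dependent_zero[of "{P, Q}"] by auto
  then have Q: "ip Q Q > 0" by (rule pos)
  \<comment> \<open>\<open>ip Q Q\<close> times the component of P orthogonal to Q; its squared
    length is \<open>ip Q Q\<close> times the Gram determinant.\<close>
  define w where "w = ip Q Q *\<^sub>R P - ip P Q *\<^sub>R Q"
  have "w \<noteq> 0"
  proof
    assume "w = 0"
    then have "inverse (ip Q Q) *\<^sub>R ip Q Q *\<^sub>R P = inverse (ip Q Q) *\<^sub>R ip P Q *\<^sub>R Q"
      unfolding w_def by simp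
    then have "P = (inverse (ip Q Q) * ip P Q) *\<^sub>R Q"
      using Q by simp
    then have "P \<in> span {Q}"
      by (metis span_base span_scale singletonI)
    moreover have "{P, Q} - {P} = {Q}" using ind(2) by auto
    ultimately show False
      using ind(1) unfolding dependent_def by auto
  qed
  then have "ip w w > 0" by (rule pos)
  also have "ip w w = ip Q Q * (ip P P * ip Q Q - (ip P Q)\<^sup>2)"
    unfolding w_def
    by (simp add: bilinear_lsub[OF bil] bilinear_rsub[OF bil] bilinear_lmul[OF bil] bilinear_rmul[OF bil] sym
        power2_eq_square algebra_simps)
  finally show ?thesis
    using Q by (simp add: zero_less_mult_iff)
qed

section \<open>Splitting of the curvature\<close>

context C2_action
begin

lemma curvature_semidirect:
  assumes ipG: "pos_def_form ipG" and ipH: "pos_def_form ipH"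
    and trG: "\<And>X. has_transpose ipG (ad G X)" and trH: "\<And>Y. has_transpose ipH (ad H Y)"
    and h: "\<And>X Y Y'. ipH (b X Y) Y' = ipG (h Y Y') X"
    and skew: "\<And>X Y Y'. ipH (b X Y) Y' = - ipH Y (b X Y')"
  shows "curvature (semidirect G H B) (prod_ip ipG ipH) (X\<^sub>1, Y\<^sub>1) (X\<^sub>2, Y\<^sub>2) (X\<^sub>3, Y\<^sub>3)
    = (curvature G ipG X\<^sub>1 X\<^sub>2 X\<^sub>3, curvature H ipH Y\<^sub>1 Y\<^sub>2 Y\<^sub>3)"
proof -
  let ?S = "semidirect G H B" and ?ip = "prod_ip ipG ipH" and ?C = "cov H ipH"
  note bG = pos_def_form_bilinear[OF ipG] and bH = pos_def_form_bilinear[OF ipH]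
    and symH = pos_def_form_sym[OF ipH]
  note ip = pos_def_form_prod_ip[OF ipG ipH]
  note simpsG = bilinear_ladd[OF bG] bilinear_radd[OF bG] bilinear_lsub[OF bG] bilinear_rsub[OF bG]
  note simpsH = bilinear_ladd[OF bH] bilinear_radd[OF bH] bilinear_lsub[OF bH] bilinear_rsub[OF bH]
  \<comment> \<open>The witness is read off from \<langle>D, [Y, E] + b(X) E - b(C) Y\<rangle>: the
    middle term gives -b(X) D by skewness, and the last one is \<langle>h(Y, D), C\<rangle> up to
    sign.\<close>
  have trS: "has_transpose ?ip (ad ?S P)" for P
  proof -
    obtain X Y where P: "P = (X, Y)" by force
    have "ipG (transp ipG (ad G X) A) C = ipG A (ad G X C)" "ipH (transp ipH (ad H Y) D) E = ipH D (ad H Y E)" for A C D E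
      using is_transpose_transp[OF ipG trG] is_transpose_transp[OF ipH trH] unfolding is_transpose_def by blast+
    then have "?ip (transp ipG (ad G X) A - h Y D, transp ipH (ad H Y) D - b X D) (C, E)
        = ?ip (A, D) (ad ?S P (C, E))" for A D C E
      using skew[of X D E] symH[of D "b C Y"]
      by (simp add: P ad_semidirect prod_ip_def simpsG simpsH flip: h)
    then have "is_transpose ?ip (ad ?S P) (\<lambda>(A, D). (transp ipG (ad G X) A - h Y D, transp ipH (ad H Y) D - b X D))"
      unfolding is_transpose_def by auto
    then show ?thesis unfolding has_transpose_def by blast
  qed
  \<comment> \<open>In the Koszul formula the terms containing b(C) are opposite and cancel, which
    is the antisymmetry of h. Of the terms pairing with E, those in b(A) Y cancel while those in
    b(X) D add up to twice the term, against the factor 1/2.\<close>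
  have covS: "cov ?S ?ip (X, Y) (A, D) = (cov G ipG X A, ?C Y D - b X D)" for X Y A D
  proof (rule pos_def_form_ext[OF ip])
    fix Z :: "'a \<times> 'b"
    obtain C E where Z: "Z = (C, E)" by force
    have "ipH D (b C Y) = - ipH Y (b C D)" using skew[of C Y D] symH[of D "b C Y"] by simp
    moreover have "ipH D (b X E) = - ipH (b X D) E" using skew[of X D E] by simp
    moreover have "ipH Y (b A E) = - ipH (b A Y) E" using skew[of A Y E] by simp
    ultimately show "?ip (cov ?S ?ip (X, Y) (A, D)) Z = ?ip (cov G ipG X A, ?C Y D - b X D) Z"
      unfolding ip_cov[OF ip trS] Z
      by (simp add: ad_semidirect prod_ip_def simpsH ip_cov[OF ipG trG] ip_cov[OF ipH trH] field_simps)
  qed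
  \<comment> \<open>The connection on the algebra of H is built from bracket and inner product; a
    skew derivation is infinitesimally an isometric automorphism and hence a derivation of the
    connection too.\<close>
  have bC: "b X (?C Y Z) = ?C (b X Y) Z + ?C Y (b X Z)" for X Y Z
  proof (rule pos_def_form_ext[OF ipH])
    fix E :: 'b
    have 1: "ipH Z (ad H Y (b X E)) = - ipH (b X Z) (ad H Y E) - ipH Z (ad H (b X Y) E)" for Y Z
    proof -
      have "ad H Y (b X E) = b X (ad H Y E) - ad H (b X Y) E"
        by (simp add: b_derivation)
      then show ?thesis
        using skew[of X Z "ad H Y E"] by (simp add: simpsH)
    qed
    have 2: "ipH (ad H Y Z) (b X E) = - ipH (ad H (b X Y) Z) E - ipH (ad H Y (b X Z)) E"
      using skew[of X "ad H Y Z" E] by (simp add: b_derivation simpsH)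
    show "ipH (b X (?C Y Z)) E = ipH (?C (b X Y) Z + ?C Y (b X Z)) E"
      unfolding skew[of X "?C Y Z"] simpsH ip_cov[OF ipH trH] 1 2 by (simp add: field_simps)
  qed
  note bilC = H.bilinear_cov[OF ipH trH]
  note simpsC = bilinear_ladd[OF bilC] bilinear_radd[OF bilC] bilinear_lsub[OF bilC] bilinear_rsub[OF bilC]
    bilinear_lneg[OF bilC] linear_diff[OF linear_b] linear_neg[OF linear_b_left]
  show ?thesis
    \<comment> \<open>Expanded by \<open>bC\<close>, the mixed terms leave -D(b(X1) Y2) Y3 + D(b(X2)
      Y1) Y3, which the mixed part of the bracket cancels; the commutator of b(X1) and b(X2) meets
      -b([X1, X2]).\<close>
    unfolding S.curvature_cov G.curvature_cov H.curvature_cov ad_semidirect covS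
    by (simp add: covS simpsC bC b_ad)
qed

end

theorem proposition4:
  fixes G :: "('g, 'a::locally_convex_space) lie_gp"
    and H :: "('h, 'b::locally_convex_space) lie_gp"
    and B :: "'g \<Rightarrow> 'h \<Rightarrow> 'h"
    and ipG :: "'a \<Rightarrow> 'a \<Rightarrow> real" and ipH :: "'b \<Rightarrow> 'b \<Rightarrow> real"
    and X\<^sub>1 X\<^sub>2 :: 'a and Y\<^sub>1 Y\<^sub>2 :: 'b
  assumes "lie_group G" and "lie_group H"
    and "bounded_inner_product ipG" and "bounded_inner_product ipH"
    and "smooth_action G H B"
    and "\<And>X. has_transpose ipG (ad G X)"
    and "\<And>Y. has_transpose ipH (ad H Y)"
    and "\<And>X. has_transpose ipH (infinitesimal_action G H B X)"
    and "\<exists>h :: 'b \<Rightarrow> 'b \<Rightarrow> 'a. bilinear h \<and> (\<forall>X Y Y'. ipH (infinitesimal_action G H B X Y) Y' = ipG (h Y Y') X)"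
    and "\<And>g Y Y'. g \<in> carrier G \<Longrightarrow> 
           ipH (induced_action H B g Y) (induced_action H B g Y') = ipH Y Y'"
  shows "prod_ip ipG ipH
             (curvature (semidirect G H B) (prod_ip ipG ipH) (X\<^sub>1, Y\<^sub>1) (X\<^sub>2, Y\<^sub>2) (X\<^sub>2, Y\<^sub>2))
             (X\<^sub>1, Y\<^sub>1)
           = ipG (curvature G ipG X\<^sub>1 X\<^sub>2 X\<^sub>2) X\<^sub>1 + ipH (curvature H ipH Y\<^sub>1 Y\<^sub>2 Y\<^sub>2) Y\<^sub>1
       \<and> ((X\<^sub>1, Y\<^sub>1) \<noteq> (X\<^sub>2, Y\<^sub>2) \<and> independent {(X\<^sub>1, Y\<^sub>1), (X\<^sub>2, Y\<^sub>2)} \<longrightarrow>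
          sgn (sectional_curvature (semidirect G H B) (prod_ip ipG ipH) (X\<^sub>1, Y\<^sub>1) (X\<^sub>2, Y\<^sub>2))
            = sgn (ipG (curvature G ipG X\<^sub>1 X\<^sub>2 X\<^sub>2) X\<^sub>1 + ipH (curvature H ipH Y\<^sub>1 Y\<^sub>2 Y\<^sub>2) Y\<^sub>1))"
    (is "?L = ?R \<and> _")
proof (intro conjI impI)
  obtain WG WH V where "C2_action G WG H WH B V"
    by (rule smooth_action_C2_action[OF assms(1,2,5)])
  then interpret C2_action G WG H WH B V .
  obtain h where h: "\<And>X Y Y'. ipH (b X Y) Y' = ipG (h Y Y') X"
    using assms(9) by blast
  note ipG = bounded_inner_product_pos_def[OF assms(3)]
    and ipH = bounded_inner_product_pos_def[OF assms(4)]
  have "curvature (semidirect G H B) (prod_ip ipG ipH) (X\<^sub>1, Y\<^sub>1) (X\<^sub>2, Y\<^sub>2) (X\<^sub>2, Y\<^sub>2)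
      = (curvature G ipG X\<^sub>1 X\<^sub>2 X\<^sub>2, curvature H ipH Y\<^sub>1 Y\<^sub>2 Y\<^sub>2)"
    using ipG ipH assms(6,7) h b_skew[OF assms(4,10)] by (rule curvature_semidirect)
  then show eq: "?L = ?R"
    by (simp add: prod_ip_def)
  assume "(X\<^sub>1, Y\<^sub>1) \<noteq> (X\<^sub>2, Y\<^sub>2) \<and> independent {(X\<^sub>1, Y\<^sub>1), (X\<^sub>2, Y\<^sub>2)}"
  \<comment> \<open>The denominator of the sectional curvature is the Gram determinant of two
    independent vectors; dividing by a positive number keeps the sign.\<close>
  then have "prod_ip ipG ipH (X\<^sub>1, Y\<^sub>1) (X\<^sub>1, Y\<^sub>1) * prod_ip ipG ipH (X\<^sub>2, Y\<^sub>2) (X\<^sub>2, Y\<^sub>2)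
      - (prod_ip ipG ipH (X\<^sub>1, Y\<^sub>1) (X\<^sub>2, Y\<^sub>2))\<^sup>2 > 0"
    by (intro gram_determinant_pos pos_def_form_prod_ip ipG ipH) auto
  then show "sgn (sectional_curvature (semidirect G H B) (prod_ip ipG ipH) (X\<^sub>1, Y\<^sub>1) (X\<^sub>2, Y\<^sub>2)) = sgn ?R"
    unfolding sectional_curvature_def eq by (simp add: sgn_divide)
qed

end
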